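(* There is an algorithm which, given as input MV-terms $\tau_1,\ldots,\tau_k$ in the variables $X_1,\ldots,X_n$ such that the subalgebra $A$ of $\mathcal M([0,1]^n)$ generated by $\hat\tau_1,\ldots,\hat\tau_k$ is separating, decides whether $A$ is isomorphic (as an MV-algebra) to $\mathcal M([0,1]^n)$.
   Context: A McNaughton function on $[0,1]^n$ is a continuous function $f\colon[0,1]^n\to[0,1]$ for which there are finitely many affine functions with integer coefficients $p_1,\ldots,p_m$ such that for every $x$ there is $j$ with $f(x)=p_j(x)$. $\mathcal M([0,1]^n)$ is the MV-algebra of all McNaughton functions on $[0,1]^n$ with pointwise operations $f\oplus g=\min(1,f+g)$, $\neg f=1-f$, $0$ the zero function. An MV-term $\tau(X_1,\ldots,X_n)$ is a string built from the variables $X_i$ and the constant $0$ by finitely many applications of $\neg$ and $\oplus$; $\hat\tau\in\mathcal M([0,1]^n)$ is obtained by interpreting $X_i$ as the $i$-th coordinate function and the connectives pointwise. A subalgebra $A$ is separating if for all $x\neq y$ in $[0,1]^n$ there is $f\in A$ with $f(x)\neq f(y)$. *)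

theory Defs
  imports "HOL-Analysis.Analysis" "HOL-Library.Nat_Bijection" "HOL-Algebra.Congruence"
begin

section \<open>MV-algebras\<close>

record 'a mv_structure = "'a partial_object" +
  mv_plus :: "'a \<Rightarrow> 'a \<Rightarrow> 'a"
  mv_neg :: "'a \<Rightarrow> 'a"
  mv_zero :: 'a

locale mv_algebra =
  fixes M (structure)
  assumes plus_closed: "x \<in> carrier M \<Longrightarrow> y \<in> carrier M \<Longrightarrow> mv_plus M x y \<in> carrier M"
    and neg_closed: "x \<in> carrier M \<Longrightarrow> mv_neg M x \<in> carrier M"
    and zero_closed: "mv_zero M \<in> carrier M"
    and assoc: "x \<in> carrier M \<Longrightarrow> y \<in> carrier M \<Longrightarrow> z \<in> carrier M \<Longrightarrow>
      mv_plus M (mv_plus M x y) z = mv_plus M x (mv_plus M y z)"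
    and commute: "x \<in> carrier M \<Longrightarrow> y \<in> carrier M \<Longrightarrow> mv_plus M x y = mv_plus M y x"
    and plus_zero: "x \<in> carrier M \<Longrightarrow> mv_plus M x (mv_zero M) = x"
    and neg_neg: "x \<in> carrier M \<Longrightarrow> mv_neg M (mv_neg M x) = x"
    and plus_one: "x \<in> carrier M \<Longrightarrow> mv_plus M x (mv_neg M (mv_zero M)) = mv_neg M (mv_zero M)"
    and lukasiewicz: "x \<in> carrier M \<Longrightarrow> y \<in> carrier M \<Longrightarrow>
      mv_plus M (mv_neg M (mv_plus M (mv_neg M x) y)) y =
      mv_plus M (mv_neg M (mv_plus M (mv_neg M y) x)) x"

definition mv_iso :: "('a, 'c) mv_structure_scheme \<Rightarrow> ('b, 'd) mv_structure_scheme \<Rightarrow> ('a \<Rightarrow> 'b) set" where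
  "mv_iso A B = {h. bij_betw h (carrier A) (carrier B) \<and>
     h (mv_zero A) = mv_zero B \<and>
     (\<forall>x\<in>carrier A. h (mv_neg A x) = mv_neg B (h x)) \<and>
     (\<forall>x\<in>carrier A. \<forall>y\<in>carrier A. h (mv_plus A x y) = mv_plus B (h x) (h y))}"

definition mv_isomorphic :: "('a, 'c) mv_structure_scheme \<Rightarrow> ('b, 'd) mv_structure_scheme \<Rightarrow> bool" where
  "mv_isomorphic A B \<longleftrightarrow> mv_iso A B \<noteq> {}"

inductive_set mv_generate :: "('a, 'c) mv_structure_scheme \<Rightarrow> 'a set \<Rightarrow> 'a set"
  for M and G where
  zero: "mv_zero M \<in> mv_generate M G"
| incl: "g \<in> G \<Longrightarrow> g \<in> mv_generate M G"
| neg: "x \<in> mv_generate M G \<Longrightarrow> mv_neg M x \<in> mv_generate M G"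
| plus: "x \<in> mv_generate M G \<Longrightarrow> y \<in> mv_generate M G \<Longrightarrow> mv_plus M x y \<in> mv_generate M G"

definition mv_generated :: "('a, 'c) mv_structure_scheme \<Rightarrow> 'a set \<Rightarrow> ('a, 'c) mv_structure_scheme" where
  "mv_generated M G = M\<lparr>carrier := mv_generate M G\<rparr>"

lemma (in mv_algebra) mv_generate_subset:
  assumes "G \<subseteq> carrier M"
  shows "mv_generate M G \<subseteq> carrier M"
proof
  fix x assume "x \<in> mv_generate M G"
  then show "x \<in> carrier M"
    by induction (use assms plus_closed neg_closed zero_closed in auto)
qed

lemma (in mv_algebra) mv_algebra_generated:
  assumes "G \<subseteq> carrier M"
  shows "mv_algebra (mv_generated M G)"
  using mv_generate_subset[OF assms]
  by unfold_locales
    (auto simp: mv_generated_def subset_iff assoc plus_zero neg_neg plus_one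
      intro: mv_generate.intros commute lukasiewicz)


section \<open>McNaughton functions\<close>

text \<open>
  Points of \<open>[0,1]\<^sup>n\<close> are the functions \<open>nat \<Rightarrow> real\<close> with values in \<open>[0,1]\<close> at the indices
  below \<open>n\<close> and the value \<open>undefined\<close> elsewhere, so that equality of points is equality of
  the first \<open>n\<close> coordinates.  The topology is the one induced by the product topology, which
  on this set is the Euclidean one.
\<close>

definition cube :: "nat \<Rightarrow> (nat \<Rightarrow> real) set" where
  "cube n = (\<Pi>\<^sub>E i\<in>{..<n}. {0..1})"

definition int_affine :: "nat \<Rightarrow> ((nat \<Rightarrow> real) \<Rightarrow> real) set" where
  "int_affine n = {p. \<exists>(a :: nat \<Rightarrow> int) (b :: int).
     p = (\<lambda>x. of_int b + (\<Sum>i<n. of_int (a i) * x i))}"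

definition mcnaughton_functions :: "nat \<Rightarrow> ((nat \<Rightarrow> real) \<Rightarrow> real) set" where
  "mcnaughton_functions n = {f \<in> cube n \<rightarrow>\<^sub>E {0..1}. continuous_on (cube n) f \<and>
     (\<exists>P. finite P \<and> P \<subseteq> int_affine n \<and> (\<forall>x\<in>cube n. \<exists>p\<in>P. f x = p x))}"

definition mcnaughton :: "nat \<Rightarrow> ((nat \<Rightarrow> real) \<Rightarrow> real) mv_structure" where
  "mcnaughton n = \<lparr>carrier = mcnaughton_functions n,
     mv_plus = (\<lambda>f g. \<lambda>x\<in>cube n. min 1 (f x + g x)),
     mv_neg = (\<lambda>f. \<lambda>x\<in>cube n. 1 - f x),
     mv_zero = (\<lambda>x\<in>cube n. 0)\<rparr>"

definition separating :: "nat \<Rightarrow> ((nat \<Rightarrow> real) \<Rightarrow> real) set \<Rightarrow> bool" where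
  "separating n A \<longleftrightarrow> (\<forall>x\<in>cube n. \<forall>y\<in>cube n. x \<noteq> y \<longrightarrow> (\<exists>f\<in>A. f x \<noteq> f y))"

lemma int_affine_const: "(\<lambda>x. of_int c) \<in> int_affine n"
  unfolding int_affine_def
  by (intro CollectI exI[of _ "\<lambda>_. 0"] exI[of _ c]) simp

lemma int_affine_coordinate:
  assumes "i < n" shows "(\<lambda>x. x i) \<in> int_affine n"
  unfolding int_affine_def
  by (intro CollectI exI[of _ "\<lambda>j. if j = i then 1 else 0"] exI[of _ 0])
    (use assms in \<open>simp add: if_distrib[of of_int] if_distrib[of "\<lambda>c. c * _"] sum.delta cong: if_cong\<close>)

lemma int_affine_add:
  assumes "p \<in> int_affine n" "q \<in> int_affine n"
  shows "(\<lambda>x. p x + q x) \<in> int_affine n"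
proof -
  from assms obtain a b a' b' where
    "p = (\<lambda>x. of_int b + (\<Sum>i<n. of_int (a i) * x i))"
    "q = (\<lambda>x. of_int b' + (\<Sum>i<n. of_int (a' i) * x i))"
    unfolding int_affine_def by blast
  then show ?thesis
    unfolding int_affine_def
    by (intro CollectI exI[of _ "\<lambda>i. a i + a' i"] exI[of _ "b + b'"])
      (simp add: algebra_simps sum.distrib)
qed

lemma int_affine_one_minus:
  assumes "p \<in> int_affine n"
  shows "(\<lambda>x. 1 - p x) \<in> int_affine n"
proof -
  from assms obtain a b where "p = (\<lambda>x. of_int b + (\<Sum>i<n. of_int (a i) * x i))"
    unfolding int_affine_def by blast
  then show ?thesis
    unfolding int_affine_def
    by (intro CollectI exI[of _ "\<lambda>i. - a i"] exI[of _ "1 - b"])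
      (simp add: algebra_simps sum_negf)
qed

lemma mcnaughton_zero: "(\<lambda>x\<in>cube n. 0) \<in> mcnaughton_functions n"
  unfolding mcnaughton_functions_def
proof (intro CollectI conjI)
  show "(\<lambda>x\<in>cube n. 0) \<in> cube n \<rightarrow>\<^sub>E {0..1::real}" by auto
  show "continuous_on (cube n) (\<lambda>x\<in>cube n. 0::real)"
    by (subst continuous_on_cong[OF refl, of _ _ "\<lambda>_. 0"]) auto
  show "\<exists>P. finite P \<and> P \<subseteq> int_affine n \<and> (\<forall>x\<in>cube n. \<exists>p\<in>P. (\<lambda>x\<in>cube n. 0) x = p x)"
    using int_affine_const[of 0 n] by (intro exI[of _ "{\<lambda>x. 0}"]) auto
qed

lemma mcnaughton_coordinate:
  assumes "i < n"
  shows "(\<lambda>x\<in>cube n. x i) \<in> mcnaughton_functions n"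
  unfolding mcnaughton_functions_def
proof (intro CollectI conjI)
  show "(\<lambda>x\<in>cube n. x i) \<in> cube n \<rightarrow>\<^sub>E {0..1}"
    using assms by (fastforce simp: cube_def PiE_iff)
  show "continuous_on (cube n) (\<lambda>x\<in>cube n. x i)"
    by (subst continuous_on_cong[OF refl, of _ _ "\<lambda>x. x i"])
      (auto intro: continuous_on_subset[OF continuous_on_product_coordinates])
  show "\<exists>P. finite P \<and> P \<subseteq> int_affine n \<and> (\<forall>x\<in>cube n. \<exists>p\<in>P. (\<lambda>x\<in>cube n. x i) x = p x)"
    using int_affine_coordinate[OF assms] by (intro exI[of _ "{\<lambda>x. x i}"]) auto
qed

lemma mcnaughton_neg:
  assumes "f \<in> mcnaughton_functions n"
  shows "(\<lambda>x\<in>cube n. 1 - f x) \<in> mcnaughton_functions n"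
proof -
  from assms obtain P where f: "f \<in> cube n \<rightarrow>\<^sub>E {0..1}" "continuous_on (cube n) f"
    and P: "finite P" "P \<subseteq> int_affine n" "\<forall>x\<in>cube n. \<exists>p\<in>P. f x = p x"
    unfolding mcnaughton_functions_def by blast
  show ?thesis
    unfolding mcnaughton_functions_def
  proof (intro CollectI conjI)
    show "(\<lambda>x\<in>cube n. 1 - f x) \<in> cube n \<rightarrow>\<^sub>E {0..1}"
      using f(1) by (fastforce simp: PiE_iff)
    show "continuous_on (cube n) (\<lambda>x\<in>cube n. 1 - f x)"
      by (subst continuous_on_cong[OF refl, of _ _ "\<lambda>x. 1 - f x"])
        (auto intro!: continuous_intros f(2))
    show "\<exists>P. finite P \<and> P \<subseteq> int_affine n \<and> (\<forall>x\<in>cube n. \<exists>p\<in>P. (\<lambda>x\<in>cube n. 1 - f x) x = p x)"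
      using P int_affine_one_minus by (intro exI[of _ "(\<lambda>p x. 1 - p x) ` P"]) fastforce
  qed
qed

lemma mcnaughton_plus:
  assumes "f \<in> mcnaughton_functions n" "g \<in> mcnaughton_functions n"
  shows "(\<lambda>x\<in>cube n. min 1 (f x + g x)) \<in> mcnaughton_functions n"
proof -
  from assms obtain P Q where f: "f \<in> cube n \<rightarrow>\<^sub>E {0..1}" "continuous_on (cube n) f"
    and P: "finite P" "P \<subseteq> int_affine n" "\<forall>x\<in>cube n. \<exists>p\<in>P. f x = p x"
    and g: "g \<in> cube n \<rightarrow>\<^sub>E {0..1}" "continuous_on (cube n) g"
    and Q: "finite Q" "Q \<subseteq> int_affine n" "\<forall>x\<in>cube n. \<exists>p\<in>Q. g x = p x"
    unfolding mcnaughton_functions_def by blast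
  let ?R = "insert (\<lambda>x. 1) ((\<lambda>(p, q) x. p x + q x) ` (P \<times> Q))"
  show ?thesis
    unfolding mcnaughton_functions_def
  proof (intro CollectI conjI exI[of _ ?R])
    show "(\<lambda>x\<in>cube n. min 1 (f x + g x)) \<in> cube n \<rightarrow>\<^sub>E {0..1}"
      using f(1) g(1) by (fastforce simp: PiE_iff)
    show "continuous_on (cube n) (\<lambda>x\<in>cube n. min 1 (f x + g x))"
      by (subst continuous_on_cong[OF refl, of _ _ "\<lambda>x. min 1 (f x + g x)"])
        (auto intro!: continuous_intros f(2) g(2))
    show "finite ?R" using P(1) Q(1) by simp
    show "?R \<subseteq> int_affine n"
      using int_affine_const[of 1 n] P(2) Q(2) int_affine_add by fastforce
    show "\<forall>x\<in>cube n. \<exists>p\<in>?R. (\<lambda>x\<in>cube n. min 1 (f x + g x)) x = p x"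
    proof
      fix x assume x: "x \<in> cube n"
      with P(3) Q(3) obtain p q where pq: "p \<in> P" "q \<in> Q" "f x = p x" "g x = q x" by blast
      show "\<exists>p\<in>?R. (\<lambda>x\<in>cube n. min 1 (f x + g x)) x = p x"
      proof (cases "f x + g x \<le> 1")
        case True
        then show ?thesis
          using x pq by (intro bexI[of _ "\<lambda>x. p x + q x"]) (auto intro!: image_eqI[of _ _ "(p, q)"])
      next
        case False
        then show ?thesis using x by (intro bexI[of _ "\<lambda>x. 1"]) auto
      qed
    qed
  qed
qed

lemma mv_algebra_mcnaughton: "mv_algebra (mcnaughton n)"
proof -
  have rng: "0 \<le> f x" "f x \<le> 1" if "f \<in> mcnaughton_functions n" "x \<in> cube n" for f x
    using that by (auto simp: mcnaughton_functions_def PiE_iff)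
  have extn: "f \<in> extensional (cube n)" if "f \<in> mcnaughton_functions n" for f
    using that by (auto simp: mcnaughton_functions_def PiE_iff)
  show ?thesis
  proof (unfold_locales, goal_cases)
    case (4 f g h)
    show ?case
    proof
      fix x
      show "mv_plus (mcnaughton n) (mv_plus (mcnaughton n) f g) h x =
          mv_plus (mcnaughton n) f (mv_plus (mcnaughton n) g h) x"
        using 4 rng[of f x] rng[of g x] rng[of h x]
        by (auto simp: mcnaughton_def min_def)
    qed
  next
    case (6 f)
    then show ?case
      by (intro extensionalityI[of _ "cube n"]) (auto simp: mcnaughton_def extn min_def dest: rng)
  next
    case (7 f)
    then show ?case
      by (intro extensionalityI[of _ "cube n"]) (auto simp: mcnaughton_def extn)
  next
    case (8 f)
    show ?case
    proof
      fix x
      show "mv_plus (mcnaughton n) f (mv_neg (mcnaughton n) (mv_zero (mcnaughton n))) x =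
          mv_neg (mcnaughton n) (mv_zero (mcnaughton n)) x"
        using 8 rng[of f x] by (auto simp: mcnaughton_def min_def)
    qed
  next
    case (9 f g)
    show ?case
    proof
      fix x
      show "mv_plus (mcnaughton n) (mv_neg (mcnaughton n) (mv_plus (mcnaughton n)
            (mv_neg (mcnaughton n) f) g)) g x =
          mv_plus (mcnaughton n) (mv_neg (mcnaughton n) (mv_plus (mcnaughton n)
            (mv_neg (mcnaughton n) g) f)) f x"
        using 9 rng[of f x] rng[of g x] by (auto simp: mcnaughton_def min_def)
    qed
  qed (auto simp: mcnaughton_def add.commute mcnaughton_plus mcnaughton_neg mcnaughton_zero)
qed


section \<open>MV-terms\<close>

text \<open>\<open>TVar i\<close> is the variable \<open>X\<^bsub>i+1\<^esub>\<close>.\<close>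

datatype mv_term = TVar nat | TZero | TNeg mv_term | TPlus mv_term mv_term

primrec term_vars :: "mv_term \<Rightarrow> nat set" where
  "term_vars (TVar i) = {i}"
| "term_vars TZero = {}"
| "term_vars (TNeg t) = term_vars t"
| "term_vars (TPlus s t) = term_vars s \<union> term_vars t"

primrec term_value :: "('a, 'c) mv_structure_scheme \<Rightarrow> (nat \<Rightarrow> 'a) \<Rightarrow> mv_term \<Rightarrow> 'a" where
  "term_value M v (TVar i) = v i"
| "term_value M v TZero = mv_zero M"
| "term_value M v (TNeg t) = mv_neg M (term_value M v t)"
| "term_value M v (TPlus s t) = mv_plus M (term_value M v s) (term_value M v t)"

definition term_function :: "nat \<Rightarrow> mv_term \<Rightarrow> (nat \<Rightarrow> real) \<Rightarrow> real" where
  "term_function n = term_value (mcnaughton n) (\<lambda>i. \<lambda>x\<in>cube n. x i)"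

lemma term_function_mcnaughton:
  "term_vars t \<subseteq> {..<n} \<Longrightarrow> term_function n t \<in> carrier (mcnaughton n)"
  by (induction t)
    (auto simp: term_function_def mcnaughton_def mcnaughton_coordinate mcnaughton_zero
      mcnaughton_neg mcnaughton_plus)


section \<open>Partial recursive functions\<close>

text \<open>
  An algorithm is a Kleene description of a partial recursive function of several natural
  number arguments, and \<open>computes f xs y\<close> says that the computation of \<open>f\<close> on the arguments
  \<open>xs\<close> halts with the value \<open>y\<close>.  In \<open>Prec f g\<close> the recursion runs over the first argument,
  and \<open>Mini f\<close> searches for the least value of the first argument at which \<open>f\<close> vanishes,
  all earlier values being defined.
\<close>

datatype recf = Const0 | Succ | Proj nat | Comp recf "recf list" | Prec recf recf | Mini recf

inductive computes :: "recf \<Rightarrow> nat list \<Rightarrow> nat \<Rightarrow> bool" where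
  Const0: "computes Const0 xs 0"
| Succ: "computes Succ [x] (Suc x)"
| Proj: "i < length xs \<Longrightarrow> computes (Proj i) xs (xs ! i)"
| Comp: "list_all2 (\<lambda>g y. computes g xs y) gs ys \<Longrightarrow> computes f ys z \<Longrightarrow> computes (Comp f gs) xs z"
| Prec_0: "computes f xs y \<Longrightarrow> computes (Prec f g) (0 # xs) y"
| Prec_Suc: "computes (Prec f g) (k # xs) r \<Longrightarrow> computes g (k # r # xs) y \<Longrightarrow>
    computes (Prec f g) (Suc k # xs) y"
| Mini: "computes f (z # xs) 0 \<Longrightarrow> (\<forall>y<z. \<exists>v. computes f (y # xs) (Suc v)) \<Longrightarrow>
    computes (Mini f) xs z"

lemma computes_deterministic:
  "computes f xs y \<Longrightarrow> computes f xs y' \<Longrightarrow> y = y'"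
proof (induction arbitrary: y' rule: computes.induct)
  case (Comp xs gs ys f z)
  from Comp.prems obtain ys' where ys': "list_all2 (\<lambda>g y. computes g xs y) gs ys'" "computes f ys' y'"
    by (auto elim: computes.cases)
  have "ys = ys'"
    using Comp.IH(1) ys'(1)
    by (intro nth_equalityI) (auto simp: list_all2_conv_all_nth)
  with Comp.IH(2) ys'(2) show ?case by simp
next
  case (Prec_0 f xs y g)
  from Prec_0.prems show ?case by (auto elim: computes.cases intro: Prec_0.IH)
next
  case (Prec_Suc f g k xs r y)
  from Prec_Suc.prems obtain r' where "computes (Prec f g) (k # xs) r'" "computes g (k # r' # xs) y'"
    by (auto elim: computes.cases)
  with Prec_Suc.IH show ?case by metis
next
  case (Mini f z xs)
  from Mini.prems have *: "computes f (y' # xs) 0" "\<forall>y<y'. \<exists>v. computes f (y # xs) (Suc v)"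
    by (auto elim: computes.cases)
  show ?case
  proof (rule linorder_cases[of z y'])
    assume "z < y'"
    with * Mini.IH(1) show ?thesis by blast
  next
    assume "y' < z"
    with * Mini.IH(2) show ?thesis by blast
  qed
qed (auto elim: computes.cases)

primrec term_code :: "mv_term \<Rightarrow> nat" where
  "term_code (TVar i) = 3 * i + 1"
| "term_code TZero = 0"
| "term_code (TNeg t) = 3 * term_code t + 2"
| "term_code (TPlus s t) = 3 * prod_encode (term_code s, term_code t) + 3"

lemma term_code_inject: "term_code s = term_code t \<Longrightarrow> s = t"
proof (induction s arbitrary: t)
  case (TVar i)
  then show ?case by (cases t) (simp_all, presburger+)
next
  case TZero
  then show ?case by (cases t) simp_all
next
  case (TNeg s)
  then show ?case by (cases t) (simp_all, presburger+)
next
  case (TPlus s1 s2)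
  then show ?case by (cases t) (simp_all, presburger+)
qed

definition terms_code :: "mv_term list \<Rightarrow> nat" where
  "terms_code ts = list_encode (map term_code ts)"

end

theory Submission
  imports Defs
begin

text \<open>
  Let \<open>F\<close> be the map from the cube given by the generators; separation says that \<open>F\<close> is injective.
  The algebra \<open>A\<close> is isomorphic to the full one iff \<open>F\<close> preserves denominators, iff \<open>A\<close> is the full
  algebra: homomorphisms into the chain with \<open>D + 1\<close> elements are evaluations at points whose
  image has denominator dividing \<open>D\<close>, and an isomorphism preserves their finite number.
  Conversely, let \<open>\<phi>\<close> be a McNaughton function, and cut the cube into finitely many full-dimensional
  polytopes \<open>C\<close> on which \<open>\<phi>\<close> and the generators are affine.  If \<open>F\<close> preserves denominators, its
  restriction to \<open>C\<close> has an integer affine left inverse \<open>L\<close>, so \<open>\<phi> = \<phi>\<^sub>C \<circ> L \<circ> F\<close> on \<open>C\<close> with \<open>\<phi>\<^sub>C\<close> an integer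
  affine function.  The polytope \<open>F C\<close> is cut out of the image of \<open>F\<close> by finitely many inequalities
  \<open>s \<le> 0\<close> between integer affine functions of the generators, and a piecewise linear error bound yields \<open>N\<close> with
  \<open>\<phi>\<^sub>C \<circ> L \<circ> F - N * (\<Sum>s. clip s) \<le> \<phi>\<close> everywhere.  The left-hand side is an integer combination of
  elements of \<open>A\<close>, so its truncation to \<open>[0,1]\<close> lies in \<open>A\<close>, and \<open>\<phi>\<close> is the maximum of these truncations.

  Both answers then have finite certificates, and the algorithm searches for either: a rational
  point at which \<open>F\<close> lowers the denominator, or terms that recover the coordinates from the
  generators.  Terms are compared on a finite grid, which suffices because a solvable system of
  integer inequalities has a rational solution of bounded denominator.
\<close>

section \<open>Fourier-Motzkin elimination\<close>

text \<open>That \<open>L\<close> has integer coefficients is not read off from vertices. The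
  coefficient vectors realised on \<open>C\<close> by integer combinations of the generators form a
  subgroup of \<int>^(n+1), and a coordinate outside it would be detected by a character of the
  quotient, which is then read as a rational point. Full dimension of \<open>C\<close> places this
  point inside \<open>C\<close>, since translates of a fine enough lattice meet every ball. Outside
  \<open>C\<close> nothing is known about the composite with \<open>L\<close>, hence the penalty.
  Compactness alone does not bound the multiplier \<open>N\<close>, because the excess over \<phi>
  and the penalty both vanish on \<open>C\<close>; a certificate of infeasibility is extracted from
  Fourier-Motzkin elimination instead. The same elimination, with control of integer coefficients,
  bounds the denominators needed by the algorithm. McNaughton's theorem is not presupposed: it is
  the case where \<open>F\<close> is the identity, and it is what turns homomorphisms into
  evaluations at points.\<close>

definition affine_fun :: "nat \<Rightarrow> ((nat \<Rightarrow> real) \<Rightarrow> real) \<Rightarrow> bool" where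
  "affine_fun n f \<longleftrightarrow> (\<exists>a b. f = (\<lambda>x. b + (\<Sum>i<n. a i * x i)))"

definition sat :: "((nat \<Rightarrow> real) \<Rightarrow> real) \<times> bool \<Rightarrow> (nat \<Rightarrow> real) \<Rightarrow> bool" where
  "sat c x \<longleftrightarrow> (if snd c then fst c x > 0 else fst c x \<ge> 0)"

text \<open>Constraints are stored as functions, not as coefficient vectors, so the coefficient of
  the variable with index \<open>n\<close> is recovered as a difference of two values.\<close>

definition lead :: "nat \<Rightarrow> ((nat \<Rightarrow> real) \<Rightarrow> real) \<Rightarrow> real" where
  "lead n f = f ((\<lambda>_. 0)(n := 1)) - f (\<lambda>_. 0)"

lemma lead_affine:
  "lead n (\<lambda>x. b + (\<Sum>i<Suc n. a i * x i)) = a n"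
  by (simp add: lead_def sum.neutral)

lemma affine_fun_upd:
  assumes "affine_fun (Suc n) f"
  shows "f (x(n := t)) = f x + lead n f * (t - x n)"
proof -
  obtain a b where f: "f = (\<lambda>x. b + (\<Sum>i<Suc n. a i * x i))"
    using assms by (auto simp: affine_fun_def)
  show ?thesis unfolding f lead_affine by (simp add: algebra_simps)
qed

text \<open>The multipliers make the variable with index \<open>n\<close> cancel. They are positive
  when \<open>l\<close> bounds it from below and \<open>u\<close> from above, and no division
  occurs, so integer coefficients stay integer.\<close>

definition combine :: "nat \<Rightarrow> ((nat \<Rightarrow> real) \<Rightarrow> real) \<times> bool \<Rightarrow> ((nat \<Rightarrow> real) \<Rightarrow> real) \<times> bool \<Rightarrow>
    ((nat \<Rightarrow> real) \<Rightarrow> real) \<times> bool" where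
  "combine n l u = ((\<lambda>x. lead n (fst l) * fst u x + (- lead n (fst u)) * fst l x), snd l \<or> snd u)"

definition eliminate :: "nat \<Rightarrow> (((nat \<Rightarrow> real) \<Rightarrow> real) \<times> bool) set \<Rightarrow> (((nat \<Rightarrow> real) \<Rightarrow> real) \<times> bool) set" where
  "eliminate n S = {c \<in> S. lead n (fst c) = 0} \<union>
     (\<lambda>(l, u). combine n l u) ` ({c \<in> S. lead n (fst c) > 0} \<times> {c \<in> S. lead n (fst c) < 0})"

lemma finite_eliminate: "finite S \<Longrightarrow> finite (eliminate n S)"
  by (simp add: eliminate_def)

lemma affine_fun_lead0:
  assumes "affine_fun (Suc n) f" "lead n f = 0" shows "affine_fun n f"
proof -
  obtain a b where f: "f = (\<lambda>x. b + (\<Sum>i<Suc n. a i * x i))"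
    using assms by (auto simp: affine_fun_def)
  with assms(2) have "a n = 0" by (simp add: lead_affine del: sum.lessThan_Suc)
  with f have "f = (\<lambda>x. b + (\<Sum>i<n. a i * x i))" by simp
  then show ?thesis by (auto simp: affine_fun_def)
qed

lemma affine_fun_lincomb:
  assumes "affine_fun n f" "affine_fun n g" shows "affine_fun n (\<lambda>x. s * f x + t * g x)"
proof -
  obtain a b a' b' where f: "f = (\<lambda>x. b + (\<Sum>i<n. a i * x i))" "g = (\<lambda>x. b' + (\<Sum>i<n. a' i * x i))"
    using assms by (auto simp: affine_fun_def)
  then have "(\<lambda>x. s * f x + t * g x) = (\<lambda>x. (s * b + t * b') + (\<Sum>i<n. (s * a i + t * a' i) * x i))"
    by (simp add: algebra_simps sum.distrib sum_distrib_left)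
  then show ?thesis by (auto simp: affine_fun_def)
qed

lemma affine_fun_eliminate:
  assumes "\<And>c. c \<in> S \<Longrightarrow> affine_fun (Suc n) (fst c)" "c \<in> eliminate n S"
  shows "affine_fun n (fst c)"
proof -
  consider "c \<in> S" "lead n (fst c) = 0"
    | l u where "l \<in> S" "u \<in> S" "lead n (fst l) > 0" "lead n (fst u) < 0" "c = combine n l u"
    using assms(2) by (auto simp: eliminate_def)
  then show ?thesis
  proof cases
    case 1 then show ?thesis using assms(1) affine_fun_lead0 by blast
  next
    case 2
    have "affine_fun (Suc n) (fst c)"
      unfolding 2(5) combine_def fst_conv by (intro affine_fun_lincomb assms(1) 2)
    moreover have "lead n (fst c) = 0"
      unfolding 2(5) combine_def fst_conv lead_def by (simp add: algebra_simps)
    ultimately show ?thesis by (rule affine_fun_lead0)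
  qed
qed

lemma sat_eliminate:
  assumes "\<And>c. c \<in> S \<Longrightarrow> sat c x" "c \<in> eliminate n S"
  shows "sat c x"
proof -
  consider "c \<in> S" "lead n (fst c) = 0"
    | l u where "l \<in> S" "u \<in> S" "lead n (fst l) > 0" "lead n (fst u) < 0" "c = combine n l u"
    using assms(2) by (auto simp: eliminate_def)
  then show ?thesis
  proof cases
    case 1 then show ?thesis using assms(1) by blast
  next
    case 2
    then have s: "sat l x" "sat u x" using assms(1) by auto
    then have p: "0 \<le> fst l x" "0 \<le> fst u x" "snd l \<Longrightarrow> 0 < fst l x" "snd u \<Longrightarrow> 0 < fst u x"
      by (auto simp: sat_def split: if_splits)
    define lu ll lf uf where "lu = - lead n (fst u)" and "ll = lead n (fst l)" and "lf = fst l x" and "uf = fst u x"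
    have "lu > 0" "ll > 0" using 2 by (auto simp: lu_def ll_def)
    with p have "0 \<le> ll * uf" "0 \<le> lu * lf" "snd l \<Longrightarrow> 0 < lu * lf" "snd u \<Longrightarrow> 0 < ll * uf"
      by (auto simp: uf_def lf_def)
    then have "if snd l \<or> snd u then ll * uf + lu * lf > 0 else ll * uf + lu * lf \<ge> 0"
      by (auto intro: add_pos_nonneg add_nonneg_pos)
    then show ?thesis unfolding 2(5) sat_def combine_def fst_conv snd_conv lu_def ll_def lf_def uf_def .
  qed
qed

text \<open>The eliminated variable is given the midpoint of the tightest lower and upper bound, so that
  its denominator is controlled.\<close>

lemma eliminate_lift:
  assumes fin: "finite S" and aff: "\<And>c. c \<in> S \<Longrightarrow> affine_fun (Suc n) (fst c)"
    and sat: "\<And>c. c \<in> eliminate n S \<Longrightarrow> sat c x"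
  defines "\<beta> \<equiv> \<lambda>c. x n - fst c x / lead n (fst c)"
  obtains t where "\<And>c. c \<in> S \<Longrightarrow> sat c (x(n := t))"
    "t = 0 \<or> (\<exists>c\<in>S. lead n (fst c) \<noteq> 0 \<and> (t = \<beta> c + 1 \<or> t = \<beta> c - 1)) \<or>
     (\<exists>c\<in>S. \<exists>d\<in>S. lead n (fst c) \<noteq> 0 \<and> lead n (fst d) \<noteq> 0 \<and> t = (\<beta> c + \<beta> d) / 2)"
proof -
  let ?L = "{c \<in> S. lead n (fst c) > 0}" and ?U = "{c \<in> S. lead n (fst c) < 0}"
  \<comment> \<open>\<open>\<beta> c\<close> is the value of the eliminated variable at which
    \<open>c\<close> holds with equality: a lower bound if the leading coefficient is positive, an
    upper bound if it is negative.\<close>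
  have val: "fst c (x(n := t)) = lead n (fst c) * (t - \<beta> c)" if "c \<in> S" "lead n (fst c) \<noteq> 0" for c t
    using affine_fun_upd[OF aff[OF that(1)], of x t] that(2) by (simp add: \<beta>_def right_diff_distrib)
  have Z: "sat c (x(n := t))" if "c \<in> S" "lead n (fst c) = 0" for c t
    using sat[of c] that affine_fun_upd[OF aff[OF that(1)], of x t]
    by (simp add: eliminate_def sat_def)
  have Lc: "sat c (x(n := t))" if "c \<in> ?L" "if snd c then \<beta> c < t else \<beta> c \<le> t" for c t
    using that val[of c t] by (auto simp: sat_def split: if_splits)
  have Uc: "sat c (x(n := t))" if "c \<in> ?U" "if snd c then t < \<beta> c else t \<le> \<beta> c" for c t
    using that val[of c t] by (auto simp: sat_def mult_nonpos_nonpos mult_neg_neg split: if_splits)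
  have LU: "if snd l \<or> snd u then \<beta> l < \<beta> u else \<beta> l \<le> \<beta> u" if "l \<in> ?L" "u \<in> ?U" for l u
  proof -
    have "combine n l u \<in> eliminate n S" using that by (auto simp: eliminate_def)
    then have "sat (combine n l u) x" by (rule sat)
    moreover have "fst (combine n l u) x = (\<beta> u - \<beta> l) * (lead n (fst l) * (- lead n (fst u)))"
      using that by (simp add: combine_def \<beta>_def field_simps)
    moreover have "lead n (fst l) * (- lead n (fst u)) > 0"
      using that by (intro mult_pos_pos) auto
    moreover have zero_le_mult_pos2: "0 \<le> b" if "0 \<le> b * a" "0 < a" for a b :: real
      using that by (simp add: zero_le_mult_iff)
    moreover have "snd (combine n l u) = (snd l \<or> snd u)" by (simp add: combine_def)
    ultimately show ?thesis
      unfolding sat_def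
      by (metis diff_ge_0_iff_ge diff_gt_0_iff_gt zero_less_mult_pos2 zero_le_mult_pos2)
  qed
  have all: "\<And>c. c \<in> S \<Longrightarrow> sat c (x(n := t))"
    if "\<And>c. c \<in> ?L \<Longrightarrow> if snd c then \<beta> c < t else \<beta> c \<le> t" "\<And>c. c \<in> ?U \<Longrightarrow> if snd c then t < \<beta> c else t \<le> \<beta> c" for t
  proof -
    fix c assume "c \<in> S"
    then consider "c \<in> ?L" | "c \<in> ?U" | "lead n (fst c) = 0" by fastforce
    then show "sat c (x(n := t))"
      using that Lc Uc Z \<open>c \<in> S\<close> by cases blast+
  qed
  have fL: "finite ?L" and fU: "finite ?U" using fin by auto
  have maxL: "\<exists>l\<in>?L. \<forall>c\<in>?L. \<beta> c \<le> \<beta> l" if "?L \<noteq> {}"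
  proof -
    have "Max (\<beta> ` ?L) \<in> \<beta> ` ?L" using that fL by (intro Max_in finite_imageI) simp_all
    then obtain l where l: "l \<in> ?L" "Max (\<beta> ` ?L) = \<beta> l" by (elim imageE) simp
    show ?thesis using l(1) fL by (intro bexI[of _ l]) (auto simp flip: l(2))
  qed
  have minU: "\<exists>l\<in>?U. \<forall>c\<in>?U. \<beta> l \<le> \<beta> c" if "?U \<noteq> {}"
  proof -
    have "Min (\<beta> ` ?U) \<in> \<beta> ` ?U" using that fU by (intro Min_in finite_imageI) simp_all
    then obtain l where l: "l \<in> ?U" "Min (\<beta> ` ?U) = \<beta> l" by (elim imageE) simp
    show ?thesis using l(1) fU by (intro bexI[of _ l]) (auto simp flip: l(2))
  qed
  consider "?L = {}" "?U = {}" | "?L \<noteq> {}" "?U = {}" | "?L = {}" "?U \<noteq> {}" | "?L \<noteq> {}" "?U \<noteq> {}" by blast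
  then show ?thesis
  proof cases
    case 1
    show ?thesis
    proof (rule that[of 0])
      show "\<And>c. c \<in> S \<Longrightarrow> sat c (x(n := 0))" by (rule all) (use 1 in auto)
    qed simp
  next
    case 2
    obtain l where l: "l \<in> ?L" "\<forall>c\<in>?L. \<beta> c \<le> \<beta> l" using maxL[OF 2(1)] by (elim bexE)
    show ?thesis
    proof (rule that[of "\<beta> l + 1"])
      show "\<And>c. c \<in> S \<Longrightarrow> sat c (x(n := \<beta> l + 1))"
      proof (rule all)
        fix c assume "c \<in> ?L"
        then have "\<beta> c \<le> \<beta> l" using l(2) by (rule bspec[rotated])
        then show "if snd c then \<beta> c < \<beta> l + 1 else \<beta> c \<le> \<beta> l + 1" by simp
      qed (use 2(2) in simp)
    qed (intro disjI2 disjI1 bexI[of _ l], use l(1) in simp_all)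
  next
    case 3
    obtain u where u: "u \<in> ?U" "\<forall>c\<in>?U. \<beta> u \<le> \<beta> c" using minU[OF 3(2)] by (elim bexE)
    show ?thesis
    proof (rule that[of "\<beta> u - 1"])
      show "\<And>c. c \<in> S \<Longrightarrow> sat c (x(n := \<beta> u - 1))"
      proof (rule all)
        fix c assume "c \<in> ?U"
        then have "\<beta> u \<le> \<beta> c" using u(2) by (rule bspec[rotated])
        then show "if snd c then \<beta> u - 1 < \<beta> c else \<beta> u - 1 \<le> \<beta> c" by simp
      qed (use 3(1) in simp)
    qed (intro disjI2 disjI1 bexI[of _ u], use u(1) in simp_all)
  next
    case 4
    obtain l where l: "l \<in> ?L" "\<forall>c\<in>?L. \<beta> c \<le> \<beta> l" using maxL[OF 4(1)] by (elim bexE)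
    obtain u where u: "u \<in> ?U" "\<forall>c\<in>?U. \<beta> u \<le> \<beta> c" using minU[OF 4(2)] by (elim bexE)
    show ?thesis
    proof (rule that[of "(\<beta> l + \<beta> u) / 2"])
      show "\<And>c. c \<in> S \<Longrightarrow> sat c (x(n := (\<beta> l + \<beta> u) / 2))"
      proof (rule all)
        fix c assume "c \<in> ?L"
        with l(2) have "\<beta> c \<le> \<beta> l" by (rule bspec)
        \<comment> \<open>If \<open>c\<close> is strict then \<beta> c < \<beta> u, and together
          with \<beta> c \<le> \<beta> l the midpoint exceeds \<beta> c, whether or not
          \<open>l\<close> is strict.\<close>
        with LU[OF \<open>c \<in> ?L\<close> u(1)] LU[OF l(1) u(1)]
        show "if snd c then \<beta> c < (\<beta> l + \<beta> u) / 2 else \<beta> c \<le> (\<beta> l + \<beta> u) / 2"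
          by (auto split: if_splits)
      next
        fix c assume "c \<in> ?U"
        with u(2) have "\<beta> u \<le> \<beta> c" by (rule bspec)
        with LU[OF l(1) \<open>c \<in> ?U\<close>] LU[OF l(1) u(1)]
        show "if snd c then (\<beta> l + \<beta> u) / 2 < \<beta> c else (\<beta> l + \<beta> u) / 2 \<le> \<beta> c"
          by (auto split: if_splits)
      qed
    qed (intro disjI2 bexI[of _ l] bexI[of _ u], use l(1) u(1) in simp_all)
  qed
qed

text \<open>Motzkin's transposition theorem, with the derivations from the system abstracted to an
  invariant of nonnegative combinations.\<close>

lemma infeasible_certificate:
  assumes "finite S" "\<And>c. c \<in> S \<Longrightarrow> affine_fun n (fst c)" "\<nexists>x. \<forall>c\<in>S. sat c x"
    and Q: "\<And>c. c \<in> S \<Longrightarrow> Q (fst c) (snd c)"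
    and Q_comb: "\<And>f g s t \<alpha> \<beta>. Q f s \<Longrightarrow> Q g t \<Longrightarrow> \<alpha> > 0 \<Longrightarrow> \<beta> > 0 \<Longrightarrow> Q (\<lambda>x. \<alpha> * f x + \<beta> * g x) (s \<or> t)"
  shows "\<exists>b s. Q (\<lambda>_. b) s \<and> (if s then b \<le> 0 else b < 0)"
  using assms(1-4)
proof (induction n arbitrary: S)
  case 0
  then obtain c where c: "c \<in> S" "\<not> sat c (\<lambda>_. 0)" by blast
  moreover obtain b where "fst c = (\<lambda>_. b)" using 0(2)[OF c(1)] by (auto simp: affine_fun_def)
  ultimately show ?case using 0(4)[OF c(1)]
    by (intro exI[of _ b] exI[of _ "snd c"]) (auto simp: sat_def)
next
  case (Suc n)
  show ?case
  proof (rule Suc.IH[of "eliminate n S"])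
    show "finite (eliminate n S)" using Suc.prems(1) by (rule finite_eliminate)
    show "\<And>c. c \<in> eliminate n S \<Longrightarrow> affine_fun n (fst c)"
      using affine_fun_eliminate Suc.prems(2) by blast
    show "\<nexists>x. \<forall>c\<in>eliminate n S. sat c x"
    proof
      assume "\<exists>x. \<forall>c\<in>eliminate n S. sat c x"
      then obtain x where "\<And>c. c \<in> eliminate n S \<Longrightarrow> sat c x" by blast
      then show False using eliminate_lift[OF Suc.prems(1,2), of x] Suc.prems(3) by metis
    qed
    fix c assume "c \<in> eliminate n S"
    then consider "c \<in> S" | l u where "l \<in> S" "u \<in> S" "lead n (fst l) > 0" "lead n (fst u) < 0" "c = combine n l u"
      by (auto simp: eliminate_def)
    then show "Q (fst c) (snd c)"
    proof cases
      case 1 then show ?thesis using Suc.prems(4) by blast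
    next
      case 2
      have "Q (\<lambda>x. lead n (fst l) * fst u x + (- lead n (fst u)) * fst l x) (snd u \<or> snd l)"
        by (rule Q_comb) (use 2 Suc.prems(4) in auto)
      then show ?thesis using 2(5) by (simp add: combine_def disj_commute)
    qed
  qed
qed

section \<open>Integer coefficients of bounded size and solutions of bounded denominator\<close>

definition int_affine_bounded :: "nat \<Rightarrow> nat \<Rightarrow> ((nat \<Rightarrow> real) \<Rightarrow> real) \<Rightarrow> bool" where
  "int_affine_bounded n K f \<longleftrightarrow> (\<exists>(a :: nat \<Rightarrow> int) (b :: int). f = (\<lambda>x. of_int b + (\<Sum>i<n. of_int (a i) * x i)) \<and>
     \<bar>b\<bar> \<le> int K \<and> (\<forall>i<n. \<bar>a i\<bar> \<le> int K))"

lemma int_affine_boundedI: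
  fixes a :: "nat \<Rightarrow> int"
  assumes "f = (\<lambda>x. of_int b + (\<Sum>i<n. of_int (a i) * x i))" "\<bar>b\<bar> \<le> int K" "\<And>i. i < n \<Longrightarrow> \<bar>a i\<bar> \<le> int K"
  shows "int_affine_bounded n K f"
  using assms unfolding int_affine_bounded_def by blast

lemma int_affine_bounded_affine: "int_affine_bounded n K f \<Longrightarrow> affine_fun n f"
  by (auto simp: int_affine_bounded_def affine_fun_def)

lemma int_affine_bounded_lead:
  assumes "int_affine_bounded (Suc n) K f"
  obtains k :: int where "lead n f = of_int k" "\<bar>k\<bar> \<le> int K"
proof -
  obtain a :: "nat \<Rightarrow> int" and b :: int where
    f: "f = (\<lambda>x. of_int b + (\<Sum>i<Suc n. of_int (a i) * x i))" "\<bar>a n\<bar> \<le> int K"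
    using assms by (auto simp: int_affine_bounded_def)
  then show ?thesis using that[of "a n"] by (simp add: lead_affine del: sum.lessThan_Suc)
qed

text \<open>New coefficients are differences of two products of old ones, which gives 2K^2; a
  constraint that is merely kept needs K \<le> 2K^2.\<close>

lemma int_affine_bounded_eliminate:
  assumes "\<And>c. c \<in> S \<Longrightarrow> int_affine_bounded (Suc n) K (fst c)" "c \<in> eliminate n S"
  shows "int_affine_bounded n (2 * K^2) (fst c)"
proof -
  have K: "int K \<le> int (2 * K^2)" by (cases K) (auto simp: power2_eq_square algebra_simps)
  consider "c \<in> S" "lead n (fst c) = 0"
    | l u where "l \<in> S" "u \<in> S" "lead n (fst l) > 0" "lead n (fst u) < 0" "c = combine n l u"
    using assms(2) by (auto simp: eliminate_def)
  then show ?thesis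
  proof cases
    case 1
    obtain a :: "nat \<Rightarrow> int" and b :: int where
      f: "fst c = (\<lambda>x. of_int b + (\<Sum>i<Suc n. of_int (a i) * x i))" "\<bar>b\<bar> \<le> int K" "\<forall>i<Suc n. \<bar>a i\<bar> \<le> int K"
      using assms(1)[OF 1(1)] by (auto simp: int_affine_bounded_def)
    with 1(2) have "a n = 0" by (simp add: lead_affine del: sum.lessThan_Suc)
    with f(1) have "fst c = (\<lambda>x. of_int b + (\<Sum>i<n. of_int (a i) * x i))" by simp
    then show ?thesis
      by (rule int_affine_boundedI) (use f(2,3) in \<open>auto intro: order_trans[OF _ K] simp del: of_nat_mult of_nat_power\<close>)
  next
    case 2
    obtain a :: "nat \<Rightarrow> int" and b :: int where
      f: "fst l = (\<lambda>x. of_int b + (\<Sum>i<Suc n. of_int (a i) * x i))" "\<bar>b\<bar> \<le> int K" "\<forall>i<Suc n. \<bar>a i\<bar> \<le> int K"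
      using assms(1)[OF 2(1)] by (auto simp: int_affine_bounded_def)
    obtain a' :: "nat \<Rightarrow> int" and b' :: int where
      g: "fst u = (\<lambda>x. of_int b' + (\<Sum>i<Suc n. of_int (a' i) * x i))" "\<bar>b'\<bar> \<le> int K" "\<forall>i<Suc n. \<bar>a' i\<bar> \<le> int K"
      using assms(1)[OF 2(2)] by (auto simp: int_affine_bounded_def)
    have le: "\<bar>a n * s - a' n * r\<bar> \<le> int (2 * K^2)" if "\<bar>s\<bar> \<le> int K" "\<bar>r\<bar> \<le> int K" for s r
    proof -
      have "\<bar>a n\<bar> * \<bar>s\<bar> \<le> int K * int K" "\<bar>a' n\<bar> * \<bar>r\<bar> \<le> int K * int K"
        using that f(3) g(3) by (auto intro!: mult_mono)
      then show ?thesis using abs_triangle_ineq4[of "a n * s" "a' n * r"]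
        by (simp add: abs_mult power2_eq_square)
    qed
    have "fst c = (\<lambda>x. of_int (a n * b' - a' n * b) + (\<Sum>i<n. of_int (a n * a' i - a' n * a i) * x i))"
    proof
      fix x :: "nat \<Rightarrow> real"
      have "(\<Sum>i<n. of_int (a n * a' i - a' n * a i) * x i) =
          of_int (a n) * (\<Sum>i<n. of_int (a' i) * x i) - of_int (a' n) * (\<Sum>i<n. of_int (a i) * x i)"
        by (simp add: sum_distrib_left left_diff_distrib sum_subtractf mult.assoc)
      then show "fst c x = of_int (a n * b' - a' n * b) + (\<Sum>i<n. of_int (a n * a' i - a' n * a i) * x i)"
        unfolding 2(5) combine_def fst_conv f(1) g(1) lead_affine by (simp add: algebra_simps)
    qed
    then show ?thesis
    proof (rule int_affine_boundedI)
      show "\<bar>a n * b' - a' n * b\<bar> \<le> int (2 * K^2)" by (rule le[OF g(2) f(2)])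
      show "\<bar>a n * a' i - a' n * a i\<bar> \<le> int (2 * K^2)" if "i < n" for i
        by (rule le) (use that f(3) g(3) in auto)
    qed
  qed
qed

text \<open>Subtracting the leading term removes the last coordinate, whose value has not been
  chosen yet. Up to sign, the bound \<open>\<beta>\<close> of \<open>eliminate_lift\<close> is the
  quotient of this difference by the leading coefficient, so its denominator is under
  control.\<close>

lemma int_affine_bounded_grid:
  assumes "int_affine_bounded (Suc n) K f" "\<And>i. i < n \<Longrightarrow> of_nat e * x i \<in> \<int>"
  shows "of_nat e * (f x - lead n f * x n) \<in> \<int>"
proof -
  obtain a :: "nat \<Rightarrow> int" and b :: int where
    f: "f = (\<lambda>x. of_int b + (\<Sum>i<Suc n. of_int (a i) * x i))"
    using assms(1) unfolding int_affine_bounded_def by blast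
  have l: "lead n f = of_int (a n)" unfolding f by (rule lead_affine)
  have "of_nat e * (f x - lead n f * x n) = of_nat e * of_int b + (\<Sum>i<n. of_int (a i) * (of_nat e * x i))"
    unfolding l by (simp add: f distrib_left sum_distrib_left mult.left_commute)
  also have "\<dots> \<in> \<int>"
    by (intro Ints_add Ints_sum Ints_mult[OF Ints_of_int assms(2)] Ints_mult[OF Ints_of_nat Ints_of_int]) auto
  finally show ?thesis .
qed

text \<open>Elimination turns 2K into 2 * 2K^2 = (2K)^2, and lifting the last coordinate multiplies
  the denominator by at most 2K^2. With the latter estimated by (2K)^2, the exponent e(n) of 2K
  satisfies e(0) = 0 and e(n + 1) = 2 e(n) + 2, hence e(n) = 2^(n + 1) - 2.\<close>

lemma small_rational_solution:
  assumes "finite S" "\<And>c. c \<in> S \<Longrightarrow> int_affine_bounded n K (fst c)" "\<And>c. c \<in> S \<Longrightarrow> sat c x" "K > 0"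
  obtains e :: nat and y where "0 < e" "e \<le> (2 * K) ^ (2 ^ (n + 1) - 2)" "\<And>i. i < n \<Longrightarrow> of_nat e * y i \<in> \<int>"
    "\<And>c. c \<in> S \<Longrightarrow> sat c y"
proof -
  have "\<exists>e y. 0 < e \<and> e \<le> (2 * K) ^ (2 ^ (n + 1) - 2) \<and> (\<forall>i<n. of_nat e * y i \<in> \<int>) \<and> (\<forall>c\<in>S. sat c y)"
    using assms
  proof (induction n arbitrary: S K x)
    case 0
    then show ?case by (intro exI[of _ 1] exI[of _ x]) auto
  next
    case (Suc n)
    have aff: "affine_fun (Suc n) (fst c)" if "c \<in> S" for c
      using int_affine_bounded_affine Suc.prems(2) that by blast
    have "\<exists>e y. 0 < e \<and> e \<le> (2 * (2 * K^2)) ^ (2 ^ (n + 1) - 2) \<and> (\<forall>i<n. of_nat e * y i \<in> \<int>) \<and> (\<forall>c\<in>eliminate n S. sat c y)"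
    proof (rule Suc.IH)
      show "finite (eliminate n S)" by (rule finite_eliminate[OF Suc.prems(1)])
      show "\<And>c. c \<in> eliminate n S \<Longrightarrow> int_affine_bounded n (2 * K^2) (fst c)"
        by (rule int_affine_bounded_eliminate[OF Suc.prems(2)])
      show "\<And>c. c \<in> eliminate n S \<Longrightarrow> sat c x" by (rule sat_eliminate[OF Suc.prems(3)])
    qed (use Suc.prems(4) in auto)
    then obtain e y where e: "0 < e" "e \<le> (2 * (2 * K^2)) ^ (2 ^ (n + 1) - 2)"
      and e3: "\<forall>i<n. of_nat e * y i \<in> \<int>" and y: "\<forall>c\<in>eliminate n S. sat c y" by (elim exE conjE)
    define \<beta> where "\<beta> = (\<lambda>c :: ((nat \<Rightarrow> real) \<Rightarrow> real) \<times> bool. y n - fst c y / lead n (fst c))"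
    obtain t where t: "\<And>c. c \<in> S \<Longrightarrow> sat c (y(n := t))"
      "t = 0 \<or> (\<exists>c\<in>S. lead n (fst c) \<noteq> 0 \<and> (t = \<beta> c + 1 \<or> t = \<beta> c - 1)) \<or>
       (\<exists>c\<in>S. \<exists>d\<in>S. lead n (fst c) \<noteq> 0 \<and> lead n (fst d) \<noteq> 0 \<and> t = (\<beta> c + \<beta> d) / 2)"
      by (rule eliminate_lift[OF Suc.prems(1) aff bspec[OF y]], assumption, assumption, rule that[unfolded \<beta>_def])
    \<comment> \<open>The factor \<open>k\<close> is the absolute value of the leading
      coefficient.\<close>
    have \<beta>: "\<exists>k::nat. k > 0 \<and> k \<le> K \<and> of_nat (e * k) * \<beta> c \<in> \<int>" if c: "c \<in> S" "lead n (fst c) \<noteq> 0" for c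
    proof -
      obtain k :: int where k: "lead n (fst c) = of_int k" "\<bar>k\<bar> \<le> int K"
        using int_affine_bounded_lead[OF Suc.prems(2)[OF c(1)]] by blast
      have "of_nat e * (fst c y - lead n (fst c) * y n) \<in> \<int>"
        by (rule int_affine_bounded_grid[OF Suc.prems(2)[OF c(1)]]) (use e3 in blast)
      moreover have "of_nat e * (fst c y - lead n (fst c) * y n) = - (of_nat e * of_int k * \<beta> c)"
        using c(2) by (simp add: \<beta>_def k field_simps)
      ultimately have "of_nat e * of_int k * \<beta> c \<in> \<int>" by (metis Ints_minus minus_minus)
      moreover have "of_nat (e * nat \<bar>k\<bar>) * \<beta> c = (if k > 0 then 1 else - 1) * (of_nat e * of_int k * \<beta> c)"
        by simp
      ultimately have "of_nat (e * nat \<bar>k\<bar>) * \<beta> c \<in> \<int>" by (simp add: minus_in_Ints_iff split: if_splits)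
      moreover have "k \<noteq> 0" using c k by auto
      ultimately have *: "nat \<bar>k\<bar> > 0 \<and> nat \<bar>k\<bar> \<le> K \<and> of_nat (e * nat \<bar>k\<bar>) * \<beta> c \<in> \<int>" using k(2) by simp
      show ?thesis by (rule exI) (rule *)
    qed
    have "\<exists>m::nat. m > 0 \<and> m \<le> 2 * K^2 \<and> of_nat (e * m) * t \<in> \<int>"
      using t(2)
    proof (elim disjE bexE conjE)
      assume "t = 0" then show ?thesis using Suc.prems(4) by (intro exI[of _ 1]) auto
    next
      fix c assume c: "c \<in> S" "lead n (fst c) \<noteq> 0" "t = \<beta> c + 1"
      obtain k where k: "k > 0" "k \<le> K" "of_nat (e * k) * \<beta> c \<in> \<int>" using \<beta>[OF c(1,2)] by blast
      have "k \<le> 2 * K^2" using k(2) by (cases K) (auto simp: power2_eq_square)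
      moreover have "of_nat (e * k) * t = of_nat (e * k) * \<beta> c + of_nat (e * k)" by (simp add: c(3) algebra_simps)
      then have "of_nat (e * k) * t \<in> \<int>" using k(3) by (metis Ints_add Ints_of_nat)
      ultimately show ?thesis using k by blast
    next
      fix c assume c: "c \<in> S" "lead n (fst c) \<noteq> 0" "t = \<beta> c - 1"
      obtain k where k: "k > 0" "k \<le> K" "of_nat (e * k) * \<beta> c \<in> \<int>" using \<beta>[OF c(1,2)] by blast
      have "k \<le> 2 * K^2" using k(2) by (cases K) (auto simp: power2_eq_square)
      moreover have "of_nat (e * k) * t = of_nat (e * k) * \<beta> c - of_nat (e * k)" by (simp add: c(3) algebra_simps)
      then have "of_nat (e * k) * t \<in> \<int>" using k(3) by (metis Ints_diff Ints_of_nat)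
      ultimately show ?thesis using k by blast
    next
      fix c d assume c: "c \<in> S" "lead n (fst c) \<noteq> 0" and d: "d \<in> S" "lead n (fst d) \<noteq> 0"
        and td: "t = (\<beta> c + \<beta> d) / 2"
      obtain k where k: "k > 0" "k \<le> K" "of_nat (e * k) * \<beta> c \<in> \<int>" using \<beta>[OF c] by blast
      obtain l where l: "l > 0" "l \<le> K" "of_nat (e * l) * \<beta> d \<in> \<int>" using \<beta>[OF d] by blast
      \<comment> \<open>The midpoint of fractions with denominators \<open>e * k\<close> and
        \<open>e * l\<close> has denominator \<open>e * (2 * k * l)\<close>; the bound 2K^2 on the
        new factor comes from here.\<close>
      have "2 * k * l \<le> 2 * K^2" using k(2) l(2) by (simp add: power2_eq_square mult_le_mono)
      moreover have "of_nat (e * (2 * k * l)) * t = of_nat l * (of_nat (e * k) * \<beta> c) + of_nat k * (of_nat (e * l) * \<beta> d)"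
        by (simp add: td algebra_simps)
      then have "of_nat (e * (2 * k * l)) * t \<in> \<int>"
        using k(3) l(3) by (metis Ints_add Ints_mult Ints_of_nat)
      ultimately show ?thesis using k(1) l(1) by (intro exI[of _ "2 * k * l"]) auto
    qed
    then obtain m where m: "m > 0" "m \<le> 2 * K^2" "of_nat (e * m) * t \<in> \<int>" by blast
    have "e * m \<le> (2 * (2 * K^2)) ^ (2 ^ (n + 1) - 2) * (2 * (2 * K^2))"
      using e(2) m(2) by (intro mult_le_mono) auto
    also have "2 * (2 * K^2) = (2 * K)^2" by (simp add: power2_eq_square)
    also have "((2 * K)^2) ^ (2 ^ (n + 1) - 2) * (2 * K)^2 = (2 * K) ^ (2 * (2 ^ (n + 1) - 2) + 2)"
      by (simp only: power_mult power_add)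
    also have "2 * (2 ^ (n + 1) - 2) + 2 = (2 ^ (Suc n + 1) - 2 :: nat)"
      using one_le_power[of "2::nat" n] by (simp only: diff_mult_distrib2 power_add power_Suc power_one_right) linarith
    finally have "e * m \<le> (2 * K) ^ (2 ^ (Suc n + 1) - 2)" .
    moreover have "of_nat (e * m) * (y(n := t)) i \<in> \<int>" if "i < Suc n" for i
    proof (cases "i = n")
      case False
      then have "of_nat e * y i \<in> \<int>" using e3 that by (simp add: less_Suc_eq)
      then have "of_nat m * (of_nat e * y i) \<in> \<int>" by (rule Ints_mult[OF Ints_of_nat])
      then show ?thesis using False by (simp add: mult_ac)
    qed (use m(3) in simp)
    moreover have "0 < e * m" using e(1) m(1) by simp
    moreover have "\<forall>c\<in>S. sat c (y(n := t))" using t(1) by (intro ballI)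
    ultimately show ?case by blast
  qed
  then obtain e y where *: "0 < e" "e \<le> (2 * K) ^ (2 ^ (n + 1) - 2)" "\<forall>i<n. of_nat e * y i \<in> \<int>" "\<forall>c\<in>S. sat c y"
    by (elim exE conjE)
  show thesis by (rule that[OF *(1,2)]) (use *(3,4) in auto)
qed

section \<open>Characters of subgroups of \<open>\<int>\<^sup>m\<close>\<close>

definition dot :: "nat \<Rightarrow> (nat \<Rightarrow> int) \<Rightarrow> (nat \<Rightarrow> int) \<Rightarrow> int" where
  "dot m r w = (\<Sum>i<m. r i * w i)"

text \<open>\<open>W\<close> and \<open>w\<close> stand for the character \<open>r \<mapsto> dot m r w / W\<close> of \<open>\<int>\<^sup>m\<close> with values in \<open>\<rat>/\<int>\<close>.\<close>

lemma subgroup_character: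
  fixes H :: "(nat \<Rightarrow> int) set"
  assumes "(\<lambda>_. 0) \<in> H" and "\<And>r s k. r \<in> H \<Longrightarrow> s \<in> H \<Longrightarrow> (\<lambda>i. r i + k * s i) \<in> H"
    and "\<nexists>r. r \<in> H \<and> (\<forall>i<m. r i = \<phi> i)"
  shows "\<exists>W w. W > 0 \<and> (\<forall>r\<in>H. W dvd dot m r w) \<and> \<not> W dvd dot m \<phi> w"
  using assms
proof (induction m arbitrary: H \<phi>)
  case 0
  then show ?case by auto
next
  case (Suc m)
  \<comment> \<open>The last entries of the elements of \<open>H\<close> form a subgroup of \<int>;
    if it is not zero, the least element of \<open>?D\<close> generates it.\<close>
  let ?D = "{k. k > 0 \<and> (\<exists>r\<in>H. r m = int k)}"
  have single: "dot (Suc m) r (\<lambda>i. if i = m then 1 else 0) = r m" for r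
    by (simp add: dot_def sum.neutral)
  have neg: "(\<lambda>i. - r i) \<in> H" if "r \<in> H" for r
    using Suc.prems(2)[OF Suc.prems(1) that, of "- 1"] by simp
  show ?case
  proof (cases "\<forall>r\<in>H. r m = 0")
    case True
    show ?thesis
    proof (cases "\<phi> m = 0")
      case False
      \<comment> \<open>Every element of \<open>H\<close> has last entry 0, so the projection to the
        last entry separates modulo any number that does not divide \<open>\<phi> m\<close>.\<close>
      have "\<not> (\<bar>\<phi> m\<bar> + 1) dvd \<phi> m"
        using False zdvd_not_zless[of "\<bar>\<phi> m\<bar>" "\<bar>\<phi> m\<bar> + 1"] by (auto simp del: zdvd_not_zless)
      then show ?thesis
        using True by (intro exI[of _ "\<bar>\<phi> m\<bar> + 1"] exI[of _ "\<lambda>i. if i = m then 1 else 0"]) (auto simp: single)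
    next
      case zero: True
      have "\<nexists>r. r \<in> H \<and> (\<forall>i<m. r i = \<phi> i)"
        using Suc.prems(3) True zero by (auto simp: less_Suc_eq)
      from Suc.IH[OF Suc.prems(1,2) this] obtain W w where
        "W > 0" "\<forall>r\<in>H. W dvd dot m r w" "\<not> W dvd dot m \<phi> w" by blast
      with True zero show ?thesis
        by (intro exI[of _ W] exI[of _ w]) (auto simp: dot_def)
    qed
  next
    case False
    then obtain r where r: "r \<in> H" "r m \<noteq> 0" by blast
    have "?D \<noteq> {}"
    proof (cases "r m > 0")
      case True
      with r show ?thesis by (auto intro!: exI[of _ "nat (r m)"] bexI[of _ r])
    next
      case False
      with r show ?thesis by (auto intro!: exI[of _ "nat (- r m)"] bexI[OF _ neg[OF r(1)]])
    qed
    then obtain d where d: "d \<in> ?D" "\<And>k. k \<in> ?D \<Longrightarrow> d \<le> k"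
      using exists_least_iff[of "\<lambda>k. k \<in> ?D"] by (metis (no_types, lifting) Collect_empty_eq mem_Collect_eq not_le)
    then obtain r0 where r0: "r0 \<in> H" "r0 m = int d" and "d > 0" by blast
    have dvd: "int d dvd s m" if "s \<in> H" for s
    proof -
      have "(\<lambda>i. s i + (- (s m div int d)) * r0 i) \<in> H" by (rule Suc.prems(2)[OF that r0(1)])
      moreover have "s m + (- (s m div int d)) * r0 m = s m mod int d"
        by (simp add: r0(2) minus_div_mult_eq_mod)
      ultimately have "\<exists>r\<in>H. r m = s m mod int d" by (intro bexI[of _ "\<lambda>i. s i + (- (s m div int d)) * r0 i"])
      then have "nat (s m mod int d) \<in> ?D" if "s m mod int d > 0"
        using that by auto
      then have "d \<le> nat (s m mod int d)" if "s m mod int d > 0"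
        using that d(2) by blast
      moreover have "s m mod int d < int d" "s m mod int d \<ge> 0" using \<open>d > 0\<close> by simp_all
      ultimately have "s m mod int d = 0" by linarith
      then show ?thesis by (rule dvd_eq_mod_eq_0[THEN iffD2])
    qed
    show ?thesis
    proof (cases "int d dvd \<phi> m")
      case False
      \<comment> \<open>The projection to the last entry, taken modulo \<open>d\<close>, already
        separates.\<close>
      then show ?thesis using dvd \<open>d > 0\<close>
        by (intro exI[of _ "int d"] exI[of _ "\<lambda>i. if i = m then 1 else 0"]) (auto simp: single)
    next
      case True
      then obtain j where j: "\<phi> m = int d * j" by blast
      \<comment> \<open>Subtracting \<open>j\<close> times \<open>r0\<close> clears the last entry
        of \<open>\<phi>\<close>, so the induction hypothesis applies to the elements of
        \<open>H\<close> with last entry 0.\<close>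
      let ?H = "{r \<in> H. r m = 0}" and ?\<phi> = "\<lambda>i. \<phi> i - j * r0 i"
      have nex: "\<nexists>r. r \<in> ?H \<and> (\<forall>i<m. r i = ?\<phi> i)"
      proof
        assume "\<exists>r. r \<in> ?H \<and> (\<forall>i<m. r i = ?\<phi> i)"
        then obtain s where s: "s \<in> H" "s m = 0" "\<forall>i<m. s i = ?\<phi> i" by blast
        have "(\<lambda>i. s i + j * r0 i) \<in> H" by (rule Suc.prems(2)[OF s(1) r0(1)])
        moreover have "\<forall>i<Suc m. s i + j * r0 i = \<phi> i"
          using s(2,3) j r0(2) by (auto simp: less_Suc_eq)
        ultimately show False using Suc.prems(3) by blast
      qed
      have "\<exists>W w. W > 0 \<and> (\<forall>r\<in>?H. W dvd dot m r w) \<and> \<not> W dvd dot m ?\<phi> w"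
        by (rule Suc.IH) (use Suc.prems(1,2) nex in auto)
      then obtain W w where W: "W > 0" "\<And>r. r \<in> H \<Longrightarrow> r m = 0 \<Longrightarrow> W dvd dot m r w" "\<not> W dvd dot m ?\<phi> w"
        by blast
      \<comment> \<open>The character found on the first \<open>m\<close> entries is extended so as
        to vanish on \<open>r0\<close>: a vector with last entry \<open>d * k\<close> is treated as
        its difference with \<open>k\<close> times \<open>r0\<close>. The division by
        \<open>d\<close> is absorbed into the modulus \<open>d * W\<close>.\<close>
      define w' where "w' = (\<lambda>i. if i = m then - dot m r0 w else int d * w i)"
      have w': "dot (Suc m) r w' = int d * dot m r w - r m * dot m r0 w" for r
        by (simp add: dot_def w'_def sum_distrib_left mult_ac)
      have lin: "dot m (\<lambda>i. r i - k * r0 i) w = dot m r w - k * dot m r0 w" for r k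
        by (simp add: dot_def left_diff_distrib sum_subtractf sum_distrib_left mult.assoc)
      have w'': "dot (Suc m) r w' = int d * dot m (\<lambda>i. r i - k * r0 i) w" if "r m = int d * k" for r k
        unfolding w' lin that by (simp add: algebra_simps)
      have "int d * W dvd dot (Suc m) r w'" if rH: "r \<in> H" for r
      proof -
        obtain k where k: "r m = int d * k" using dvd[OF rH] by blast
        have "(\<lambda>i. r i + (- k) * r0 i) \<in> H" by (rule Suc.prems(2)[OF rH r0(1)])
        then have "W dvd dot m (\<lambda>i. r i - k * r0 i) w" by (intro W(2)) (use k r0(2) in auto)
        then show ?thesis unfolding w''[of r k, OF k] by (rule mult_dvd_mono[OF dvd_refl])
      qed
      moreover have "\<not> int d * W dvd dot (Suc m) \<phi> w'"
        unfolding w''[of \<phi> j, OF j] using W(3) \<open>d > 0\<close> by simp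
      ultimately show ?thesis using W(1) \<open>d > 0\<close> by (intro exI[of _ "int d * W"] exI[of _ w']) auto
    qed
  qed
qed

section \<open>Truncated integer combinations\<close>

definition clip :: "real \<Rightarrow> real" where "clip t = max 0 (min 1 t)"

lemma clip_id: "0 \<le> t \<Longrightarrow> t \<le> 1 \<Longrightarrow> clip t = t" by (simp add: clip_def)

lemma clip_nonneg: "0 \<le> clip t" by (simp add: clip_def)

lemma clip_int: "clip (of_int c) \<in> {0, 1}" by (simp add: clip_def min_def max_def)

text \<open>In MV notation the right-hand side is (clip t \<oplus> f) \<odot> clip (t + 1). For t
  \<ge> 0 the second factor is 1; for t < 0 it restores the deficit that truncation at 0 discards. A
  truncated sum is thus built from truncations of a shorter sum.\<close>

lemma clip_add:
  assumes "0 \<le> f" "f \<le> 1"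
  shows "clip (t + f) = max 0 (min 1 (clip t + f) + clip (t + 1) - 1)"
  using assms by (auto simp: clip_def min_def max_def)

abbreviation alg :: "nat \<Rightarrow> ((nat \<Rightarrow> real) \<Rightarrow> real) set \<Rightarrow> ((nat \<Rightarrow> real) \<Rightarrow> real) set" where
  "alg n G \<equiv> mv_generate (mcnaughton n) G"

lemma alg_cong:
  assumes "f \<in> alg n G" "\<And>x. x \<in> cube n \<Longrightarrow> g x = f x" "g \<in> extensional (cube n)" "f \<in> extensional (cube n)"
  shows "g \<in> alg n G"
  using assms extensionalityI[of g "cube n" f] by simp

lemma alg_mcnaughton:
  assumes "G \<subseteq> mcnaughton_functions n" shows "alg n G \<subseteq> mcnaughton_functions n"
  using mv_algebra.mv_generate_subset[OF mv_algebra_mcnaughton, of G n] assms by (simp add: mcnaughton_def)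

lemma mcnaughton_bounds:
  assumes "f \<in> mcnaughton_functions n" "x \<in> cube n" shows "0 \<le> f x" "f x \<le> 1"
  using assms by (auto simp: mcnaughton_functions_def PiE_iff)

lemma mcnaughton_extensional: "f \<in> mcnaughton_functions n \<Longrightarrow> f \<in> extensional (cube n)"
  by (auto simp: mcnaughton_functions_def PiE_iff)

lemma alg_neg: "f \<in> alg n G \<Longrightarrow> (\<lambda>x\<in>cube n. 1 - f x) \<in> alg n G"
  using mv_generate.neg[of f "mcnaughton n" G] by (simp add: mcnaughton_def)

lemma alg_plus: "f \<in> alg n G \<Longrightarrow> g \<in> alg n G \<Longrightarrow> (\<lambda>x\<in>cube n. min 1 (f x + g x)) \<in> alg n G"
  using mv_generate.plus[of f "mcnaughton n" G g] by (simp add: mcnaughton_def)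

lemma alg_zero: "(\<lambda>x\<in>cube n. 0) \<in> alg n G"
  using mv_generate.zero[of "mcnaughton n" G] by (simp add: mcnaughton_def)

lemma alg_one: "(\<lambda>x\<in>cube n. 1) \<in> alg n G"
  using alg_neg[OF alg_zero] by (rule back_subst[of "\<lambda>f. f \<in> alg n G"]) (auto simp: fun_eq_iff)

lemma alg_times:
  assumes "f \<in> alg n G" "g \<in> alg n G"
  shows "(\<lambda>x\<in>cube n. max 0 (f x + g x - 1)) \<in> alg n G"
  using alg_neg[OF alg_plus[OF alg_neg[OF assms(1)] alg_neg[OF assms(2)]]]
  by (rule back_subst[of "\<lambda>f. f \<in> alg n G"]) (auto simp: fun_eq_iff min_def max_def)

lemma alg_max:
  assumes "f \<in> alg n G" "g \<in> alg n G" and G: "G \<subseteq> mcnaughton_functions n"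
  shows "(\<lambda>x\<in>cube n. max (f x) (g x)) \<in> alg n G"
  using alg_plus[OF alg_times[OF assms(1) alg_neg[OF assms(2)]] assms(2)]
proof (rule back_subst[of "\<lambda>f. f \<in> alg n G"], intro ext)
  fix x
  have "x \<in> cube n \<Longrightarrow> f x \<le> 1" "x \<in> cube n \<Longrightarrow> g x \<le> 1"
    using assms alg_mcnaughton[OF G] mcnaughton_bounds by blast+
  then show "(\<lambda>x\<in>cube n. min 1 ((\<lambda>x\<in>cube n. max 0 (f x + (\<lambda>x\<in>cube n. 1 - g x) x - 1)) x + g x)) x =
      (\<lambda>x\<in>cube n. max (f x) (g x)) x"
    by (auto simp: min_def max_def)
qed

lemma alg_Max:
  assumes "finite I" "I \<noteq> {}" "\<And>i. i \<in> I \<Longrightarrow> g i \<in> alg n G" and G: "G \<subseteq> mcnaughton_functions n"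
  shows "\<exists>m\<in>alg n G. \<forall>x\<in>cube n. (\<forall>i\<in>I. g i x \<le> m x) \<and> (\<exists>i\<in>I. m x = g i x)"
  using assms(1-3)
proof (induction rule: finite_ne_induct)
  case (singleton i)
  then show ?case by (intro bexI[of _ "g i"]) auto
next
  case (insert i I)
  then obtain m where m: "m \<in> alg n G" "\<forall>x\<in>cube n. (\<forall>i\<in>I. g i x \<le> m x) \<and> (\<exists>i\<in>I. m x = g i x)" by auto
  show ?case
  proof (rule bexI[OF _ alg_max[OF _ m(1) G, of "g i"]])
    show "g i \<in> alg n G" using insert.prems by simp
    show "\<forall>x\<in>cube n. (\<forall>j\<in>insert i I. g j x \<le> (\<lambda>x\<in>cube n. max (g i x) (m x)) x) \<and>
       (\<exists>j\<in>insert i I. (\<lambda>x\<in>cube n. max (g i x) (m x)) x = g j x)"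
    proof (intro ballI conjI)
      fix x j assume x: "x \<in> cube n" and j: "j \<in> insert i I"
      have "g j x \<le> g i x \<or> g j x \<le> m x" using m(2) x j by auto
      then show "g j x \<le> (\<lambda>x\<in>cube n. max (g i x) (m x)) x" using x by auto
    next
      fix x assume x: "x \<in> cube n"
      then obtain j where "j \<in> I" "m x = g j x" using m(2) by blast
      then show "\<exists>j\<in>insert i I. (\<lambda>x\<in>cube n. max (g i x) (m x)) x = g j x"
        using x by (cases "g i x \<le> m x") (auto simp: max_def)
    qed
  qed
qed

text \<open>Elements of \<open>G\<close> enter one at a time and without coefficients, because
  \<open>clip_add\<close> handles exactly one summand per step of an induction.\<close>

inductive int_combination :: "((nat \<Rightarrow> real) \<Rightarrow> real) set \<Rightarrow> ((nat \<Rightarrow> real) \<Rightarrow> real) \<Rightarrow> bool" for G where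
  const: "int_combination G (\<lambda>_. of_int c)"
| add: "int_combination G g \<Longrightarrow> f \<in> G \<Longrightarrow> int_combination G (\<lambda>x. g x + f x)"
| diff: "int_combination G g \<Longrightarrow> f \<in> G \<Longrightarrow> int_combination G (\<lambda>x. g x - f x)"

text \<open>The shift \<open>c\<close> is arbitrary because each step uses the induction hypothesis
  for two consecutive shifts. Subtracting \<open>f\<close> is adding \<open>1 - f\<close> after
  lowering the shift by 1.\<close>

lemma clip_int_combination:
  assumes "int_combination (alg n G) g" and G: "G \<subseteq> mcnaughton_functions n"
  shows "(\<lambda>x\<in>cube n. clip (g x + of_int c)) \<in> alg n G"
  using assms(1)
proof (induction arbitrary: c)
  case (const d)
  have "(\<lambda>x\<in>cube n. clip (of_int d + of_int c)) \<in> {(\<lambda>x\<in>cube n. 0), (\<lambda>x\<in>cube n. 1)}"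
    using clip_int[of "d + c"] by auto
  then show ?case using alg_zero[of n G] alg_one[of n G] by (elim insertE emptyE) (simp_all only:)
next
  case (add g f)
  have f: "0 \<le> f x" "f x \<le> 1" if "x \<in> cube n" for x
    using that add.hyps(2) alg_mcnaughton[OF G] mcnaughton_bounds by blast+
  show ?case
    using alg_times[OF alg_plus[OF add.IH[of c] add.hyps(2)] add.IH[of "c + 1"]]
  proof (rule back_subst[of "\<lambda>f. f \<in> alg n G"], intro ext)
    fix x
    show "(\<lambda>x\<in>cube n. max 0 ((\<lambda>x\<in>cube n. min 1 ((\<lambda>x\<in>cube n. clip (g x + of_int c)) x + f x)) x +
        (\<lambda>x\<in>cube n. clip (g x + of_int (c + 1))) x - 1)) x = (\<lambda>x\<in>cube n. clip (g x + f x + of_int c)) x"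
      using clip_add[OF f, of x "g x + of_int c"] by (auto simp: algebra_simps)
  qed
next
  case (diff g f)
  have f: "0 \<le> 1 - f x" "1 - f x \<le> 1" if "x \<in> cube n" for x
    using that diff.hyps(2) alg_mcnaughton[OF G] mcnaughton_bounds by force+
  show ?case
    using alg_times[OF alg_plus[OF diff.IH[of "c - 1"] alg_neg[OF diff.hyps(2)]] diff.IH[of c]]
  proof (rule back_subst[of "\<lambda>f. f \<in> alg n G"], intro ext)
    fix x
    show "(\<lambda>x\<in>cube n. max 0 ((\<lambda>x\<in>cube n. min 1 ((\<lambda>x\<in>cube n. clip (g x + of_int (c - 1))) x +
        (\<lambda>x\<in>cube n. 1 - f x) x)) x + (\<lambda>x\<in>cube n. clip (g x + of_int c)) x - 1)) x =
        (\<lambda>x\<in>cube n. clip (g x - f x + of_int c)) x"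
      using clip_add[OF f, of x "g x + of_int (c - 1)"] by (auto simp: algebra_simps)
  qed
qed

lemma int_combination_plus:
  assumes "int_combination G g" "int_combination G h" shows "int_combination G (\<lambda>x. g x + h x)"
  using assms(2)
proof induction
  case (const c)
  from assms(1) show ?case
  proof induction
    case (const d) then show ?case using int_combination.const[of G "d + c"] by simp
  next
    case (add g f) then show ?case using int_combination.add[of G "\<lambda>x. g x + of_int c" f] by (simp add: algebra_simps)
  next
    case (diff g f) then show ?case using int_combination.diff[of G "\<lambda>x. g x + of_int c" f] by (simp add: algebra_simps)
  qed
next
  case (add h f) then show ?case using int_combination.add[of G "\<lambda>x. g x + h x" f] by (simp add: algebra_simps)
next
  case (diff h f) then show ?case using int_combination.diff[of G "\<lambda>x. g x + h x" f] by (simp add: algebra_simps)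
qed

lemma int_combination_minus:
  assumes "int_combination G g" shows "int_combination G (\<lambda>x. - g x)"
  using assms
proof induction
  case (const c) then show ?case using int_combination.const[of G "- c"] by simp
next
  case (add h f) then show ?case using int_combination.diff[of G "\<lambda>x. - h x" f] by simp
next
  case (diff h f) then show ?case using int_combination.add[of G "\<lambda>x. - h x" f] by (simp add: algebra_simps)
qed

lemma int_combination_diff:
  assumes "int_combination G g" "int_combination G h" shows "int_combination G (\<lambda>x. g x - h x)"
  using int_combination_plus[OF assms(1) int_combination_minus[OF assms(2)]] by simp

lemma int_combination_mult_nat:
  assumes "int_combination G g" shows "int_combination G (\<lambda>x. of_nat k * g x)"
proof (induction k)
  case 0 then show ?case using int_combination.const[of G 0] by simp
next
  case (Suc k) then show ?case using int_combination_plus[OF assms Suc] by (simp add: algebra_simps)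
qed

lemma int_combination_mult:
  assumes "int_combination G g" shows "int_combination G (\<lambda>x. of_int k * g x)"
proof (cases k)
  case (nonneg m) then show ?thesis using int_combination_mult_nat[OF assms, of m] by simp
next
  case (neg m) then show ?thesis using int_combination_minus[OF int_combination_mult_nat[OF assms, of "Suc m"]]
    by (simp only: of_int_minus of_int_of_nat_eq mult_minus_left)
qed

lemma int_combination_sum:
  assumes "\<And>i. i \<in> I \<Longrightarrow> int_combination G (g i)" shows "int_combination G (\<lambda>x. \<Sum>i\<in>I. g i x)"
  using assms
proof (induction I rule: infinite_finite_induct)
  case (insert i I) then show ?case using int_combination_plus[of G "g i" "\<lambda>x. \<Sum>i\<in>I. g i x"] by simp
qed (use int_combination.const[of G 0] in simp_all)

lemma int_combination_base: "f \<in> G \<Longrightarrow> int_combination G f"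
  using int_combination.add[OF int_combination.const[of G 0]] by simp

lemma int_combination_mono: "int_combination G g \<Longrightarrow> G \<subseteq> H \<Longrightarrow> int_combination H g"
  by (induction rule: int_combination.induct) (auto intro: int_combination.intros)

section \<open>Polyhedral subdivisions of the cube\<close>

lemma int_affine_affine_fun: "p \<in> int_affine n \<Longrightarrow> affine_fun n p"
  unfolding int_affine_def affine_fun_def by fast

lemma affine_fun_cong:
  assumes "affine_fun n p" "\<And>i. i < n \<Longrightarrow> x i = y i" shows "p x = p y"
  using assms by (auto simp: affine_fun_def)

lemma cube_iff: "x \<in> cube n \<longleftrightarrow> x \<in> extensional {..<n} \<and> (\<forall>i<n. 0 \<le> x i \<and> x i \<le> 1)"
  by (auto simp: cube_def PiE_iff)

lemma cube_eqI: "x \<in> cube n \<Longrightarrow> y \<in> cube n \<Longrightarrow> (\<And>i. i < n \<Longrightarrow> x i = y i) \<Longrightarrow> x = y"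
  by (auto simp: cube_iff intro: extensionalityI)

definition segment :: "nat \<Rightarrow> (nat \<Rightarrow> real) \<Rightarrow> (nat \<Rightarrow> real) \<Rightarrow> real \<Rightarrow> nat \<Rightarrow> real" where
  "segment n x y s = restrict (\<lambda>i. (1 - s) * x i + s * y i) {..<n}"

lemma affine_fun_segment:
  assumes "affine_fun n p" shows "p (segment n x y s) = (1 - s) * p x + s * p y"
proof -
  obtain a b where p: "p = (\<lambda>x. b + (\<Sum>i<n. a i * x i))"
    using assms unfolding affine_fun_def by blast
  show ?thesis
    by (simp add: p segment_def algebra_simps sum.distrib sum_distrib_left sum_subtractf)
qed

lemma segment_cube:
  assumes "x \<in> cube n" "y \<in> cube n" "0 \<le> s" "s \<le> 1" shows "segment n x y s \<in> cube n"
  unfolding cube_iff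
proof (intro conjI allI impI)
  fix i assume "i < n"
  with assms show "0 \<le> segment n x y s i" "segment n x y s i \<le> 1"
    by (auto simp: segment_def cube_iff intro!: convex_bound_le add_nonneg_nonneg)
qed (simp add: segment_def)

lemma continuous_on_segment: "continuous_on A (segment n x y)"
  unfolding segment_def restrict_def
proof (rule continuous_on_coordinatewise_then_product)
  fix i show "continuous_on A (\<lambda>s. if i \<in> {..<n} then (1 - s) * x i + s * y i else undefined)"
    by (cases "i < n") (auto intro!: continuous_intros)
qed

definition generic :: "nat \<Rightarrow> ((nat \<Rightarrow> real) \<Rightarrow> real) set \<Rightarrow> (nat \<Rightarrow> real) \<Rightarrow> bool" where
  "generic n P g \<longleftrightarrow> g \<in> cube n \<and> (\<forall>p\<in>P. \<forall>q\<in>P. p \<noteq> q \<longrightarrow> p g \<noteq> q g)"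

text \<open>The hyperplanes p = q cut the cube into closed cells, and this is the cell that contains
  a generic \<open>g\<close>. It is full-dimensional since \<open>g\<close> lies on none of the
  hyperplanes.\<close>

definition region :: "nat \<Rightarrow> ((nat \<Rightarrow> real) \<Rightarrow> real) set \<Rightarrow> (nat \<Rightarrow> real) \<Rightarrow> (nat \<Rightarrow> real) set" where
  "region n P g = {y \<in> cube n. \<forall>p\<in>P. \<forall>q\<in>P. p g < q g \<longrightarrow> p y \<le> q y}"

text \<open>Almost every point of the moment curve \<open>(t, t\<^sup>2, \<dots>)\<close> is generic.\<close>

lemma generic_exists:
  assumes "finite P" "P \<subseteq> int_affine n" shows "\<exists>g. generic n P g"
proof -
  define z where "z t = restrict (\<lambda>i. t ^ Suc i) {..<n}" for t :: real
  have "finite {t. p (z t) = q (z t)}" if pq: "p \<in> P" "q \<in> P" "p \<noteq> q" for p q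
  proof -
    obtain a b where p: "p = (\<lambda>x. of_int b + (\<Sum>i<n. of_int (a i) * x i))"
      using assms(2) pq(1) unfolding int_affine_def by blast
    obtain a' b' where q: "q = (\<lambda>x. of_int b' + (\<Sum>i<n. of_int (a' i) * x i))"
      using assms(2) pq(2) unfolding int_affine_def by blast
    \<comment> \<open>Along the curve, \<open>p - q\<close> is a polynomial in \<open>t\<close>:
      coordinate \<open>i\<close> is the power with exponent \<open>i + 1\<close>, so its
      coefficient moves to index \<open>i + 1\<close> and index 0 holds the constant term.\<close>
    define c :: "nat \<Rightarrow> real" where "c j = (case j of 0 \<Rightarrow> of_int (b - b') | Suc i \<Rightarrow> of_int (a i - a' i))" for j
    have "\<exists>j\<le>n. c j \<noteq> 0"
    proof (rule ccontr)
      assume "\<not> (\<exists>j\<le>n. c j \<noteq> 0)"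
      then have c: "c j = 0" if "j \<le> n" for j using that by blast
      have "b = b'" using c[of 0] by (simp add: c_def)
      moreover have "a i = a' i" if "i < n" for i using c[of "Suc i"] that by (simp add: c_def)
      ultimately show False using \<open>p \<noteq> q\<close> by (simp add: p q)
    qed
    then have "finite {t. (\<Sum>j\<le>n. c j * t ^ j) = 0}" by (simp add: polyfun_finite_roots)
    moreover have "(\<Sum>j\<le>n. c j * t ^ j) = p (z t) - q (z t)" for t
      unfolding p q z_def
      by (subst sum.atMost_shift) (simp add: c_def sum_subtractf left_diff_distrib)
    ultimately show ?thesis by simp
  qed
  then have "finite (\<Union>p\<in>P. \<Union>q\<in>P - {p}. {t. p (z t) = q (z t)})"
    using assms(1) by (intro finite_UN_I finite_Diff) auto
  moreover have "infinite {0<..<1::real}" by (simp add: infinite_Ioo)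
  ultimately have "\<not> {0<..<1} \<subseteq> (\<Union>p\<in>P. \<Union>q\<in>P - {p}. {t. p (z t) = q (z t)})"
    by (intro notI) (erule (1) finite_subset[THEN notE[rotated]])
  then obtain t where t: "0 < t" "t < 1" "t \<notin> (\<Union>p\<in>P. \<Union>q\<in>P - {p}. {t. p (z t) = q (z t)})"
    unfolding subset_iff greaterThanLessThan_iff by blast
  have "z t \<in> cube n" unfolding cube_iff z_def
    using t by (auto simp del: power_Suc intro!: power_le_one)
  with t(3) show ?thesis unfolding generic_def by (intro exI[of _ "z t"]) blast
qed

text \<open>Moving \<open>x\<close> slightly towards a generic point gives \<open>g\<close>: strict
  inequalities at \<open>x\<close> persist, and ties at \<open>x\<close> are broken by the generic
  point.\<close>

lemma region_cover:
  assumes "finite P" "P \<subseteq> int_affine n" "x \<in> cube n"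
  shows "\<exists>g. generic n P g \<and> x \<in> region n P g"
proof -
  obtain z where z: "z \<in> cube n" "\<And>p q. p \<in> P \<Longrightarrow> q \<in> P \<Longrightarrow> p \<noteq> q \<Longrightarrow> p z \<noteq> q z"
    using generic_exists[OF assms(1,2)] unfolding generic_def by blast
  have aff: "affine_fun n p" if "p \<in> P" for p using assms(2) that int_affine_affine_fun by blast
  let ?ok = "\<lambda>p q s. p (segment n x z s) \<noteq> q (segment n x z s) \<and>
      (p (segment n x z s) < q (segment n x z s) \<longrightarrow> p x \<le> q x)"
  have "\<forall>\<^sub>F s in at_right 0. \<forall>p\<in>P. \<forall>q\<in>P - {p}. ?ok p q s"
  proof (intro eventually_ball_finite ballI)
    fix p q assume pq: "p \<in> P" "q \<in> P - {p}"
    have eq: "p (segment n x z s) - q (segment n x z s) = (1 - s) * (p x - q x) + s * (p z - q z)" for s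
      using affine_fun_segment[OF aff, of p x z s] affine_fun_segment[OF aff, of q x z s] pq
      by (simp add: algebra_simps)
    show "\<forall>\<^sub>F s in at_right 0. ?ok p q s"
    proof (cases "p x = q x")
      case True
      have "p (segment n x z s) \<noteq> q (segment n x z s)" if "s > 0" for s
        using eq[of s] True z(2)[of p q] pq that by auto
      then show ?thesis using True eventually_at_right_less[of "0::real"] by (auto elim: eventually_mono)
    next
      case False
      have lim: "((\<lambda>s. (1 - s) * (p x - q x) + s * (p z - q z)) \<longlongrightarrow> (1 - 0) * (p x - q x) + 0 * (p z - q z)) (at_right 0)"
        by (intro tendsto_intros)
      show ?thesis
      proof (cases "p x < q x")
        case True
        then have "\<forall>\<^sub>F s in at_right 0. (1 - s) * (p x - q x) + s * (p z - q z) < 0"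
          by (intro order_tendstoD(2)[OF lim]) simp
        then show ?thesis
        proof (rule eventually_mono)
          fix s :: real assume "(1 - s) * (p x - q x) + s * (p z - q z) < 0"
          with eq[of s] True show "?ok p q s" by linarith
        qed
      next
        case f: False
        then have "\<forall>\<^sub>F s in at_right 0. (1 - s) * (p x - q x) + s * (p z - q z) > 0"
          using False by (intro order_tendstoD(1)[OF lim]) simp
        then show ?thesis
        proof (rule eventually_mono)
          fix s :: real assume "(1 - s) * (p x - q x) + s * (p z - q z) > 0"
          with eq[of s] show "?ok p q s" by linarith
        qed
      qed
    qed
  qed (use assms(1) in auto)
  moreover have "\<forall>\<^sub>F s in at_right 0. s < (1::real)"
    by (rule order_tendstoD(2)[OF tendsto_ident_at]) simp
  moreover have "\<forall>\<^sub>F s in at_right 0. s > (0::real)" by (rule eventually_at_right_less)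
  ultimately have "\<forall>\<^sub>F s in at_right 0. (\<forall>p\<in>P. \<forall>q\<in>P - {p}. ?ok p q s) \<and> s < 1 \<and> 0 < s"
    by (intro eventually_conj)
  then obtain s where s: "\<forall>p\<in>P. \<forall>q\<in>P - {p}. ?ok p q s" "s < 1" "0 < s"
    using eventually_happens trivial_limit_at_right_real by blast
  let ?g = "segment n x z s"
  have "?g \<in> cube n" by (rule segment_cube) (use s z assms in auto)
  moreover have "p ?g \<noteq> q ?g" if "p \<in> P" "q \<in> P" "p \<noteq> q" for p q using s(1) that by simp
  ultimately have "generic n P ?g" unfolding generic_def by simp
  moreover have "p x \<le> q x" if "p \<in> P" "q \<in> P" "p ?g < q ?g" for p q
    using s(1) that by (cases "p = q") auto
  then have "x \<in> region n P ?g" unfolding region_def using assms(3) by simp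
  ultimately show ?thesis by blast
qed

text \<open>A region depends only on which pairs from \<open>P\<close> are strictly ordered at
  \<open>g\<close>.\<close>

lemma finite_regions:
  assumes "finite P" shows "finite {region n P g | g. generic n P g}"
proof -
  have "region n P g = {y \<in> cube n. \<forall>(p, q)\<in>{(p, q) \<in> P \<times> P. p g < q g}. p y \<le> q y}" for g
    unfolding region_def by blast
  then have "{region n P g | g. generic n P g} \<subseteq>
      (\<lambda>R. {y \<in> cube n. \<forall>(p, q)\<in>R. p y \<le> q y}) ` Pow (P \<times> P)" by blast
  with assms show ?thesis by (meson finite_Pow_iff finite_SigmaI finite_imageI finite_subset)
qed

text \<open>On the segment from \<open>g\<close> to \<open>y\<close>, without the endpoint
  \<open>y\<close>, distinct pieces never take equal values. The sets where \<open>f\<close> agrees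
  with the various pieces are therefore disjoint, relatively closed and finite in number; by
  connectedness \<open>f\<close> follows one piece. The point \<open>y\<close> may lie on a wall and
  is reached by continuity.\<close>

lemma region_piece:
  assumes P: "finite P" "P \<subseteq> int_affine n" and g: "generic n P g"
    and f: "f \<in> mcnaughton_functions n" "\<forall>x\<in>cube n. \<exists>p\<in>P. f x = p x"
  shows "\<exists>p\<in>P. \<forall>y\<in>region n P g. f y = p y"
proof -
  have gc: "g \<in> cube n" and gen: "\<And>p q. p \<in> P \<Longrightarrow> q \<in> P \<Longrightarrow> p \<noteq> q \<Longrightarrow> p g \<noteq> q g"
    using g unfolding generic_def by blast+
  have aff: "affine_fun n p" if "p \<in> P" for p using P(2) that int_affine_affine_fun by blast
  obtain p where p: "p \<in> P" "f g = p g" using f(2) gc by blast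
  have "f y = p y" if y: "y \<in> region n P g" for y
  proof -
    have yc: "y \<in> cube n" and yle: "\<And>p q. p \<in> P \<Longrightarrow> q \<in> P \<Longrightarrow> p g < q g \<Longrightarrow> p y \<le> q y"
      using y unfolding region_def by blast+
    let ?\<gamma> = "segment n g y"
    have \<gamma>: "?\<gamma> s \<in> cube n" if "s \<in> {0..1}" for s using segment_cube[OF gc yc] that by simp
    have ne: "q (?\<gamma> s) \<noteq> r (?\<gamma> s)" if "q \<in> P" "r \<in> P" "q \<noteq> r" "s \<in> {0..<1}" for q r s
    proof -
      have lt: "q (?\<gamma> s) < r (?\<gamma> s)" if qr: "q \<in> P" "r \<in> P" "q g < r g" for q r
      proof -
        have "(1 - s) * q g < (1 - s) * r g" "s * q y \<le> s * r y"
          using \<open>s \<in> {0..<1}\<close> qr yle[OF qr] by (auto intro: mult_left_mono)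
        then show ?thesis unfolding affine_fun_segment[OF aff[OF qr(1)]] affine_fun_segment[OF aff[OF qr(2)]]
          by (rule add_less_le_mono)
      qed
      from gen[OF that(1-3)] show ?thesis using lt[of q r] lt[of r q] that by fastforce
    qed
    have cf: "continuous_on {0..1} (\<lambda>s. f (?\<gamma> s))"
      using f(1) \<gamma> unfolding mcnaughton_functions_def
      by (intro continuous_on_compose2[OF _ continuous_on_segment]) auto
    have cp: "continuous_on {0..1} (\<lambda>s. q (?\<gamma> s))" if "q \<in> P" for q
      by (simp add: affine_fun_segment[OF aff[OF that]]) (intro continuous_intros)
    have cl: "closedin (top_of_set {0..<1}) {s \<in> {0..<1}. f (?\<gamma> s) - q (?\<gamma> s) = 0}" if "q \<in> P" for q
      by (rule continuous_closedin_preimage_constant)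
        (use cf cp[OF that] in \<open>auto intro!: continuous_intros elim: continuous_on_subset\<close>)
    let ?A = "{s \<in> {0..<1}. f (?\<gamma> s) - p (?\<gamma> s) = 0}"
    let ?B = "\<Union>q\<in>P - {p}. {s \<in> {0..<1}. f (?\<gamma> s) - q (?\<gamma> s) = 0}"
    have "closedin (top_of_set {0..<1}) ?B" by (rule closedin_Union) (use P cl in auto)
    moreover have "closedin (top_of_set {0..<1}) ?A" by (rule cl[OF p(1)])
    moreover have "?A \<union> ?B = {0..<1}"
    proof -
      have "\<exists>q\<in>P. f (?\<gamma> s) = q (?\<gamma> s)" if "s \<in> {0..<1}" for s using f(2) \<gamma>[of s] that by auto
      then show ?thesis by (simp add: set_eq_iff) fastforce
    qed
    moreover have "?A \<inter> ?B = {}"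
    proof -
      have "\<not> (f (?\<gamma> s) - p (?\<gamma> s) = 0 \<and> f (?\<gamma> s) - q (?\<gamma> s) = 0)" if "s \<in> {0..<1}" "q \<in> P - {p}" for s q
        using ne[OF p(1), of q s] that by auto
      then show ?thesis by blast
    qed
    moreover have "?A \<noteq> {}"
    proof -
      have "?\<gamma> 0 = g" by (rule cube_eqI[OF \<gamma> gc]) (auto simp: segment_def)
      then show ?thesis using p(2) by (intro ex_in_conv[THEN iffD1] exI[of _ 0]) simp
    qed
    moreover have "A = {} \<or> B = {}" if "closedin (top_of_set {0..<1}) B" "closedin (top_of_set {0..<1}) A"
      "A \<union> B = {0..<1::real}" "A \<inter> B = {}" for A B
    proof -
      have "connected {0..<1::real}" by simp
      then show ?thesis using that unfolding connected_closedin_eq by blast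
    qed
    ultimately have "?B = {}" by (metis (no_types, lifting))
    with \<open>?A \<union> ?B = {0..<1}\<close> have A: "f (?\<gamma> s) - p (?\<gamma> s) = 0" if "s \<in> {0..<1}" for s using that by blast
    have "f (?\<gamma> 1) - p (?\<gamma> 1) = 0"
      by (rule continuous_constant_on_closure[of "{0..<1}" "\<lambda>s. f (?\<gamma> s) - p (?\<gamma> s)"])
        (use A cf cp[OF p(1)] in \<open>auto intro!: continuous_intros\<close>)
    moreover have "?\<gamma> 1 = y" by (rule cube_eqI[OF \<gamma> yc]) (auto simp: segment_def)
    ultimately show ?thesis by simp
  qed
  with p(1) show ?thesis by blast
qed

section \<open>Affine functions near a point and on the cube\<close>

lemma affine_fun_lipschitz:
  assumes "affine_fun n p"
  shows "\<exists>L>0. \<forall>x y \<delta>. 0 \<le> \<delta> \<longrightarrow> (\<forall>i<n. \<bar>x i - y i\<bar> \<le> \<delta>) \<longrightarrow> \<bar>p x - p y\<bar> \<le> L * \<delta>"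
proof -
  obtain a b where p: "p = (\<lambda>x. b + (\<Sum>i<n. a i * x i))"
    using assms unfolding affine_fun_def by blast
  have "\<bar>p x - p y\<bar> \<le> (1 + (\<Sum>i<n. \<bar>a i\<bar>)) * \<delta>" if "\<forall>i<n. \<bar>x i - y i\<bar> \<le> \<delta>" "0 \<le> \<delta>" for x y \<delta>
  proof -
    have "\<bar>p x - p y\<bar> = \<bar>\<Sum>i<n. a i * (x i - y i)\<bar>"
      by (simp add: p right_diff_distrib sum_subtractf)
    also have "\<dots> \<le> (\<Sum>i<n. \<bar>a i\<bar> * \<bar>x i - y i\<bar>)"
      by (rule order_trans[OF sum_abs]) (simp add: abs_mult)
    also have "\<dots> \<le> (\<Sum>i<n. \<bar>a i\<bar> * \<delta>)" using that by (intro sum_mono mult_left_mono) auto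
    finally show ?thesis using that(2) by (simp add: distrib_right sum_distrib_right)
  qed
  moreover have "0 < 1 + (\<Sum>i<n. \<bar>a i\<bar>)" by (simp add: add_pos_nonneg sum_nonneg)
  ultimately show ?thesis by blast
qed

lemma affine_fun_bounded:
  assumes "affine_fun n p" shows "\<exists>B. \<forall>x\<in>cube n. \<bar>p x\<bar> \<le> B"
proof -
  obtain L where L: "\<And>x y \<delta>. 0 \<le> \<delta> \<Longrightarrow> (\<forall>i<n. \<bar>x i - y i\<bar> \<le> \<delta>) \<Longrightarrow> \<bar>p x - p y\<bar> \<le> L * \<delta>"
    using affine_fun_lipschitz[OF assms] by blast
  have "\<bar>p x\<bar> \<le> \<bar>p (\<lambda>_. 0)\<bar> + L" if "x \<in> cube n" for x
    using L[of 1 x "\<lambda>_. 0"] that by (auto simp: cube_iff)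
  then show ?thesis by blast
qed

lemma strict_ball:
  assumes "finite P" "P \<subseteq> int_affine n"
  shows "\<exists>\<rho>>0. \<forall>y. (\<forall>i<n. \<bar>y i - g i\<bar> \<le> \<rho>) \<longrightarrow> (\<forall>p\<in>P. \<forall>q\<in>P. p g < q g \<longrightarrow> p y < q y)"
proof -
  let ?R = "\<lambda>(p, q) \<rho>. \<forall>y. (\<forall>i<n. \<bar>y i - g i\<bar> \<le> \<rho>) \<longrightarrow> p g < q g \<longrightarrow> p y < q y"
  have "\<exists>\<rho>>0. ?R pq \<rho>" if "pq \<in> P \<times> P" for pq
  proof (cases "fst pq g < snd pq g")
    case True
    obtain p q where pq: "pq = (p, q)" by force
    have "affine_fun n p" "affine_fun n q"
      using that assms(2) int_affine_affine_fun unfolding pq by blast+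
    from affine_fun_lincomb[OF this(2,1), of 1 "- 1"] have "affine_fun n (\<lambda>x. q x - p x)" by simp
    then obtain L where L: "L > 0"
      "\<And>x y \<delta>. 0 \<le> \<delta> \<Longrightarrow> (\<forall>i<n. \<bar>x i - y i\<bar> \<le> \<delta>) \<Longrightarrow> \<bar>(q x - p x) - (q y - p y)\<bar> \<le> L * \<delta>"
      using affine_fun_lipschitz[of n "\<lambda>x. q x - p x"] by blast
    define \<rho> where "\<rho> = (q g - p g) / (2 * L)"
    have \<rho>: "\<rho> > 0" "L * \<rho> = (q g - p g) / 2" using True L(1) by (auto simp: \<rho>_def pq)
    have "?R pq \<rho>"
      unfolding pq prod.case
    proof (intro allI impI)
      fix y assume "\<forall>i<n. \<bar>y i - g i\<bar> \<le> \<rho>"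
      from L(2)[OF less_imp_le[OF \<rho>(1)] this, THEN abs_le_D2] have "- ((q y - p y) - (q g - p g)) \<le> (q g - p g) / 2"
        unfolding \<rho>(2) .
      moreover have "p g < q g" using True by (simp add: pq)
      ultimately show "p y < q y" by argo
    qed
    with \<rho>(1) show ?thesis by blast
  next
    case False
    then show ?thesis by (intro exI[of _ 1]) (auto split: prod.splits)
  qed
  then have "\<forall>pq\<in>P \<times> P. \<exists>\<rho>. \<rho> > 0 \<and> ?R pq \<rho>" by simp
  from bchoice[OF this] obtain r where r: "\<forall>pq\<in>P \<times> P. r pq > 0 \<and> ?R pq (r pq)" ..
  define \<rho> where "\<rho> = Min (insert 1 (r ` (P \<times> P)))"
  have fin: "finite (insert 1 (r ` (P \<times> P)))" using assms(1) by simp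
  have "\<rho> > 0" unfolding \<rho>_def using r fin by (subst Min_gr_iff) auto
  moreover have "p y < q y" if y: "\<forall>i<n. \<bar>y i - g i\<bar> \<le> \<rho>" and pq: "p \<in> P" "q \<in> P" "p g < q g" for y p q
  proof -
    have "\<rho> \<le> r (p, q)" unfolding \<rho>_def using pq by (intro Min_le[OF fin]) auto
    with y have "\<forall>i<n. \<bar>y i - g i\<bar> \<le> r (p, q)" by fastforce
    with bspec[OF r, of "(p, q)"] pq show ?thesis by simp
  qed
  ultimately show ?thesis by blast
qed

section \<open>The error bound\<close>

text \<open>A Hoffman-type bound on the polyhedron given by \<open>Ds\<close>, with the sum of the
  truncated \<open>s i\<close> as residual. By \<open>zero\<close>, adding the strict constraint h >
  0 makes the system infeasible, and \<open>infeasible_certificate\<close> turns this into an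
  inequality between \<open>h\<close> and the residual. The upper bound \<open>B\<close> on the
  \<open>s i\<close> makes truncation at 1 harmless.\<close>

lemma error_bound:
  assumes fin: "finite Ds" "finite I" and aff: "\<And>d. d \<in> Ds \<Longrightarrow> affine_fun n d" "\<And>i. i \<in> I \<Longrightarrow> affine_fun n (s i)" "affine_fun n h"
    and zero: "\<And>x. \<forall>d\<in>Ds. d x \<ge> 0 \<Longrightarrow> \<forall>i\<in>I. s i x \<le> 0 \<Longrightarrow> h x \<le> 0"
    and B: "\<And>x. \<forall>d\<in>Ds. d x \<ge> 0 \<Longrightarrow> h x \<le> B" "\<And>x i. \<forall>d\<in>Ds. d x \<ge> 0 \<Longrightarrow> i \<in> I \<Longrightarrow> s i x \<le> B"
  shows "\<exists>N::nat. \<forall>x. (\<forall>d\<in>Ds. d x \<ge> 0) \<longrightarrow> h x \<le> real N * (\<Sum>i\<in>I. clip (s i x))"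
proof -
  define u where "u x = (\<Sum>i\<in>I. clip (s i x))" for x
  have u0: "u x \<ge> 0" for x unfolding u_def by (intro sum_nonneg clip_nonneg)
  \<comment> \<open>On the polyhedron, \<open>f\<close> dominates \<open>\<nu> * h - M * u\<close>,
    and \<nu> is positive once the strict constraint h > 0 has been used. This property is closed
    under positive combinations.\<close>
  define Q where "Q f st \<longleftrightarrow> (\<exists>M\<ge>0. \<exists>\<nu>\<ge>0. (st \<longrightarrow> \<nu> > 0) \<and>
      (\<forall>x. (\<forall>d\<in>Ds. d x \<ge> 0) \<longrightarrow> f x \<ge> \<nu> * h x - M * u x))" for f :: "(nat \<Rightarrow> real) \<Rightarrow> real" and st
  have QI: "Q f st" if "M \<ge> 0" "\<nu> \<ge> 0" "st \<Longrightarrow> \<nu> > 0"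
    "\<And>x. \<forall>d\<in>Ds. d x \<ge> 0 \<Longrightarrow> f x \<ge> \<nu> * h x - M * u x" for M \<nu> f st
    unfolding Q_def using that by blast
  let ?S = "(\<lambda>d. (d, False)) ` Ds \<union> (\<lambda>i. (\<lambda>x. - s i x, False)) ` I \<union> {(h, True)}"
  have "\<exists>b st. Q (\<lambda>_. b) st \<and> (if st then b \<le> 0 else b < 0)"
  proof (rule infeasible_certificate)
    show "finite ?S" using fin by simp
    show "affine_fun n (fst c)" if "c \<in> ?S" for c
      using that aff affine_fun_lincomb[OF aff(2) aff(3), of _ "- 1" 0] by auto
    show "\<nexists>x. \<forall>c\<in>?S. sat c x"
    proof
      assume "\<exists>x. \<forall>c\<in>?S. sat c x"
      then obtain x where "\<forall>c\<in>?S. sat c x" by blast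
      then have "\<forall>d\<in>Ds. d x \<ge> 0" "\<forall>i\<in>I. s i x \<le> 0" "h x > 0"
        by (auto simp: sat_def ball_Un)
      with zero[of x] show False by simp
    qed
    show "Q (fst c) (snd c)" if c: "c \<in> ?S" for c
    proof -
      consider d where "d \<in> Ds" "c = (d, False)" | i where "i \<in> I" "c = (\<lambda>x. - s i x, False)" | "c = (h, True)"
        using c by blast
      then show ?thesis
      proof cases
        case 1 then show ?thesis by (intro QI[of 0 0]) auto
      next
        case 2
        have "s i x \<le> max 1 B * u x" if x: "\<forall>d\<in>Ds. d x \<ge> 0" for x
        proof -
          have "s i x \<le> max 1 B * clip (s i x)"
          proof (cases "s i x \<le> 1")
            case True
            have "s i x \<le> 1 * clip (s i x)" using True by (simp add: clip_def)
            also have "\<dots> \<le> max 1 B * clip (s i x)" by (intro mult_right_mono) (auto simp: clip_nonneg)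
            finally show ?thesis .
          next
            case False then show ?thesis using B(2)[OF x 2(1)] by (simp add: clip_def)
          qed
          also have "clip (s i x) \<le> u x" unfolding u_def
            by (rule member_le_sum[OF 2(1) _ fin(2)]) (rule clip_nonneg)
          then have "max 1 B * clip (s i x) \<le> max 1 B * u x" by (intro mult_left_mono) auto
          finally show ?thesis .
        qed
        then show ?thesis unfolding 2(2) by (intro QI[of "max 1 B" 0]) auto
      next
        case 3 then show ?thesis by (intro QI[of 0 1]) auto
      qed
    qed
    show "Q (\<lambda>x. \<alpha> * f x + \<beta> * g x) (st \<or> t)" if fg: "Q f st" "Q g t" and ab: "\<alpha> > 0" "\<beta> > 0" for f g st t \<alpha> \<beta>
    proof -
      obtain M \<nu> where 1: "M \<ge> 0" "\<nu> \<ge> 0" "st \<longrightarrow> \<nu> > 0" "\<And>x. \<forall>d\<in>Ds. d x \<ge> 0 \<Longrightarrow> f x \<ge> \<nu> * h x - M * u x"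
        using fg(1) unfolding Q_def by blast
      obtain M' \<nu>' where 2: "M' \<ge> 0" "\<nu>' \<ge> 0" "t \<longrightarrow> \<nu>' > 0" "\<And>x. \<forall>d\<in>Ds. d x \<ge> 0 \<Longrightarrow> g x \<ge> \<nu>' * h x - M' * u x"
        using fg(2) unfolding Q_def by blast
      show ?thesis
      proof (rule QI[of "\<alpha> * M + \<beta> * M'" "\<alpha> * \<nu> + \<beta> * \<nu>'"])
        show "\<alpha> * \<nu> + \<beta> * \<nu>' > 0" if "st \<or> t"
          using that 1(2,3) 2(2,3) ab by (auto intro: add_pos_nonneg add_nonneg_pos)
        fix x assume x: "\<forall>d\<in>Ds. d x \<ge> 0"
        show "(\<alpha> * \<nu> + \<beta> * \<nu>') * h x - (\<alpha> * M + \<beta> * M') * u x \<le> \<alpha> * f x + \<beta> * g x"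
          using mult_left_mono[OF 1(4)[OF x], of \<alpha>] mult_left_mono[OF 2(4)[OF x], of \<beta>] ab
          by (simp add: algebra_simps)
      qed (use 1(1,2) 2(1,2) ab in auto)
    qed
  qed
  then obtain b st M \<nu> where b: "if st then b \<le> 0 else b < 0" and M: "M \<ge> 0" "\<nu> \<ge> 0" "st \<longrightarrow> \<nu> > 0"
    and ineq: "\<And>x. \<forall>d\<in>Ds. d x \<ge> 0 \<Longrightarrow> b \<ge> \<nu> * h x - M * u x"
    unfolding Q_def by blast
  have "\<exists>K. \<forall>x. (\<forall>d\<in>Ds. d x \<ge> 0) \<longrightarrow> h x \<le> K * u x"
  proof (cases "\<nu> > 0")
    case True
    have "h x \<le> (M / \<nu>) * u x" if "\<forall>d\<in>Ds. d x \<ge> 0" for x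
    proof -
      have "\<nu> * h x \<le> M * u x" using ineq[OF that] b by (auto split: if_splits)
      then show ?thesis using True by (simp add: field_simps)
    qed
    then show ?thesis by blast
  next
    case False
    \<comment> \<open>In this case the residual is bounded away from 0 on the polyhedron, so the
      upper bound \<open>B\<close> on \<open>h\<close> is enough.\<close>
    then have "\<nu> = 0" "b < 0" using M b by (auto split: if_splits)
    have "h x \<le> (\<bar>B\<bar> * M / (- b)) * u x" if x: "\<forall>d\<in>Ds. d x \<ge> 0" for x
    proof -
      have "- b \<le> M * u x" using ineq[OF x] \<open>\<nu> = 0\<close> by simp
      then have "\<bar>B\<bar> * 1 \<le> \<bar>B\<bar> * (M * u x / (- b))"
        using \<open>b < 0\<close> by (intro mult_left_mono) (auto simp: field_simps)
      with B(1)[OF x] show ?thesis by simp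
    qed
    then show ?thesis by blast
  qed
  then obtain K where K: "\<And>x. \<forall>d\<in>Ds. d x \<ge> 0 \<Longrightarrow> h x \<le> K * u x" by blast
  obtain N :: nat where "K \<le> real N" using real_arch_simple by blast
  then have "h x \<le> real N * u x" if "\<forall>d\<in>Ds. d x \<ge> 0" for x
    using K[OF that] mult_right_mono[OF _ u0, of K "real N" x] by simp
  then show ?thesis unfolding u_def by blast
qed

section \<open>Generation of all McNaughton functions\<close>

definition grid_point :: "nat \<Rightarrow> nat \<Rightarrow> (nat \<Rightarrow> nat) \<Rightarrow> nat \<Rightarrow> real" where
  "grid_point n E v = restrict (\<lambda>i. real (v i) / real E) {..<n}"

lemma grid_point_cube: "(\<And>i. i < n \<Longrightarrow> v i \<le> E) \<Longrightarrow> grid_point n E v \<in> cube n"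
  by (auto simp: grid_point_def cube_iff divide_le_eq_1)

lemma int_affine_int_combination:
  assumes "p \<in> int_affine n" "\<And>i. i < n \<Longrightarrow> int_combination G (\<lambda>y. l i y)"
  shows "int_combination G (\<lambda>y. p (restrict (\<lambda>i. l i y) {..<n}))"
proof -
  obtain a b where p: "p = (\<lambda>x. of_int b + (\<Sum>i<n. of_int (a i) * x i))"
    using assms(1) unfolding int_affine_def by blast
  have "int_combination G (\<lambda>y. of_int b + (\<Sum>i<n. of_int (a i) * l i y))"
    by (intro int_combination_plus int_combination.const int_combination_sum int_combination_mult assms(2)) simp
  then show ?thesis by (simp add: p)
qed

text \<open>One target \<phi> is fixed, so that a single finite \<open>P\<close> serves \<phi> and
  all generators. The constants and coordinates belong to \<open>P\<close> to make the faces of the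
  cube walls of the subdivision.\<close>

locale subdivision =
  fixes n :: nat and G P :: "((nat \<Rightarrow> real) \<Rightarrow> real) set" and \<phi> :: "(nat \<Rightarrow> real) \<Rightarrow> real"
  assumes finite_G: "finite G" and G: "G \<subseteq> mcnaughton_functions n" and \<phi>: "\<phi> \<in> mcnaughton_functions n"
    and injective: "\<And>x y. x \<in> cube n \<Longrightarrow> y \<in> cube n \<Longrightarrow> \<forall>f\<in>G. f x = f y \<Longrightarrow> x = y"
    and denominators: "\<And>E D v i. E > 0 \<Longrightarrow> (\<And>i. i < n \<Longrightarrow> v i \<le> E) \<Longrightarrow>
        \<forall>f\<in>G. real D * f (grid_point n E v) \<in> \<int> \<Longrightarrow> i < n \<Longrightarrow> real D * grid_point n E v i \<in> \<int>"
    and P: "finite P" "P \<subseteq> int_affine n" "(\<lambda>_. 0) \<in> P" "(\<lambda>_. 1) \<in> P" "\<And>i. i < n \<Longrightarrow> (\<lambda>x. x i) \<in> P"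
    and pieces: "\<And>f x. f \<in> insert \<phi> G \<Longrightarrow> x \<in> cube n \<Longrightarrow> \<exists>p\<in>P. f x = p x"
begin

lemma region_affine:
  assumes "generic n P g" "f \<in> insert \<phi> G"
  shows "\<exists>p. p \<in> int_affine n \<and> (\<forall>y\<in>region n P g. f y = p y)"
proof -
  have "f \<in> mcnaughton_functions n" using assms(2) G \<phi> by blast
  moreover have "\<forall>x\<in>cube n. \<exists>p\<in>P. f x = p x" using pieces[OF assms(2)] by simp
  ultimately have "\<exists>p\<in>P. \<forall>y\<in>region n P g. f y = p y" by (rule region_piece[OF P(1,2) assms(1)])
  then show ?thesis using P(2) by blast
qed

text \<open>A generic point has 0 < g i < 1, since its coordinates cannot tie with the constants; so
  0 \<le> x i \<le> 1 is among the order relations within \<open>P\<close>. This yields the bounds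
  for points not known to lie in the cube.\<close>

lemma order_imp_bounds:
  assumes g: "generic n P g" and le: "\<And>p q. p \<in> P \<Longrightarrow> q \<in> P \<Longrightarrow> p g < q g \<Longrightarrow> p y \<le> q y" and i: "i < n"
  shows "0 \<le> y i \<and> y i \<le> 1"
proof -
  have gc: "g \<in> cube n" and gen: "\<And>p q. p \<in> P \<Longrightarrow> q \<in> P \<Longrightarrow> p \<noteq> q \<Longrightarrow> p g \<noteq> q g"
    using g unfolding generic_def by blast+
  have "(\<lambda>x. x i) \<noteq> (\<lambda>_. c :: real)" for c
    by (rule notI, drule fun_cong[of _ _ "\<lambda>_. c + 1"]) simp
  then have "0 < g i" "g i < 1"
    using gen[OF P(5)[OF i] P(3)] gen[OF P(5)[OF i] P(4)] gc i by (auto simp: cube_iff less_le)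
  then show ?thesis using le[OF P(3) P(5)[OF i]] le[OF P(5)[OF i] P(4)] by simp
qed

lemma region_ball:
  assumes g: "generic n P g"
  shows "\<exists>\<rho>>0. \<forall>y\<in>extensional {..<n}. (\<forall>i<n. \<bar>y i - g i\<bar> \<le> \<rho>) \<longrightarrow> y \<in> region n P g"
proof -
  obtain \<rho> where \<rho>: "\<rho> > 0"
    "\<And>y p q. \<forall>i<n. \<bar>y i - g i\<bar> \<le> \<rho> \<Longrightarrow> p \<in> P \<Longrightarrow> q \<in> P \<Longrightarrow> p g < q g \<Longrightarrow> p y < q y"
    using strict_ball[OF P(1,2), of g] by blast
  have "y \<in> region n P g" if y: "y \<in> extensional {..<n}" "\<forall>i<n. \<bar>y i - g i\<bar> \<le> \<rho>" for y
  proof -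
    have "0 \<le> y i \<and> y i \<le> 1" if "i < n" for i
      using \<rho>(2)[OF y(2)] by (intro order_imp_bounds[OF g _ that] less_imp_le)
    then have "y \<in> cube n" using y(1) by (simp add: cube_iff)
    then show ?thesis unfolding region_def using \<rho>(2)[OF y(2)] by (simp add: less_imp_le)
  qed
  with \<rho>(1) show ?thesis by blast
qed

text \<open>If a coordinate were no integer combination of the generators, a character of the quotient
  group would yield a rational point of the region whose image has a smaller denominator.\<close>

lemma coordinate_int_combination:
  assumes g: "generic n P g" and i: "i < n"
  shows "\<exists>l. int_combination G l \<and> (\<forall>y\<in>region n P g. y i = l y)"
proof (rule ccontr)
  assume no: "\<not> ?thesis"
  \<comment> \<open>Coefficient vectors, with the constant term at index \<open>n\<close>, of the
    affine functions that integer combinations of \<open>G\<close> realise on the region.\<close>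
  define H where "H = {r :: nat \<Rightarrow> int. \<exists>l. int_combination G l \<and>
      (\<forall>y\<in>region n P g. l y = of_int (r n) + (\<Sum>j<n. of_int (r j) * y j))}"
  define e where "e j = (if j = i then 1 else 0 :: int)" for j
  have H0: "(\<lambda>_. 0) \<in> H" unfolding H_def using int_combination.const[of G 0] by (auto intro!: exI[of _ "\<lambda>_. 0"])
  have H1: "(\<lambda>j. if j = n then 1 else 0) \<in> H"
    unfolding H_def using int_combination.const[of G 1] by (auto intro!: exI[of _ "\<lambda>_. 1"] sum.neutral)
  have Hadd: "(\<lambda>j. r j + k * s j) \<in> H" if rs: "r \<in> H" "s \<in> H" for r s k
  proof -
    obtain l where l: "int_combination G l" "\<And>y. y \<in> region n P g \<Longrightarrow> l y = of_int (r n) + (\<Sum>j<n. of_int (r j) * y j)"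
      using rs(1) unfolding H_def by blast
    obtain m where m: "int_combination G m" "\<And>y. y \<in> region n P g \<Longrightarrow> m y = of_int (s n) + (\<Sum>j<n. of_int (s j) * y j)"
      using rs(2) unfolding H_def by blast
    have "int_combination G (\<lambda>y. l y + of_int k * m y)"
      by (intro int_combination_plus int_combination_mult l m)
    moreover have "l y + of_int k * m y = of_int (r n + k * s n) + (\<Sum>j<n. of_int (r j + k * s j) * y j)"
      if "y \<in> region n P g" for y
      by (simp add: l(2)[OF that] m(2)[OF that] distrib_left distrib_right sum.distrib sum_distrib_left mult.assoc)
    ultimately show ?thesis unfolding H_def by blast
  qed
  have "\<nexists>r. r \<in> H \<and> (\<forall>j<Suc n. r j = e j)"
  proof
    assume "\<exists>r. r \<in> H \<and> (\<forall>j<Suc n. r j = e j)"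
    then obtain r l where r: "\<And>j. j < Suc n \<Longrightarrow> r j = e j" and l: "int_combination G l"
      "\<And>y. y \<in> region n P g \<Longrightarrow> l y = of_int (r n) + (\<Sum>j<n. of_int (r j) * y j)"
      unfolding H_def by blast
    have "of_int (r n) + (\<Sum>j<n. of_int (r j) * y j) = y i" for y :: "nat \<Rightarrow> real"
      using i r by (simp add: e_def sum.delta if_distrib[of "\<lambda>c. c * _"] if_distrib[of of_int] cong: if_cong)
    with l(2) have "\<forall>y\<in>region n P g. y i = l y" by simp
    with l(1) no show False by blast
  qed
  from subgroup_character[OF H0 Hadd this] obtain W w where W: "W > 0" "\<And>r. r \<in> H \<Longrightarrow> W dvd dot (Suc n) r w"
    "\<not> W dvd dot (Suc n) e w" by blast
  have "dot (Suc n) e w = w i"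
    using i by (simp add: dot_def e_def sum.delta if_distrib[of "\<lambda>c. c * _"] cong: if_cong)
  with W(3) have wi: "\<not> W dvd w i" by simp
  have "dot (Suc n) (\<lambda>j. if j = n then 1 else 0) w = w n"
    by (simp add: dot_def sum.neutral)
  \<comment> \<open>The constant function 1 belongs to \<open>H\<close>, so the character is trivial
    on constant terms.\<close>
  with W(2)[OF H1] obtain w0 where w0: "w n = W * w0" by (auto elim: dvdE)
  obtain \<rho> where \<rho>: "\<rho> > 0"
    "\<And>y. y \<in> extensional {..<n} \<Longrightarrow> \<forall>i<n. \<bar>y i - g i\<bar> \<le> \<rho> \<Longrightarrow> y \<in> region n P g"
    using region_ball[OF g] by blast
  \<comment> \<open>With 1 / D < \<rho>, rounding \<open>D * g\<close> by at most 1 in each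
    coordinate stays within the ball around \<open>g\<close>.\<close>
  obtain D :: nat where D: "1 / \<rho> < real D" using reals_Archimedean2 by blast
  have D0: "real D > 0" using \<rho>(1) D by (meson divide_pos_pos less_trans zero_less_one)
  have D\<rho>: "1 \<le> real D * \<rho>" using D \<rho>(1) by (simp add: field_simps)
  \<comment> \<open>Each \<open>D * g j\<close> is rounded down to the class of
    \<open>w j / W\<close> modulo \<int>. Hence, for an integer affine function, \<open>D\<close>
    times its value at \<open>y\<close> is congruent modulo \<int> to the character applied to its
    coefficients.\<close>
  define a where "a j = \<lfloor>real D * g j - of_int (w j) / of_int W\<rfloor>" for j
  define y where "y = restrict (\<lambda>j. (of_int (w j) / of_int W + of_int (a j)) / real D) {..<n}"
  have yj: "real D * y j = of_int (w j) / of_int W + of_int (a j)" if "j < n" for j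
    using that D0 by (simp add: y_def)
  have "y \<in> region n P g"
  proof (rule \<rho>(2))
    show "y \<in> extensional {..<n}" by (simp add: y_def)
    show "\<forall>j<n. \<bar>y j - g j\<bar> \<le> \<rho>"
    proof (intro allI impI)
      fix j assume "j < n"
      have "\<bar>real D * y j - real D * g j\<bar> \<le> 1"
        unfolding yj[OF \<open>j < n\<close>] a_def by linarith
      also have "1 \<le> real D * \<rho>" by (rule D\<rho>)
      also have "real D * y j - real D * g j = real D * (y j - g j)" by (simp add: algebra_simps)
      finally show "\<bar>y j - g j\<bar> \<le> \<rho>" using D0 by (simp add: abs_mult)
    qed
  qed
  then have yc: "y \<in> cube n" by (simp add: region_def)
  \<comment> \<open>To be a grid point, \<open>y\<close> needs natural numerators over a common
    denominator, and \<open>W * D\<close> is one.\<close>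
  define E where "E = nat W * D"
  define v where "v j = nat (w j + W * a j)" for j
  have E0: "E > 0" using W(1) D0 by (simp add: E_def)
  have wv: "of_int (w j + W * a j) = real E * y j" if "j < n" for j
  proof -
    have "real E * y j = of_int W * (real D * y j)" using W(1) by (simp add: E_def)
    also have "\<dots> = of_int (w j + W * a j)" unfolding yj[OF that] using W(1) by (simp add: field_simps)
    finally show ?thesis by simp
  qed
  have v0: "w j + W * a j \<ge> 0" if "j < n" for j
  proof -
    have "real E * y j \<ge> 0" using yc that by (simp add: cube_iff)
    then show ?thesis unfolding wv[OF that, symmetric] of_int_0_le_iff .
  qed
  have vE: "real (v j) = real E * y j" if "j < n" for j
    using wv[OF that] v0[OF that] by (simp add: v_def)
  have "v j \<le> E" if "j < n" for j
  proof -
    have "real E * y j \<le> real E * 1" using yc that by (intro mult_left_mono) (auto simp: cube_iff)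
    then show ?thesis unfolding vE[OF that, symmetric] by simp
  qed
  moreover have y_grid: "grid_point n E v = y"
    by (rule extensionalityI[of _ "{..<n}"]) (use E0 vE in \<open>auto simp: grid_point_def y_def\<close>)
  moreover have "real D * f y \<in> \<int>" if f: "f \<in> G" for f
  proof -
    obtain p where p: "p \<in> int_affine n" "\<And>y. y \<in> region n P g \<Longrightarrow> f y = p y"
      using region_affine[OF g, of f] f by blast
    obtain b c where bc: "p = (\<lambda>x. of_int c + (\<Sum>i<n. of_int (b i) * x i))"
      using p(1) unfolding int_affine_def by blast
    define r where "r = b(n := c)"
    have rb: "(\<Sum>j<n. of_int (r j) * z j) = (\<Sum>j<n. of_int (b j) * z j)" for z :: "nat \<Rightarrow> real"
      by (rule sum.cong) (auto simp: r_def)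
    have "f y = of_int (r n) + (\<Sum>j<n. of_int (r j) * y j)" if "y \<in> region n P g" for y
      unfolding rb p(2)[OF that] by (simp add: bc r_def)
    then have "r \<in> H" unfolding H_def using int_combination_base[OF f] by blast
    then obtain t where t: "dot (Suc n) r w = W * t" using W(2) by (auto elim: dvdE)
    have "real D * f y = of_int c * real D + (\<Sum>j<n. of_int (r j) * (real D * y j))"
      unfolding p(2)[OF \<open>y \<in> region n P g\<close>] bc rb by (simp add: distrib_left sum_distrib_left mult_ac)
    also have "(\<Sum>j<n. of_int (r j) * (real D * y j)) = (\<Sum>j<n. of_int (r j) * (of_int (w j) / of_int W + of_int (a j)))"
      by (rule sum.cong) (simp_all add: yj)
    also have "\<dots> = (\<Sum>j<n. of_int (r j * w j)) / of_int W + (\<Sum>j<n. of_int (r j * a j))"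
      by (simp add: distrib_left sum.distrib sum_divide_distrib)
    also have "(\<Sum>j<n. of_int (r j * w j)) = of_int W * (of_int t - of_int (c * w0) :: real)"
    proof -
      have "(\<Sum>j<n. r j * w j) + c * w n = W * t" using t by (simp add: dot_def r_def)
      then have "(\<Sum>j<n. r j * w j) = W * (t - c * w0)" by (simp add: w0 algebra_simps)
      then have "of_int (\<Sum>j<n. r j * w j) = (of_int (W * (t - c * w0)) :: real)" by (rule arg_cong)
      then show ?thesis by simp
    qed
    finally have "real D * f y = of_int (c * int D + (t - c * w0) + (\<Sum>j<n. r j * a j))" using W(1) by simp
    then show ?thesis by (metis Ints_of_int)
  qed
  ultimately have "real D * y i \<in> \<int>" using denominators[OF E0, of v D i] i by simp
  \<comment> \<open>Modulo \<int>, \<open>D * y i\<close> is \<open>w i / W\<close>, the value of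
    the character at the coordinate, which is not an integer.\<close>
  then have "of_int (w i) / of_int W \<in> (\<int> :: real set)"
    using Ints_diff[of "real D * y i" "of_int (a i)"] yj[OF i] by simp
  then obtain k where "real_of_int (w i) / of_int W = of_int k" by (auto elim: Ints_cases)
  then have "real_of_int (w i) = of_int (W * k)" using W(1) by (simp add: field_simps)
  then have "w i = W * k" using of_int_eq_iff by blast
  with wi show False by simp
qed

lemma int_combination_region_affine:
  assumes g: "generic n P g" and t: "int_combination G t"
  shows "\<exists>p. affine_fun n p \<and> (\<forall>y\<in>region n P g. t y = p y)"
  using t
proof induction
  case (const c)
  show ?case by (rule exI[of _ "\<lambda>_. of_int c"]) (auto simp: affine_fun_def intro!: exI[of _ "\<lambda>_. 0"])
next
  case (add t f)
  then obtain p where p: "affine_fun n p" "\<forall>y\<in>region n P g. t y = p y" by blast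
  obtain q where q: "q \<in> int_affine n" "\<And>y. y \<in> region n P g \<Longrightarrow> f y = q y"
    using region_affine[OF g, of f] add.hyps(2) by blast
  show ?case using affine_fun_lincomb[OF p(1) int_affine_affine_fun[OF q(1)], of 1 1] p(2) q(2)
    by (intro exI[of _ "\<lambda>x. p x + q x"]) simp
next
  case (diff t f)
  then obtain p where p: "affine_fun n p" "\<forall>y\<in>region n P g. t y = p y" by blast
  obtain q where q: "q \<in> int_affine n" "\<And>y. y \<in> region n P g \<Longrightarrow> f y = q y"
    using region_affine[OF g, of f] diff.hyps(2) by blast
  show ?case using affine_fun_lincomb[OF p(1) int_affine_affine_fun[OF q(1)], of 1 "- 1"] p(2) q(2)
    by (intro exI[of _ "\<lambda>x. p x - q x"]) simp
qed

text \<open>On one region all functions involved are affine, so \<open>error_bound\<close> applies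
  to their affine pieces. That bound speaks of arbitrary points satisfying the inequalities of the
  region; \<open>r\<close> normalises them outside the first \<open>n\<close> coordinates.\<close>

lemma region_error_bound:
  assumes d: "generic n P d" and I: "finite I" "\<And>i. i \<in> I \<Longrightarrow> int_combination G (s i)"
    and h: "int_combination G h"
    and zero: "\<And>y. y \<in> cube n \<Longrightarrow> \<forall>i\<in>I. s i y \<le> 0 \<Longrightarrow> h y \<le> \<phi> y"
  shows "\<exists>N::nat. \<forall>y\<in>region n P d. h y - \<phi> y \<le> real N * (\<Sum>i\<in>I. clip (s i y))"
proof -
  let ?R = "region n P d"
  have aff: "affine_fun n p" if "p \<in> P" for p using P(2) that int_affine_affine_fun by blast
  have "\<forall>i\<in>I. \<exists>p. affine_fun n p \<and> (\<forall>y\<in>?R. s i y = p y)"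
    using int_combination_region_affine[OF d I(2)] by blast
  from bchoice[OF this] obtain s' where s': "\<And>i. i \<in> I \<Longrightarrow> affine_fun n (s' i)"
    "\<And>i y. i \<in> I \<Longrightarrow> y \<in> ?R \<Longrightarrow> s i y = s' i y" by blast
  obtain p where p: "affine_fun n p" "\<And>y. y \<in> ?R \<Longrightarrow> h y = p y"
    using int_combination_region_affine[OF d h] by blast
  obtain q where q: "q \<in> int_affine n" "\<And>y. y \<in> ?R \<Longrightarrow> \<phi> y = q y"
    using region_affine[OF d, of \<phi>] by blast
  define h' where "h' x = p x - q x" for x
  have h': "affine_fun n h'" "\<And>y. y \<in> ?R \<Longrightarrow> h y - \<phi> y = h' y"
    using affine_fun_lincomb[OF p(1) int_affine_affine_fun[OF q(1)], of 1 "- 1"] p(2) q(2)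
    by (auto simp: h'_def[abs_def])
  define Ds where "Ds = (\<lambda>(p, q) x. q x - p x) ` {(p, q) \<in> P \<times> P. p d < q d}"
  define r where "r x = restrict x {..<n}" for x :: "nat \<Rightarrow> real"
  have r: "f (r x) = f x" if "affine_fun n f" for f x
    by (rule affine_fun_cong[OF that]) (simp add: r_def)
  have Ds: "r x \<in> ?R" if x: "\<forall>c\<in>Ds. c x \<ge> 0" for x
  proof -
    have le: "p x \<le> q x" if "p \<in> P" "q \<in> P" "p d < q d" for p q
      using bspec[OF x, of "\<lambda>x. q x - p x"] that unfolding Ds_def by force
    have "0 \<le> x i \<and> x i \<le> 1" if "i < n" for i
      by (rule order_imp_bounds[OF d le that])
    then have "r x \<in> cube n" by (simp add: r_def cube_iff)
    then show ?thesis unfolding region_def using le by (simp add: r[OF aff])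
  qed
  have "\<exists>B. \<forall>x\<in>cube n. h' x \<le> B \<and> (\<forall>i\<in>I. s' i x \<le> B)"
  proof -
    obtain B where B: "\<And>x. x \<in> cube n \<Longrightarrow> \<bar>h' x\<bar> \<le> B" using affine_fun_bounded[OF h'(1)] by blast
    have "\<forall>i\<in>I. \<exists>B. \<forall>x\<in>cube n. \<bar>s' i x\<bar> \<le> B" using affine_fun_bounded s'(1) by blast
    from bchoice[OF this] obtain C where C: "\<And>i x. i \<in> I \<Longrightarrow> x \<in> cube n \<Longrightarrow> \<bar>s' i x\<bar> \<le> C i" by blast
    have "s' i x \<le> \<bar>B\<bar> + (\<Sum>i\<in>I. \<bar>C i\<bar>)" if "i \<in> I" "x \<in> cube n" for i x
    proof -
      have "\<bar>C i\<bar> \<le> (\<Sum>i\<in>I. \<bar>C i\<bar>)" using that(1) I(1) by (intro member_le_sum) auto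
      with C[OF that] show ?thesis by linarith
    qed
    moreover have "h' x \<le> \<bar>B\<bar> + (\<Sum>i\<in>I. \<bar>C i\<bar>)" if "x \<in> cube n" for x
    proof -
      have "0 \<le> (\<Sum>i\<in>I. \<bar>C i\<bar>)" by (simp add: sum_nonneg)
      with B[OF that] show ?thesis by linarith
    qed
    ultimately show ?thesis by blast
  qed
  then obtain B where B: "\<And>x. x \<in> cube n \<Longrightarrow> h' x \<le> B" "\<And>x i. x \<in> cube n \<Longrightarrow> i \<in> I \<Longrightarrow> s' i x \<le> B" by blast
  have RC: "?R \<subseteq> cube n" by (auto simp: region_def)
  have "\<exists>N::nat. \<forall>x. (\<forall>c\<in>Ds. c x \<ge> 0) \<longrightarrow> h' x \<le> real N * (\<Sum>i\<in>I. clip (s' i x))"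
  proof (rule error_bound[where Ds = Ds and I = I and s = s' and h = h' and n = n and B = B])
    have "finite {(p, q) \<in> P \<times> P. p d < q d}" by (rule finite_subset[of _ "P \<times> P"]) (use P(1) in auto)
    then show "finite Ds" unfolding Ds_def by (rule finite_imageI)
    show "affine_fun n c" if "c \<in> Ds" for c
      using that affine_fun_lincomb[OF aff aff, of _ _ 1 "- 1"] unfolding Ds_def by auto
    show "h' x \<le> 0" if x: "\<forall>c\<in>Ds. c x \<ge> 0" "\<forall>i\<in>I. s' i x \<le> 0" for x
    proof -
      have "h (r x) \<le> \<phi> (r x)"
      proof (rule zero)
        show "r x \<in> cube n" using Ds[OF x(1)] RC by blast
        show "\<forall>i\<in>I. s i (r x) \<le> 0" using x(2) by (simp add: s'(2)[OF _ Ds[OF x(1)]] r[OF s'(1)])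
      qed
      then show ?thesis using h'(2)[OF Ds[OF x(1)]] by (simp add: r[OF h'(1)])
    qed
    show "h' x \<le> B" if x: "\<forall>c\<in>Ds. c x \<ge> 0" for x
      using B(1)[of "r x"] Ds[OF x] RC by (auto simp: r[OF h'(1)])
    show "s' i x \<le> B" if x: "\<forall>c\<in>Ds. c x \<ge> 0" "i \<in> I" for x i
      using B(2)[of "r x" i] Ds[OF x(1)] RC x(2) by (auto simp: r[OF s'(1)])
  qed (use I(1) s'(1) h'(1) in auto)
  then obtain N :: nat where N: "\<And>x. \<forall>c\<in>Ds. c x \<ge> 0 \<Longrightarrow> h' x \<le> real N * (\<Sum>i\<in>I. clip (s' i x))" by blast
  have "h y - \<phi> y \<le> real N * (\<Sum>i\<in>I. clip (s i y))" if y: "y \<in> ?R" for y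
  proof -
    have "\<forall>c\<in>Ds. c y \<ge> 0" using y unfolding Ds_def region_def by auto
    from N[OF this] show ?thesis using h'(2)[OF y] s'(2)[OF _ y] by simp
  qed
  then show ?thesis by blast
qed

text \<open>The inverse \<open>L\<close> of the generator map on the region consists of integer
  combinations and so makes sense on the whole cube. It need not invert anything elsewhere, but
  injectivity of the generators makes the region the exact solution set of the system
  \<open>S\<close>.\<close>

lemma local_minorant:
  assumes g: "generic n P g"
  shows "\<exists>m\<in>alg n G. (\<forall>y\<in>cube n. m y \<le> \<phi> y) \<and> (\<forall>y\<in>region n P g. m y = \<phi> y)"
proof -
  let ?C = "region n P g"
  have "\<forall>i\<in>{..<n}. \<exists>l. int_combination G l \<and> (\<forall>y\<in>?C. y i = l y)"
    using coordinate_int_combination[OF g] by blast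
  from bchoice[OF this] obtain l where l: "\<And>i. i < n \<Longrightarrow> int_combination G (l i)"
    "\<And>i y. i < n \<Longrightarrow> y \<in> ?C \<Longrightarrow> l i y = y i" by fastforce
  define L where "L y = restrict (\<lambda>i. l i y) {..<n}" for y
  have "\<forall>f\<in>insert \<phi> G. \<exists>p. p \<in> int_affine n \<and> (\<forall>y\<in>?C. f y = p y)"
    by (intro ballI region_affine[OF g])
  from bchoice[OF this] obtain \<pi> where \<pi>: "\<And>f. f \<in> insert \<phi> G \<Longrightarrow> \<pi> f \<in> int_affine n"
    "\<And>f y. f \<in> insert \<phi> G \<Longrightarrow> y \<in> ?C \<Longrightarrow> f y = \<pi> f y" by blast
  have comb: "int_combination G (\<lambda>y. p (L y))" if "p \<in> int_affine n" for p
    unfolding L_def by (rule int_affine_int_combination[OF that l(1)])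
  have L: "L y = y" if "y \<in> ?C" for y
    by (rule extensionalityI[of _ "{..<n}"]) (use that l(2)[OF _ that] in \<open>auto simp: L_def region_def cube_iff\<close>)
  \<comment> \<open>The first family says that \<open>L y\<close> satisfies the inequalities of the
    region, the other two that each generator has the same value at \<open>y\<close> as its affine
    piece has at \<open>L y\<close>.\<close>
  define S where "S = (\<lambda>(p, q) y. p (L y) - q (L y)) ` {(p, q) \<in> P \<times> P. p g < q g} \<union>
    (\<lambda>f y. f y - \<pi> f (L y)) ` G \<union> (\<lambda>f y. \<pi> f (L y) - f y) ` G"
  have "finite {(p, q) \<in> P \<times> P. p g < q g}" by (rule finite_subset[of _ "P \<times> P"]) (use P(1) in auto)
  then have finS: "finite S" unfolding S_def using finite_G by (intro finite_UnI finite_imageI)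
  have combS: "int_combination G s" if "s \<in> S" for s
  proof -
    consider p q where "s = (\<lambda>y. p (L y) - q (L y))" "p \<in> P" "q \<in> P"
      | f where "f \<in> G" "s = (\<lambda>y. f y - \<pi> f (L y)) \<or> s = (\<lambda>y. \<pi> f (L y) - f y)"
      using \<open>s \<in> S\<close> unfolding S_def by (elim UnE imageE) auto
    then show ?thesis
    proof cases
      case 1
      show ?thesis unfolding 1(1) by (intro int_combination_diff comb subsetD[OF P(2)] 1(2,3))
    next
      case 2
      have "int_combination G f" "int_combination G (\<lambda>y. \<pi> f (L y))"
        using 2(1) by (auto intro: int_combination_base comb \<pi>(1))
      then show ?thesis using 2(2) by (auto intro: int_combination_diff)
    qed
  qed
  have S_C: "s y \<le> 0" if "s \<in> S" "y \<in> ?C" for s y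
    using that L[OF that(2)] \<pi>(2) unfolding S_def by (auto simp: region_def)
  have C_S: "y \<in> ?C" if y: "y \<in> cube n" "\<forall>s\<in>S. s y \<le> 0" for y
  proof -
    have le: "p (L y) \<le> q (L y)" if "p \<in> P" "q \<in> P" "p g < q g" for p q
      using bspec[OF y(2), of "\<lambda>y. p (L y) - q (L y)"] that unfolding S_def by force
    have "0 \<le> L y i \<and> L y i \<le> 1" if "i < n" for i
      by (rule order_imp_bounds[OF g le that])
    then have Lc: "L y \<in> cube n" by (simp add: cube_iff L_def)
    then have LC: "L y \<in> ?C" unfolding region_def using le by simp
    have "f y = f (L y)" if "f \<in> G" for f
    proof -
      have "f y - \<pi> f (L y) \<le> 0" "\<pi> f (L y) - f y \<le> 0"
        using y(2) that unfolding S_def by (auto simp: ball_Un)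
      then show ?thesis using \<pi>(2)[OF _ LC] that by simp
    qed
    with injective[OF y(1) Lc] LC show ?thesis by simp
  qed
  let ?h = "\<lambda>y. \<pi> \<phi> (L y)"
  have h: "int_combination G ?h" by (rule comb[OF \<pi>(1)]) simp
  have hC: "?h y = \<phi> y" if "y \<in> ?C" for y using \<pi>(2)[of \<phi> y] that L[OF that] by simp
  let ?\<R> = "{region n P d | d. generic n P d}"
  have "\<forall>R\<in>?\<R>. \<exists>N::nat. \<forall>y\<in>R. ?h y - \<phi> y \<le> real N * (\<Sum>s\<in>S. clip (s y))"
  proof
    fix R assume "R \<in> ?\<R>"
    then obtain d where d: "generic n P d" "R = region n P d" by blast
    show "\<exists>N::nat. \<forall>y\<in>R. ?h y - \<phi> y \<le> real N * (\<Sum>s\<in>S. clip (s y))"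
      unfolding d(2)
    proof (rule region_error_bound[OF d(1) finS combS h])
      show "?h y \<le> \<phi> y" if "y \<in> cube n" "\<forall>s\<in>S. s y \<le> 0" for y
        using hC[OF C_S[OF that]] by simp
    qed
  qed
  from bchoice[OF this] obtain N :: "(nat \<Rightarrow> real) set \<Rightarrow> nat" where
    N: "\<And>R y. R \<in> ?\<R> \<Longrightarrow> y \<in> R \<Longrightarrow> ?h y - \<phi> y \<le> real (N R) * (\<Sum>s\<in>S. clip (s y))" by blast
  \<comment> \<open>There are finitely many regions; the sum of their constants bounds each of them
    and gives one multiplier for the whole cube.\<close>
  define K where "K = (\<Sum>R\<in>?\<R>. N R)"
  have u0: "0 \<le> (\<Sum>s\<in>S. clip (s y))" for y by (intro sum_nonneg clip_nonneg)
  have K: "?h y - \<phi> y \<le> real K * (\<Sum>s\<in>S. clip (s y))" if y: "y \<in> cube n" for y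
  proof -
    obtain d where d: "generic n P d" "y \<in> region n P d" using region_cover[OF P(1,2) y] by blast
    then have R: "region n P d \<in> ?\<R>" by blast
    have "N (region n P d) \<le> K" unfolding K_def
      by (rule member_le_sum[OF R _ finite_regions[OF P(1)]]) simp
    then have "real (N (region n P d)) * (\<Sum>s\<in>S. clip (s y)) \<le> real K * (\<Sum>s\<in>S. clip (s y))"
      by (intro mult_right_mono u0) simp
    with N[OF R d(2)] show ?thesis by linarith
  qed
  \<comment> \<open>The truncated penalty terms are elements of the algebra, so \<open>t\<close> is
    an integer combination of its elements. The summand \<open>of_int 0\<close> matches the form of
    \<open>clip_int_combination\<close>.\<close>
  define t where "t y = ?h y - of_nat K * (\<Sum>s\<in>S. (\<lambda>y\<in>cube n. clip (s y + of_int 0)) y)" for y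
  have Galg: "G \<subseteq> alg n G" by (auto intro: mv_generate.incl)
  have combt: "int_combination (alg n G) t"
    unfolding t_def
  proof (intro int_combination_diff int_combination_mult_nat int_combination_sum)
    show "int_combination (alg n G) ?h" by (rule int_combination_mono[OF h Galg])
    fix s assume "s \<in> S"
    then show "int_combination (alg n G) (\<lambda>x. (\<lambda>y\<in>cube n. clip (s y + of_int 0)) x)"
      by (intro int_combination_base clip_int_combination[OF _ G] int_combination_mono[OF combS Galg])
  qed
  have "(\<lambda>y\<in>cube n. clip (t y + of_int 0)) \<in> alg n G" by (rule clip_int_combination[OF combt G])
  moreover have "clip (t y) \<le> \<phi> y" if y: "y \<in> cube n" for y
  proof -
    have "t y \<le> \<phi> y" using K[OF y] y by (simp add: t_def)
    moreover have "0 \<le> \<phi> y" using mcnaughton_bounds[OF \<phi> y] by simp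
    ultimately show ?thesis by (simp add: clip_def)
  qed
  moreover have "clip (t y) = \<phi> y" if y: "y \<in> ?C" for y
  proof -
    have "clip (s y) = 0" if "s \<in> S" for s using S_C[OF that y] by (simp add: clip_def)
    moreover have yc: "y \<in> cube n" using y by (simp add: region_def)
    ultimately have "t y = \<phi> y" by (simp add: t_def hC[OF y])
    then show ?thesis using mcnaughton_bounds[OF \<phi> yc] by (simp add: clip_id)
  qed
  ultimately show ?thesis by (intro bexI[of _ "\<lambda>y\<in>cube n. clip (t y + of_int 0)"]) (auto simp: region_def)
qed

lemma in_generated: "\<phi> \<in> alg n G"
proof -
  let ?\<R> = "{region n P d | d. generic n P d}"
  have "\<forall>R\<in>?\<R>. \<exists>m. m \<in> alg n G \<and> (\<forall>y\<in>cube n. m y \<le> \<phi> y) \<and> (\<forall>y\<in>R. m y = \<phi> y)"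
  proof
    fix R assume "R \<in> ?\<R>"
    then obtain d where d: "generic n P d" "R = region n P d" by (elim CollectE exE conjE)
    from local_minorant[OF d(1)] show "\<exists>m. m \<in> alg n G \<and> (\<forall>y\<in>cube n. m y \<le> \<phi> y) \<and> (\<forall>y\<in>R. m y = \<phi> y)"
      unfolding d(2) by (elim bexE) (rule exI, rule conjI)
  qed
  from bchoice[OF this] obtain m where *: "\<forall>R\<in>?\<R>. m R \<in> alg n G \<and> (\<forall>y\<in>cube n. m R y \<le> \<phi> y) \<and> (\<forall>y\<in>R. m R y = \<phi> y)" ..
  have m: "\<And>R. R \<in> ?\<R> \<Longrightarrow> m R \<in> alg n G"
    "\<And>R y. R \<in> ?\<R> \<Longrightarrow> y \<in> cube n \<Longrightarrow> m R y \<le> \<phi> y" "\<And>R y. R \<in> ?\<R> \<Longrightarrow> y \<in> R \<Longrightarrow> m R y = \<phi> y"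
    by (use * in fast)+
  have "?\<R> \<noteq> {}" using generic_exists[OF P(1,2)] by blast
  from alg_Max[OF finite_regions[OF P(1)] this m(1) G] obtain M where
    "\<forall>y\<in>cube n. (\<forall>R\<in>?\<R>. m R y \<le> M y) \<and> (\<exists>R\<in>?\<R>. M y = m R y)" and M1: "M \<in> alg n G" ..
  then have M: "\<And>y R. y \<in> cube n \<Longrightarrow> R \<in> ?\<R> \<Longrightarrow> m R y \<le> M y" "\<And>y. y \<in> cube n \<Longrightarrow> \<exists>R\<in>?\<R>. M y = m R y"
    by fast+
  have "\<phi> y = M y" if y: "y \<in> cube n" for y
  proof (rule antisym)
    obtain d where d: "generic n P d" "y \<in> region n P d" using region_cover[OF P(1,2) y] by blast
    have R: "region n P d \<in> ?\<R>" using d(1) by blast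
    show "\<phi> y \<le> M y" using M(1)[OF y R] m(3)[OF R d(2)] by simp
    obtain R' where R': "R' \<in> ?\<R>" "M y = m R' y" using M(2)[OF y] ..
    show "M y \<le> \<phi> y" unfolding R'(2) by (rule m(2)[OF R'(1) y])
  qed
  then show ?thesis
    using M1 \<phi> alg_mcnaughton[OF G] by (auto intro!: alg_cong[OF M1] mcnaughton_extensional)
qed

end

theorem generated_eq_mcnaughton:
  assumes "finite G" and G: "G \<subseteq> mcnaughton_functions n"
    and "\<And>x y. x \<in> cube n \<Longrightarrow> y \<in> cube n \<Longrightarrow> \<forall>f\<in>G. f x = f y \<Longrightarrow> x = y"
    and "\<And>E D v i. E > 0 \<Longrightarrow> (\<And>i. i < n \<Longrightarrow> v i \<le> E) \<Longrightarrow>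
        \<forall>f\<in>G. real D * f (grid_point n E v) \<in> \<int> \<Longrightarrow> i < n \<Longrightarrow> real D * grid_point n E v i \<in> \<int>"
  shows "alg n G = mcnaughton_functions n"
proof (rule equalityI[OF alg_mcnaughton[OF G] subsetI])
  fix \<phi> assume \<phi>: "\<phi> \<in> mcnaughton_functions n"
  have "\<forall>f\<in>insert \<phi> G. \<exists>P. finite P \<and> P \<subseteq> int_affine n \<and> (\<forall>x\<in>cube n. \<exists>p\<in>P. f x = p x)"
    using \<phi> G unfolding mcnaughton_functions_def by blast
  from bchoice[OF this] obtain Q where Q: "\<And>f. f \<in> insert \<phi> G \<Longrightarrow> finite (Q f)"
    "\<And>f. f \<in> insert \<phi> G \<Longrightarrow> Q f \<subseteq> int_affine n"
    "\<And>f x. f \<in> insert \<phi> G \<Longrightarrow> x \<in> cube n \<Longrightarrow> \<exists>p\<in>Q f. f x = p x" by blast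
  define P where "P = {\<lambda>_. 0, \<lambda>_. 1} \<union> (\<lambda>i x. x i) ` {..<n} \<union> (\<Union>f\<in>insert \<phi> G. Q f)"
  interpret subdivision n G P \<phi>
  proof
    show "finite P" unfolding P_def using Q(1) assms(1) by simp
    have "(\<Union>f\<in>insert \<phi> G. Q f) \<subseteq> int_affine n" by (intro UN_least Q(2))
    moreover have "(\<lambda>i x. x i) ` {..<n} \<subseteq> int_affine n" by (auto intro: int_affine_coordinate)
    moreover have "{\<lambda>_. 0, \<lambda>_. 1} \<subseteq> int_affine n"
      using int_affine_const[of 0 n] int_affine_const[of 1 n] by simp
    ultimately show "P \<subseteq> int_affine n" unfolding P_def by (intro Un_least)
    show "\<exists>p\<in>P. f x = p x" if "f \<in> insert \<phi> G" "x \<in> cube n" for f x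
      using Q(3)[OF that] that(1) unfolding P_def by blast
    show "(\<lambda>x. x i) \<in> P" if "i < n" for i using that by (simp add: P_def)
    show "(\<lambda>_. 0) \<in> P" "(\<lambda>_. 1) \<in> P" by (simp_all add: P_def)
  qed (fact assms(1) G \<phi> assms(3) assms(4))+
  show "\<phi> \<in> alg n G" by (rule in_generated)
qed

section \<open>Isomorphism and denominators\<close>

primrec term_real :: "(nat \<Rightarrow> real) \<Rightarrow> mv_term \<Rightarrow> real" where
  "term_real \<rho> (TVar i) = \<rho> i"
| "term_real \<rho> TZero = 0"
| "term_real \<rho> (TNeg t) = 1 - term_real \<rho> t"
| "term_real \<rho> (TPlus s t) = min 1 (term_real \<rho> s + term_real \<rho> t)"

lemma term_function_eq:
  "x \<in> cube n \<Longrightarrow> term_function n t x = term_real x t"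
  by (induction t) (simp_all add: term_function_def mcnaughton_def)

lemma term_real_cong: "(\<And>i. i \<in> term_vars t \<Longrightarrow> \<rho> i = \<rho>' i) \<Longrightarrow> term_real \<rho> t = term_real \<rho>' t"
  by (induction t) simp_all

lemma term_real_Ints:
  assumes "\<And>i. i \<in> term_vars t \<Longrightarrow> of_nat D * \<rho> i \<in> \<int>"
  shows "of_nat D * term_real \<rho> t \<in> \<int>"
  using assms
proof (induction t)
  case (TNeg t)
  then have "of_nat D - of_nat D * term_real \<rho> t \<in> \<int>" by (intro Ints_diff Ints_of_nat) simp
  then show ?case by (simp add: right_diff_distrib)
next
  case (TPlus s t)
  then have "of_nat D * term_real \<rho> s + of_nat D * term_real \<rho> t \<in> \<int>" by (intro Ints_add) simp_all
  then show ?case by (simp add: min_def distrib_left)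
qed simp_all

lemma generated_by_terms:
  assumes "f \<in> alg n (set fs)"
  shows "\<exists>\<sigma>. term_vars \<sigma> \<subseteq> {..<length fs} \<and> (\<forall>x\<in>cube n. f x = term_real (\<lambda>j. (fs ! j) x) \<sigma>)"
  using assms
proof induction
  case zero
  show ?case by (intro exI[of _ TZero]) (simp add: mcnaughton_def)
next
  case (incl g)
  then obtain j where "j < length fs" "g = fs ! j" by (auto simp: in_set_conv_nth)
  then show ?case by (intro exI[of _ "TVar j"]) simp
next
  case (neg f)
  then obtain \<sigma> where "term_vars \<sigma> \<subseteq> {..<length fs}" "\<forall>x\<in>cube n. f x = term_real (\<lambda>j. (fs ! j) x) \<sigma>" by blast
  then show ?case by (intro exI[of _ "TNeg \<sigma>"]) (simp add: mcnaughton_def)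
next
  case (plus f g)
  then obtain \<sigma> \<tau> where "term_vars \<sigma> \<subseteq> {..<length fs}" "\<forall>x\<in>cube n. f x = term_real (\<lambda>j. (fs ! j) x) \<sigma>"
    "term_vars \<tau> \<subseteq> {..<length fs}" "\<forall>x\<in>cube n. g x = term_real (\<lambda>j. (fs ! j) x) \<tau>" by blast
  then show ?case by (intro exI[of _ "TPlus \<sigma> \<tau>"]) (simp add: mcnaughton_def)
qed

lemma generated_Ints:
  assumes "f \<in> alg n G" "x \<in> cube n" "\<And>g. g \<in> G \<Longrightarrow> of_nat D * g x \<in> \<int>"
  shows "of_nat D * f x \<in> \<int>"
  using assms(1)
proof induction
  case zero
  then show ?case using assms(2) by (simp add: mcnaughton_def)
next
  case (incl g)
  then show ?case by (rule assms(3))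
next
  case (neg f)
  then have "of_nat D - of_nat D * f x \<in> \<int>" by (intro Ints_diff Ints_of_nat)
  then show ?case using assms(2) by (simp add: mcnaughton_def right_diff_distrib)
next
  case (plus f g)
  then have "of_nat D * f x + of_nat D * g x \<in> \<int>" by (intro Ints_add)
  then show ?case using assms(2) by (simp add: mcnaughton_def min_def distrib_left)
qed

text \<open>Turns separation by the generated algebra into separation by the generators.\<close>

lemma generated_separates:
  assumes "f \<in> alg n G" "x \<in> cube n" "y \<in> cube n" "\<forall>g\<in>G. g x = g y"
  shows "f x = f y"
  using assms(1) by induction (use assms in \<open>auto simp: mcnaughton_def\<close>)

definition coordinates :: "nat \<Rightarrow> ((nat \<Rightarrow> real) \<Rightarrow> real) set" where
  "coordinates n = (\<lambda>i. \<lambda>x\<in>cube n. x i) ` {..<n}"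

text \<open>The coordinates map the cube identically, so injectivity and preservation of
  denominators are immediate. The result allows inductions over all McNaughton functions that start
  from the coordinates.\<close>

theorem mcnaughton_theorem: "alg n (coordinates n) = mcnaughton_functions n"
proof (rule generated_eq_mcnaughton)
  show "coordinates n \<subseteq> mcnaughton_functions n"
    by (auto simp: coordinates_def intro: mcnaughton_coordinate)
  show "x = y" if "x \<in> cube n" "y \<in> cube n" "\<forall>f\<in>coordinates n. f x = f y" for x y
    using that by (intro cube_eqI) (auto simp: coordinates_def)
  show "real D * grid_point n E v i \<in> \<int>" if "\<And>i. i < n \<Longrightarrow> v i \<le> E"
    "\<forall>f\<in>coordinates n. real D * f (grid_point n E v) \<in> \<int>" "i < n" for E D v i
    using that(2,3) grid_point_cube[OF that(1)] by (auto simp: coordinates_def)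
qed (simp add: coordinates_def)

section \<open>Points of bounded denominator under an isomorphism\<close>

lemma finite_bounded_denominator:
  assumes "D > 0" shows "finite {y \<in> cube n. \<forall>i<n. real D * y i \<in> \<int>}"
proof (rule finite_subset)
  show "finite (\<Pi>\<^sub>E i\<in>{..<n}. (\<lambda>k. real k / real D) ` {..D})" by (intro finite_PiE) auto
  show "{y \<in> cube n. \<forall>i<n. real D * y i \<in> \<int>} \<subseteq> (\<Pi>\<^sub>E i\<in>{..<n}. (\<lambda>k. real k / real D) ` {..D})"
  proof
    fix y assume y: "y \<in> {y \<in> cube n. \<forall>i<n. real D * y i \<in> \<int>}"
    have "y i \<in> (\<lambda>k. real k / real D) ` {..D}" if "i < n" for i
    proof -
      have 01: "0 \<le> y i" "y i \<le> 1" and "real D * y i \<in> \<int>" using y that by (auto simp: cube_iff)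
      then obtain k where k: "real D * y i = of_int k" by (auto elim: Ints_cases)
      have "0 \<le> real D * y i" "real D * y i \<le> real D" using 01 by (auto intro: mult_left_le)
      then have "0 \<le> k" "k \<le> int D" unfolding k by linarith+
      then have "y i = real (nat k) / real D" "nat k \<le> D" using k assms by (auto simp: field_simps)
      then show ?thesis by blast
    qed
    with y show "y \<in> (\<Pi>\<^sub>E i\<in>{..<n}. (\<lambda>k. real k / real D) ` {..D})"
      by (auto simp: cube_iff PiE_iff)
  qed
qed

text \<open>Evaluation at \<open>x\<close>, transported along the isomorphism, is evaluation at
  another point \<open>Y x\<close>. This maps the set \<open>X\<close> of points where the algebra
  takes values with denominator dividing \<open>D\<close> injectively into the finite set
  \<open>\<Gamma>\<close> of points whose coordinates have this property. Since \<Gamma> \<subseteq>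
  X, the two sets coincide.\<close>

lemma isomorphic_denominators:
  assumes G: "G \<subseteq> mcnaughton_functions n" and iso: "mv_isomorphic (mv_generated (mcnaughton n) G) (mcnaughton n)"
    and sep: "\<And>x y. x \<in> cube n \<Longrightarrow> y \<in> cube n \<Longrightarrow> \<forall>f\<in>G. f x = f y \<Longrightarrow> x = y"
    and D: "D > 0" and x: "x \<in> cube n" "\<forall>f\<in>G. real D * f x \<in> \<int>" and i: "i < n"
  shows "real D * x i \<in> \<int>"
proof -
  let ?M = "mcnaughton n"
  obtain h where bij: "bij_betw h (alg n G) (mcnaughton_functions n)"
    and h0: "h (mv_zero ?M) = mv_zero ?M"
    and hneg: "\<And>a. a \<in> alg n G \<Longrightarrow> h (mv_neg ?M a) = mv_neg ?M (h a)"
    and hplus: "\<And>a b. a \<in> alg n G \<Longrightarrow> b \<in> alg n G \<Longrightarrow> h (mv_plus ?M a b) = mv_plus ?M (h a) (h b)"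
    using iso by (auto simp: mv_isomorphic_def mv_iso_def mv_generated_def mcnaughton_def)
  define X where "X = {x \<in> cube n. \<forall>f\<in>alg n G. real D * f x \<in> \<int>}"
  define \<Gamma> where "\<Gamma> = {y \<in> cube n. \<forall>i<n. real D * y i \<in> \<int>}"
  have "\<forall>i\<in>{..<n}. \<exists>c. c \<in> alg n G \<and> h c = (\<lambda>x\<in>cube n. x i)"
  proof
    fix i assume "i \<in> {..<n}"
    then have "(\<lambda>x\<in>cube n. x i) \<in> h ` alg n G"
      using bij mcnaughton_coordinate by (simp add: bij_betw_def)
    then show "\<exists>c. c \<in> alg n G \<and> h c = (\<lambda>x\<in>cube n. x i)" by (elim imageE) auto
  qed
  from bchoice[OF this] obtain c where c: "\<And>i. i < n \<Longrightarrow> c i \<in> alg n G"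
    "\<And>i. i < n \<Longrightarrow> h (c i) = (\<lambda>x\<in>cube n. x i)" by blast
  \<comment> \<open>The coordinates of \<open>Y x\<close> are forced: they are the values at
    \<open>x\<close> of the preimages \<open>c i\<close> of the coordinate functions.\<close>
  define Y where "Y x = restrict (\<lambda>i. c i x) {..<n}" for x
  have Y_cube: "Y x \<in> cube n" if "x \<in> cube n" for x
    using mcnaughton_bounds[OF subsetD[OF alg_mcnaughton[OF G] c(1)] that] by (auto simp: cube_iff Y_def)
  have eval: "a x = h a (Y x)" if a: "a \<in> alg n G" and x: "x \<in> cube n" for a x
  proof -
    \<comment> \<open>The induction runs over the target algebra, which McNaughton's theorem
      generates by coordinates, and produces a preimage with the right value at \<open>x\<close>;
      injectivity of \<open>h\<close> identifies it with \<open>a\<close>.\<close>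
    have "\<exists>b\<in>alg n G. h b = f \<and> b x = f (Y x)" if "f \<in> alg n (coordinates n)" for f
      using that
    proof induction
      case zero
      have "mv_zero ?M x = mv_zero ?M (Y x)" using x Y_cube[OF x] by (simp add: mcnaughton_def)
      with h0 show ?case by (intro bexI[OF _ mv_generate.zero]) simp
    next
      case (incl f)
      then obtain i where i: "i < n" "f = (\<lambda>x\<in>cube n. x i)" by (auto simp: coordinates_def)
      then have "c i x = f (Y x)" using Y_cube[OF x] by (simp add: Y_def)
      with i c show ?case by (intro bexI[of _ "c i"]) simp_all
    next
      case (neg f)
      then obtain b where b: "b \<in> alg n G" "h b = f" "b x = f (Y x)" by blast
      then have "mv_neg ?M b x = mv_neg ?M f (Y x)" using x Y_cube[OF x] by (simp add: mcnaughton_def)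
      with b(1,2) hneg show ?case by (intro bexI[OF _ mv_generate.neg]) simp_all
    next
      case (plus f g)
      then obtain b b' where b: "b \<in> alg n G" "h b = f" "b x = f (Y x)"
        and b': "b' \<in> alg n G" "h b' = g" "b' x = g (Y x)" by blast
      then have "mv_plus ?M b b' x = mv_plus ?M f g (Y x)" using x Y_cube[OF x] by (simp add: mcnaughton_def)
      moreover have "h (mv_plus ?M b b') = mv_plus ?M f g" using b(1,2) b'(1,2) hplus by simp
      ultimately show ?case by (intro bexI[OF _ mv_generate.plus[OF b(1) b'(1)]] conjI)
    qed
    moreover have "h a \<in> alg n (coordinates n)"
      using bij a unfolding mcnaughton_theorem by (auto simp: bij_betw_def)
    ultimately obtain b where "b \<in> alg n G" "h b = h a" "b x = h a (Y x)" by blast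
    moreover from this have "b = a" using bij a by (auto simp: bij_betw_def inj_on_def)
    ultimately show ?thesis by simp
  qed
  have "Y ` X \<subseteq> \<Gamma>"
    using Y_cube c(1) by (auto simp: X_def \<Gamma>_def Y_def)
  moreover have "inj_on Y X"
  proof (rule inj_onI)
    fix x x' assume "x \<in> X" "x' \<in> X" and eq: "Y x = Y x'"
    then have xc: "x \<in> cube n" "x' \<in> cube n" by (auto simp: X_def)
    have "f x = f x'" if "f \<in> G" for f
      using eval[OF mv_generate.incl[OF that] xc(1)] eval[OF mv_generate.incl[OF that] xc(2)] eq by simp
    then show "x = x'" by (intro sep xc) blast
  qed
  moreover have fin: "finite \<Gamma>" unfolding \<Gamma>_def by (rule finite_bounded_denominator[OF D])
  ultimately have "finite X" "card X \<le> card \<Gamma>"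
    by (meson inj_on_finite, meson card_inj_on_le)
  moreover have "\<Gamma> \<subseteq> X"
  proof
    fix y assume y: "y \<in> \<Gamma>"
    have "real D * f y \<in> \<int>" if "f \<in> alg n G" for f
    proof (rule generated_Ints[where f = f and x = y and G = "coordinates n"])
      show "f \<in> alg n (coordinates n)" unfolding mcnaughton_theorem using that alg_mcnaughton[OF G] by blast
      show "y \<in> cube n" using y by (simp add: \<Gamma>_def)
      then show "\<And>g. g \<in> coordinates n \<Longrightarrow> real D * g y \<in> \<int>" using y by (auto simp: \<Gamma>_def coordinates_def)
    qed
    with y show "y \<in> X" by (simp add: X_def \<Gamma>_def)
  qed
  ultimately have "\<Gamma> = X" by (intro card_seteq)
  moreover have "x \<in> X" unfolding X_def using generated_Ints[OF _ x(1), of _ G D] x by blast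
  ultimately show ?thesis using i by (auto simp: \<Gamma>_def)
qed

definition preserves_denominators :: "nat \<Rightarrow> ((nat \<Rightarrow> real) \<Rightarrow> real) set \<Rightarrow> bool" where
  "preserves_denominators n G \<longleftrightarrow> (\<forall>E D v. E > 0 \<longrightarrow> (\<forall>i<n. v i \<le> E) \<longrightarrow>
    (\<forall>f\<in>G. real D * f (grid_point n E v) \<in> \<int>) \<longrightarrow> (\<forall>i<n. real D * grid_point n E v i \<in> \<int>))"

lemma isomorphic_iff_denominators:
  assumes G: "finite G" "G \<subseteq> mcnaughton_functions n"
    and sep: "\<And>x y. x \<in> cube n \<Longrightarrow> y \<in> cube n \<Longrightarrow> \<forall>f\<in>G. f x = f y \<Longrightarrow> x = y"
  shows "mv_isomorphic (mv_generated (mcnaughton n) G) (mcnaughton n) \<longleftrightarrow> preserves_denominators n G"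
    and "preserves_denominators n G \<longleftrightarrow> alg n G = mcnaughton_functions n"
proof -
  let ?DP = "preserves_denominators n G"
  have 1: "?DP" if "mv_isomorphic (mv_generated (mcnaughton n) G) (mcnaughton n)"
    unfolding preserves_denominators_def
  proof (intro allI impI)
    fix E D :: nat and v :: "nat \<Rightarrow> nat" and i
    assume *: "\<forall>i<n. v i \<le> E" "\<forall>f\<in>G. real D * f (grid_point n E v) \<in> \<int>" "i < n"
    show "real D * grid_point n E v i \<in> \<int>"
    proof (cases "D = 0")
      case False
      then show ?thesis using * grid_point_cube[of n v E]
        by (intro isomorphic_denominators[OF G(2) that sep]) auto
    qed simp
  qed
  have 2: "alg n G = mcnaughton_functions n" if ?DP
    by (rule generated_eq_mcnaughton[OF G sep]) (use that[unfolded preserves_denominators_def] in blast)+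
  have 3: "mv_isomorphic (mv_generated (mcnaughton n) G) (mcnaughton n)" if "alg n G = mcnaughton_functions n"
  proof -
    have "mv_generated (mcnaughton n) G = mcnaughton n" using that by (simp add: mv_generated_def mcnaughton_def)
    moreover have "id \<in> mv_iso (mcnaughton n) (mcnaughton n)" by (simp add: mv_iso_def)
    ultimately show ?thesis unfolding mv_isomorphic_def by auto
  qed
  show "mv_isomorphic (mv_generated (mcnaughton n) G) (mcnaughton n) \<longleftrightarrow> ?DP"
    "?DP \<longleftrightarrow> alg n G = mcnaughton_functions n" using 1 2 3 by blast+
qed

section \<open>Comparing terms on a grid\<close>

text \<open>The value of a term at \<open>\<rho> / D\<close>, multiplied by \<open>D\<close>.\<close>

primrec term_nat :: "nat \<Rightarrow> (nat \<Rightarrow> nat) \<Rightarrow> mv_term \<Rightarrow> nat" where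
  "term_nat D \<rho> (TVar i) = \<rho> i"
| "term_nat D \<rho> TZero = 0"
| "term_nat D \<rho> (TNeg t) = D - term_nat D \<rho> t"
| "term_nat D \<rho> (TPlus s t) = min D (term_nat D \<rho> s + term_nat D \<rho> t)"

lemma term_nat_real:
  assumes "D > 0" "\<And>i. i \<in> term_vars t \<Longrightarrow> \<rho> i \<le> D"
  shows "term_nat D \<rho> t \<le> D \<and> term_real (\<lambda>i. real (\<rho> i) / real D) t = real (term_nat D \<rho> t) / real D"
  using assms(2)
proof (induction t)
  case (TNeg t) then show ?case using assms(1) by (auto simp: of_nat_diff diff_divide_distrib)
next
  case (TPlus s t)
  then have IH: "term_real (\<lambda>i. real (\<rho> i) / real D) s = real (term_nat D \<rho> s) / real D"
    "term_real (\<lambda>i. real (\<rho> i) / real D) t = real (term_nat D \<rho> t) / real D" by simp_all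
  have "min 1 (real a / real D + real b / real D) = real (min D (a + b)) / real D" for a b
  proof (cases "a + b \<le> D")
    case True
    then have "real a + real b \<le> real D" by linarith
    with True show ?thesis using assms(1) by (simp add: add_divide_distrib[symmetric] min_absorb2)
  next
    case False
    then have "real D \<le> real a + real b" by linarith
    with False show ?thesis using assms(1) by (simp add: add_divide_distrib[symmetric] min_absorb1)
  qed
  then show ?case by (simp add: IH)
qed (use assms(1) in auto)

text \<open>Serves as a bound for the absolute values of the coefficients of the affine pieces of a
  term.\<close>

primrec term_size :: "mv_term \<Rightarrow> nat" where
  "term_size (TVar i) = 1"
| "term_size TZero = 1"
| "term_size (TNeg t) = Suc (term_size t)"
| "term_size (TPlus s t) = Suc (term_size s + term_size t)"

primrec subst :: "mv_term \<Rightarrow> (nat \<Rightarrow> mv_term) \<Rightarrow> mv_term" where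
  "subst (TVar i) \<theta> = \<theta> i"
| "subst TZero \<theta> = TZero"
| "subst (TNeg t) \<theta> = TNeg (subst t \<theta>)"
| "subst (TPlus s t) \<theta> = TPlus (subst s \<theta>) (subst t \<theta>)"

lemma term_real_subst: "term_real \<rho> (subst t \<theta>) = term_real (\<lambda>i. term_real \<rho> (\<theta> i)) t"
  by (induction t) simp_all

lemma term_nat_subst: "term_nat D \<rho> (subst t \<theta>) = term_nat D (\<lambda>i. term_nat D \<rho> (\<theta> i)) t"
  by (induction t) simp_all

lemma term_vars_subst: "term_vars (subst t \<theta>) = (\<Union>i\<in>term_vars t. term_vars (\<theta> i))"
  by (induction t) simp_all

lemma term_size_subst:
  assumes "\<And>i. term_size (\<theta> i) \<le> K" "0 < K" shows "term_size (subst t \<theta>) \<le> term_size t * K"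
proof (induction t)
  case (TPlus s t)
  then show ?case using assms(2) by (simp add: algebra_simps)
qed (use assms in \<open>auto simp: Suc_le_eq add_mono\<close>)

lemma term_size_le_code: "term_size t \<le> Suc (term_code t)"
proof (induction t)
  case (TPlus s t)
  have "term_code s \<le> prod_encode (term_code s, term_code t)" by (rule le_prod_encode_1)
  moreover have "term_code t \<le> prod_encode (term_code s, term_code t)" by (rule le_prod_encode_2)
  ultimately show ?case using TPlus by simp
qed simp_all

section \<open>Affine pieces of terms, with bounded integer coefficients\<close>

lemma int_affine_bounded_mono: "int_affine_bounded n K f \<Longrightarrow> K \<le> K' \<Longrightarrow> int_affine_bounded n K' f"
  unfolding int_affine_bounded_def by fastforce

lemma int_affine_bounded_const: "\<bar>c\<bar> \<le> int K \<Longrightarrow> int_affine_bounded n K (\<lambda>_. of_int c)"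
  by (rule int_affine_boundedI[where b = c and a = "\<lambda>_. 0"]) simp_all

lemma int_affine_bounded_coordinate: "i < n \<Longrightarrow> int_affine_bounded n 1 (\<lambda>x. x i)"
  by (rule int_affine_boundedI[where b = 0 and a = "\<lambda>j. if j = i then 1 else 0"])
    (simp_all add: sum.delta if_distrib[of "\<lambda>c. c * _"] if_distrib[of of_int] cong: if_cong)

lemma int_affine_bounded_add:
  assumes "int_affine_bounded n K f" "int_affine_bounded n L g"
  shows "int_affine_bounded n (K + L) (\<lambda>x. f x + g x)"
proof -
  obtain a :: "nat \<Rightarrow> int" and b :: int where f: "f = (\<lambda>x. of_int b + (\<Sum>i<n. of_int (a i) * x i))"
    "\<bar>b\<bar> \<le> int K" "\<And>i. i < n \<Longrightarrow> \<bar>a i\<bar> \<le> int K" using assms(1) unfolding int_affine_bounded_def by blast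
  obtain a' :: "nat \<Rightarrow> int" and b' :: int where g: "g = (\<lambda>x. of_int b' + (\<Sum>i<n. of_int (a' i) * x i))"
    "\<bar>b'\<bar> \<le> int L" "\<And>i. i < n \<Longrightarrow> \<bar>a' i\<bar> \<le> int L" using assms(2) unfolding int_affine_bounded_def by blast
  show ?thesis
  proof (rule int_affine_boundedI)
    show "(\<lambda>x. f x + g x) = (\<lambda>x. of_int (b + b') + (\<Sum>i<n. of_int (a i + a' i) * x i))"
      by (simp add: f(1) g(1) distrib_right sum.distrib algebra_simps)
    show "\<bar>a i + a' i\<bar> \<le> int (K + L)" if "i < n" for i
      using f(3)[OF that] g(3)[OF that] by simp
  qed (use f(2) g(2) in simp)
qed

lemma int_affine_bounded_uminus:
  assumes "int_affine_bounded n K f" shows "int_affine_bounded n K (\<lambda>x. - f x)"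
proof -
  obtain a :: "nat \<Rightarrow> int" and b :: int where f: "f = (\<lambda>x. of_int b + (\<Sum>i<n. of_int (a i) * x i))"
    "\<bar>b\<bar> \<le> int K" "\<And>i. i < n \<Longrightarrow> \<bar>a i\<bar> \<le> int K" using assms(1) unfolding int_affine_bounded_def by blast
  show ?thesis
    by (rule int_affine_boundedI[where b = "- b" and a = "\<lambda>i. - a i"]) (use f in \<open>simp_all add: sum_negf\<close>)
qed

text \<open>Each truncated sum takes one of its two branches at \<open>y\<close>. Recording the
  branches as inequalities gives a system satisfied by \<open>y\<close> on whose solution set the
  term is a single affine function.\<close>

lemma term_locally_affine:
  assumes "term_vars t \<subseteq> {..<n}"
  shows "\<exists>S p. finite S \<and> (\<forall>c\<in>S. int_affine_bounded n (term_size t) (fst c) \<and> sat c y) \<and>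
    int_affine_bounded n (term_size t) p \<and> (\<forall>z. (\<forall>c\<in>S. sat c z) \<longrightarrow> term_real z t = p z)"
  using assms
proof (induction t)
  case (TVar i)
  then show ?case using int_affine_bounded_coordinate[of i n]
    by (intro exI[of _ "{}"] exI[of _ "\<lambda>x. x i"]) simp
next
  case TZero
  then show ?case using int_affine_bounded_const[of 0 1 n]
    by (intro exI[of _ "{}"] exI[of _ "\<lambda>x. 0"]) simp
next
  case (TNeg t)
  then obtain S p where S: "finite S" "\<And>c. c \<in> S \<Longrightarrow> int_affine_bounded n (term_size t) (fst c) \<and> sat c y"
    and p: "int_affine_bounded n (term_size t) p" "\<And>z. \<forall>c\<in>S. sat c z \<Longrightarrow> term_real z t = p z" by auto
  have "int_affine_bounded n (1 + term_size t) (\<lambda>x. of_int 1 + - p x)"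
    by (intro int_affine_bounded_add int_affine_bounded_const int_affine_bounded_uminus p) simp
  moreover have "int_affine_bounded n (term_size (TNeg t)) (fst c) \<and> sat c y" if "c \<in> S" for c
    using S(2)[OF that] int_affine_bounded_mono[of n "term_size t" "fst c"] by simp
  ultimately show ?case using S(1) p(2)
    by (intro exI[of _ S] exI[of _ "\<lambda>x. of_int 1 + - p x"]) simp
next
  case (TPlus s t)
  have "term_vars s \<subseteq> {..<n}" using TPlus.prems by simp
  from TPlus.IH(1)[OF this] obtain S p where S: "finite S"
      "\<forall>c\<in>S. int_affine_bounded n (term_size s) (fst c) \<and> sat c y"
    and p: "int_affine_bounded n (term_size s) p" "\<forall>z. (\<forall>c\<in>S. sat c z) \<longrightarrow> term_real z s = p z"
    by (elim exE conjE)
  have "term_vars t \<subseteq> {..<n}" using TPlus.prems by simp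
  from TPlus.IH(2)[OF this] obtain T q where T: "finite T"
      "\<forall>c\<in>T. int_affine_bounded n (term_size t) (fst c) \<and> sat c y"
    and q: "int_affine_bounded n (term_size t) q" "\<forall>z. (\<forall>c\<in>T. sat c z) \<longrightarrow> term_real z t = q z"
    by (elim exE conjE)
  let ?K = "term_size (TPlus s t)"
  have ST: "int_affine_bounded n ?K (fst c) \<and> sat c y" if "c \<in> S \<union> T" for c
    using that bspec[OF S(2), of c] bspec[OF T(2), of c] int_affine_bounded_mono[of n "term_size s" "fst c" ?K]
      int_affine_bounded_mono[of n "term_size t" "fst c" ?K] by auto
  have pq: "int_affine_bounded n (term_size s + term_size t) (\<lambda>x. p x + q x)"
    by (rule int_affine_bounded_add[OF p(1) q(1)])
  have "int_affine_bounded n ((term_size s + term_size t) + 1) (\<lambda>x. (p x + q x) + of_int (- 1))"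
    by (rule int_affine_bounded_add[OF pq int_affine_bounded_const]) simp
  then have pq1: "int_affine_bounded n ?K (\<lambda>x. p x + q x - 1)" by simp
  from int_affine_bounded_uminus[OF this] have pq2: "int_affine_bounded n ?K (\<lambda>x. 1 - (p x + q x))" by simp
  show ?case
  proof (cases "p y + q y \<le> 1")
    case True
    show ?thesis
    proof (intro exI conjI)
      show "finite (insert (\<lambda>x. 1 - (p x + q x), False) (S \<union> T))" using S(1) T(1) by simp
      show "int_affine_bounded n ?K (\<lambda>x. p x + q x)" by (rule int_affine_bounded_mono[OF pq]) simp
      show "\<forall>c\<in>insert (\<lambda>x. 1 - (p x + q x), False) (S \<union> T). int_affine_bounded n ?K (fst c) \<and> sat c y"
        using ST pq2 True by (auto simp: sat_def)
      show "\<forall>z. (\<forall>c\<in>insert (\<lambda>x. 1 - (p x + q x), False) (S \<union> T). sat c z) \<longrightarrow> term_real z (TPlus s t) = p z + q z"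
        using p(2) q(2) by (auto simp: sat_def ball_Un)
    qed
  next
    case False
    show ?thesis
    proof (intro exI conjI)
      show "finite (insert (\<lambda>x. p x + q x - 1, False) (S \<union> T))" using S(1) T(1) by simp
      show "int_affine_bounded n ?K (\<lambda>x. of_int 1)" by (rule int_affine_bounded_const) simp
      show "\<forall>c\<in>insert (\<lambda>x. p x + q x - 1, False) (S \<union> T). int_affine_bounded n ?K (fst c) \<and> sat c y"
        using ST pq1 False by (auto simp: sat_def)
      show "\<forall>z. (\<forall>c\<in>insert (\<lambda>x. p x + q x - 1, False) (S \<union> T). sat c z) \<longrightarrow> term_real z (TPlus s t) = of_int 1"
        using p(2) q(2) by (auto simp: sat_def ball_Un)
    qed
  qed
qed

text \<open>The factorial is divisible by every denominator that
  \<open>small_rational_solution\<close> can return, so one grid contains all these solutions from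
  the cube.\<close>

definition grid_size :: "nat \<Rightarrow> nat \<Rightarrow> nat" where
  "grid_size n K = fact ((2 * K) ^ (2 ^ (n + 1)))"

text \<open>If the term differs from the coordinate at \<open>y\<close>, then \<open>y\<close>
  solves the system of its affine piece together with the cube inequalities and the strict sign of
  the difference. Hence there is a solution on the grid, where agreement is assumed. The strict size
  bound leaves room for the coefficient of the subtracted coordinate.\<close>

lemma term_coordinate_grid:
  assumes t: "term_vars t \<subseteq> {..<n}" "term_size t < K" and i: "i < n"
    and grid: "\<And>v. (\<And>j. j < n \<Longrightarrow> v j \<le> grid_size n K) \<Longrightarrow> term_nat (grid_size n K) v t = v i"
    and y: "\<And>j. j < n \<Longrightarrow> 0 \<le> y j \<and> y j \<le> 1"
  shows "term_real y t = y i"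
proof (rule ccontr)
  assume ne: "term_real y t \<noteq> y i"
  obtain S p where S: "finite S" "\<And>c. c \<in> S \<Longrightarrow> int_affine_bounded n (term_size t) (fst c) \<and> sat c y"
    and p: "int_affine_bounded n (term_size t) p" "\<And>z. \<forall>c\<in>S. sat c z \<Longrightarrow> term_real z t = p z"
    using term_locally_affine[OF t(1), of y] by blast
  have K: "0 < K" using t(2) by simp
  have ci: "int_affine_bounded n 1 (\<lambda>x. x i)" by (rule int_affine_bounded_coordinate[OF i])
  have "int_affine_bounded n (term_size t + 1) (\<lambda>x. p x + - x i)"
    by (rule int_affine_bounded_add[OF p(1) int_affine_bounded_uminus[OF ci]])
  then have d: "int_affine_bounded n K (\<lambda>x. p x - x i)"
    using int_affine_bounded_mono[of _ _ _ K] t(2) by simp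
  from int_affine_bounded_uminus[OF this] have d': "int_affine_bounded n K (\<lambda>x. x i - p x)" by simp
  define e where "e = (if p y > y i then (\<lambda>x. p x - x i) else (\<lambda>x. x i - p x))"
  have pe: "p y \<noteq> y i" using ne p(2)[of y] S(2) by simp
  have e: "int_affine_bounded n K e" "e y > 0" "\<And>z. e z > 0 \<Longrightarrow> p z \<noteq> z i"
    using d d' pe by (auto simp: e_def split: if_splits)
  let ?S = "S \<union> (\<lambda>j. (\<lambda>x. x j, False)) ` {..<n} \<union> (\<lambda>j. (\<lambda>x. of_int 1 + - x j, False)) ` {..<n} \<union> {(e, True)}"
  obtain m :: nat and z where m: "0 < m" "m \<le> (2 * K) ^ (2 ^ (n + 1) - 2)"
    and z: "\<And>i. i < n \<Longrightarrow> of_nat m * z i \<in> \<int>" "\<And>c. c \<in> ?S \<Longrightarrow> sat c z"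
  proof (rule small_rational_solution)
    show "finite ?S" using S(1) by simp
    show "int_affine_bounded n K (fst c)" if c: "c \<in> ?S" for c
    proof -
      have cj: "int_affine_bounded n K (\<lambda>x. x j)" if "j < n" for j
        by (rule int_affine_bounded_mono[OF int_affine_bounded_coordinate[OF that]]) (use K in simp)
      have "1 \<le> term_size t" by (cases t) auto
      then have "1 + 1 \<le> K" using t(2) by simp
      then have cj': "int_affine_bounded n K (\<lambda>x. of_int 1 + - x j)" if "j < n" for j
        by (intro int_affine_bounded_mono[OF int_affine_bounded_add[OF int_affine_bounded_const[of 1 1]
          int_affine_bounded_uminus[OF int_affine_bounded_coordinate[OF that]]]]) simp_all
      have "int_affine_bounded n K (fst c)" if "c \<in> S"
        by (rule int_affine_bounded_mono[of n "term_size t"]) (use S(2)[OF that] t(2) in simp_all)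
      with cj cj' e(1) c show ?thesis by auto
    qed
    show "sat c y" if "c \<in> ?S" for c
    proof -
      consider "c \<in> S" | j where "j < n" "c = (\<lambda>x. x j, False) \<or> c = (\<lambda>x. of_int 1 + - x j, False)" | "c = (e, True)"
        using \<open>c \<in> ?S\<close> by blast
      then show ?thesis using S(2) y e(2) by cases (auto simp: sat_def[of "(_, _)"])
    qed
  qed (use K in auto)
  have z01: "0 \<le> z j \<and> z j \<le> 1" if "j < n" for j
    using z(2)[of "(\<lambda>x. x j, False)"] z(2)[of "(\<lambda>x. of_int 1 + - x j, False)"] that by (auto simp: sat_def)
  have "term_real z t = p z" using p(2)[of z] z(2) by simp
  moreover have "p z \<noteq> z i" using e(3)[of z] z(2)[of "(e, True)"] by (simp add: sat_def)
  ultimately have ne: "term_real z t \<noteq> z i" by simp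
  let ?D = "grid_size n K"
  have "(2 * K) ^ (2 ^ (n + 1) - 2) \<le> (2 * K) ^ (2 ^ (n + 1))" using K by (intro power_increasing) auto
  with m have "m dvd ?D" unfolding grid_size_def by (intro dvd_fact) auto
  then obtain r where r: "?D = m * r" by blast
  have D0: "?D > 0" by (simp add: grid_size_def)
  define v where "v j = nat \<lfloor>real ?D * z j\<rfloor>" for j
  have v: "real (v j) = real ?D * z j" if "j < n" for j
  proof -
    have "real ?D * z j = real r * (real m * z j)" by (simp add: r)
    also have "\<dots> \<in> \<int>" by (rule Ints_mult[OF Ints_of_nat z(1)[OF that]])
    finally have "of_int \<lfloor>real ?D * z j\<rfloor> = real ?D * z j" by (auto elim: Ints_cases)
    moreover have "0 \<le> real ?D * z j" using z01[OF that] by simp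
    ultimately show ?thesis by (simp add: v_def)
  qed
  have vD: "v j \<le> ?D" if "j < n" for j
  proof -
    have "real ?D * z j \<le> real ?D * 1" using z01[OF that] by (intro mult_left_mono) auto
    then show ?thesis unfolding v[OF that, symmetric] by simp
  qed
  have "term_real z t = term_real (\<lambda>j. real (v j) / real ?D) t"
    by (rule term_real_cong) (use t(1) v D0 in auto)
  also have "\<dots> = real (term_nat ?D v t) / real ?D"
    using term_nat_real[OF D0, of t v] vD t(1) by blast
  also have "\<dots> = z i" using grid[of v] vD v[OF i] D0 by simp
  finally show False using ne by simp
qed

section \<open>Recursive functions\<close>

definition computable :: "nat \<Rightarrow> (nat list \<Rightarrow> nat) \<Rightarrow> bool" where
  "computable k f \<longleftrightarrow> (\<exists>r. \<forall>xs. length xs = k \<longrightarrow> computes r xs (f xs))"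

lemma computable_proj: "i < k \<Longrightarrow> computable k (\<lambda>xs. xs ! i)"
  unfolding computable_def by (intro exI[of _ "Proj i"]) (simp add: computes.Proj)

lemma computable_comp:
  assumes "computable (length fs) F" "\<And>f. f \<in> set fs \<Longrightarrow> computable k f"
  shows "computable k (\<lambda>xs. F (map (\<lambda>f. f xs) fs))"
proof -
  obtain r where r: "\<And>xs. length xs = length fs \<Longrightarrow> computes r xs (F xs)"
    using assms(1) unfolding computable_def by blast
  have "\<forall>f\<in>set fs. \<exists>r. \<forall>xs. length xs = k \<longrightarrow> computes r xs (f xs)"
    using assms(2) unfolding computable_def by blast
  from bchoice[OF this] obtain R where R: "\<And>f xs. f \<in> set fs \<Longrightarrow> length xs = k \<Longrightarrow> computes (R f) xs (f xs)"
    by blast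
  have "computes (Comp r (map R fs)) xs (F (map (\<lambda>f. f xs) fs))" if "length xs = k" for xs
  proof (rule computes.Comp)
    show "list_all2 (\<lambda>g y. computes g xs y) (map R fs) (map (\<lambda>f. f xs) fs)"
      using R that by (simp add: list_all2_conv_all_nth)
    show "computes r (map (\<lambda>f. f xs) fs) (F (map (\<lambda>f. f xs) fs))" by (rule r) simp
  qed
  then show ?thesis unfolding computable_def by blast
qed

lemma computable_app1: "computable 1 (\<lambda>xs. F (xs ! 0)) \<Longrightarrow> computable k f \<Longrightarrow> computable k (\<lambda>xs. F (f xs))"
  using computable_comp[of "[f]" "\<lambda>xs. F (xs ! 0)" k] by simp

lemma computable_app2:
  "computable 2 (\<lambda>xs. F (xs ! 0) (xs ! 1)) \<Longrightarrow> computable k f \<Longrightarrow> computable k g \<Longrightarrow> computable k (\<lambda>xs. F (f xs) (g xs))"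
  using computable_comp[of "[f, g]" "\<lambda>xs. F (xs ! 0) (xs ! 1)" k] by (simp add: numeral_2_eq_2) fastforce

lemma computable_Suc: "computable k f \<Longrightarrow> computable k (\<lambda>xs. Suc (f xs))"
proof (rule computable_app1[of Suc])
  have "computes Succ xs (Suc (xs ! 0))" if "length xs = 1" for xs
    using that by (cases xs) (auto intro: computes.Succ)
  then show "computable 1 (\<lambda>xs. Suc (xs ! 0))" unfolding computable_def by blast
qed

lemma computable_const: "computable k (\<lambda>_. c)"
proof (induction c)
  case 0
  show ?case unfolding computable_def by (intro exI[of _ Const0]) (simp add: computes.Const0)
next
  case (Suc c)
  then show ?case by (rule computable_Suc)
qed

lemma computable_prec:
  assumes "computable k a" "computable (Suc (Suc k)) h"
  shows "computable (Suc k) (\<lambda>xs. rec_nat (a (tl xs)) (\<lambda>i r. h (i # r # tl xs)) (hd xs))"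
proof -
  obtain ra where ra: "\<And>xs. length xs = k \<Longrightarrow> computes ra xs (a xs)"
    using assms(1) unfolding computable_def by blast
  obtain rh where rh: "\<And>xs. length xs = Suc (Suc k) \<Longrightarrow> computes rh xs (h xs)"
    using assms(2) unfolding computable_def by blast
  have "computes (Prec ra rh) (m # ys) (rec_nat (a ys) (\<lambda>i r. h (i # r # ys)) m)" if "length ys = k" for m ys
  proof (induction m)
    case 0
    show ?case by simp (rule computes.Prec_0[OF ra[OF that]])
  next
    case (Suc m)
    show ?case by simp (rule computes.Prec_Suc[OF Suc rh], simp add: that)
  qed
  then have "computes (Prec ra rh) xs (rec_nat (a (tl xs)) (\<lambda>i r. h (i # r # tl xs)) (hd xs))" if "length xs = Suc k" for xs
    using that by (cases xs) auto
  then show ?thesis unfolding computable_def by blast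
qed

lemma computable_cong:
  assumes "computable k f" "\<And>xs. length xs = k \<Longrightarrow> f xs = g xs" shows "computable k g"
  using assms unfolding computable_def by metis

lemma computable_rec1:
  assumes "computable 2 (\<lambda>xs. h (xs ! 0) (xs ! 1))"
  shows "computable 1 (\<lambda>xs. rec_nat c (\<lambda>i r. h i r) (xs ! 0))"
proof -
  have "computable (Suc 0) (\<lambda>xs. rec_nat c (\<lambda>i r. h ((i # r # tl xs) ! 0) ((i # r # tl xs) ! 1)) (hd xs))"
    by (rule computable_prec[OF computable_const[of 0 c]]) (use assms in \<open>simp add: numeral_2_eq_2\<close>)
  then have "computable (Suc 0) (\<lambda>xs. rec_nat c (\<lambda>i r. h i r) (xs ! 0))"
    by (rule computable_cong) (auto simp: length_Suc_conv)
  then show ?thesis by simp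
qed

lemma computable_rec2:
  assumes "computable 1 (\<lambda>xs. a (xs ! 0))" "computable 3 (\<lambda>xs. h (xs ! 0) (xs ! 1) (xs ! 2))"
  shows "computable 2 (\<lambda>xs. rec_nat (a (xs ! 1)) (\<lambda>i r. h i r (xs ! 1)) (xs ! 0))"
proof -
  have "computable (Suc 1) (\<lambda>xs. rec_nat (a (tl xs ! 0)) (\<lambda>i r. h ((i # r # tl xs) ! 0) ((i # r # tl xs) ! 1) ((i # r # tl xs) ! 2)) (hd xs))"
    by (rule computable_prec[OF assms(1)]) (use assms(2) in \<open>simp add: numeral_3_eq_3\<close>)
  then have "computable (Suc 1) (\<lambda>xs. rec_nat (a (xs ! 1)) (\<lambda>i r. h i r (xs ! 1)) (xs ! 0))"
    by (rule computable_cong) (auto simp: length_Suc_conv numeral_2_eq_2)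
  then show ?thesis by (simp add: numeral_2_eq_2)
qed

lemma computable_add: "computable k f \<Longrightarrow> computable k g \<Longrightarrow> computable k (\<lambda>xs. f xs + g xs)"
proof (rule computable_app2[of "(+)"])
  have "computable 2 (\<lambda>xs. rec_nat (xs ! 1) (\<lambda>i r. Suc r) (xs ! 0))"
    by (rule computable_rec2[of "\<lambda>x. x" "\<lambda>i r x. Suc r"]) (simp_all add: computable_proj computable_Suc)
  moreover have "rec_nat y (\<lambda>i r. Suc r) x = x + y" for x y by (induction x) simp_all
  ultimately show "computable 2 (\<lambda>xs. xs ! 0 + xs ! 1)" by simp
qed

lemma computable_pred: "computable k f \<Longrightarrow> computable k (\<lambda>xs. f xs - 1)"
proof (rule computable_app1[of "\<lambda>x. x - 1"])
  have "computable 1 (\<lambda>xs. rec_nat 0 (\<lambda>i r. i) (xs ! 0))"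
    by (rule computable_rec1[of "\<lambda>i r. i"]) (simp add: computable_proj)
  moreover have "rec_nat 0 (\<lambda>i r. i) x = x - 1" for x by (cases x) simp_all
  ultimately show "computable 1 (\<lambda>xs. xs ! 0 - 1)" by simp
qed

lemma computable_diff: "computable k f \<Longrightarrow> computable k g \<Longrightarrow> computable k (\<lambda>xs. f xs - g xs)"
proof (rule computable_app2[of "\<lambda>x y. y - x"])
  have "computable 2 (\<lambda>xs. rec_nat (xs ! 1) (\<lambda>i r. r - 1) (xs ! 0))"
    by (rule computable_rec2[of "\<lambda>x. x" "\<lambda>i r x. r - 1"]) (intro computable_proj computable_pred, simp)+
  moreover have "rec_nat y (\<lambda>i r. r - 1) x = y - x" for x y :: nat by (induction x) simp_all
  ultimately show "computable 2 (\<lambda>xs. xs ! 1 - xs ! 0)" by simp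
qed

lemma computable_triangle: "computable k f \<Longrightarrow> computable k (\<lambda>xs. triangle (f xs))"
proof (rule computable_app1[of triangle])
  have "computable 1 (\<lambda>xs. rec_nat 0 (\<lambda>i r. r + Suc i) (xs ! 0))"
    by (rule computable_rec1[of "\<lambda>i r. r + Suc i"]) (intro computable_add computable_Suc computable_proj, simp_all)
  moreover have "rec_nat 0 (\<lambda>i r. r + Suc i) x = triangle x" for x by (induction x) simp_all
  ultimately show "computable 1 (\<lambda>xs. triangle (xs ! 0))" by simp
qed

text \<open>The index of the Cantor antidiagonal on which \<open>z\<close> lies, that is, the
  largest \<open>d\<close> with \<open>triangle d\<close> at most \<open>z\<close>. It grows by at
  most 1 from \<open>z\<close> to \<open>z + 1\<close>, which gives a recursion without
  search.\<close>

definition diagonal :: "nat \<Rightarrow> nat" where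
  "diagonal = rec_nat 0 (\<lambda>z d. d + (1 - (triangle (Suc d) - Suc z)))"

lemma diagonal: "triangle (diagonal z) \<le> z \<and> z < triangle (Suc (diagonal z))"
proof (induction z)
  case (Suc z)
  have "diagonal (Suc z) = (if triangle (Suc (diagonal z)) \<le> Suc z then Suc (diagonal z) else diagonal z)"
    unfolding diagonal_def by simp
  with Suc show ?case by auto
qed (simp add: diagonal_def)

lemma computable_diagonal: "computable k f \<Longrightarrow> computable k (\<lambda>xs. diagonal (f xs))"
proof (rule computable_app1[of diagonal])
  show "computable 1 (\<lambda>xs. diagonal (xs ! 0))" unfolding diagonal_def
    by (rule computable_rec1) (intro computable_add computable_diff computable_triangle computable_const computable_Suc computable_proj, simp_all)
qed

definition pair :: "nat \<Rightarrow> nat \<Rightarrow> nat" where "pair a b = prod_encode (a, b)"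
definition pfst :: "nat \<Rightarrow> nat" where "pfst z = fst (prod_decode z)"
definition psnd :: "nat \<Rightarrow> nat" where "psnd z = snd (prod_decode z)"

lemma pfst_pair [simp]: "pfst (pair a b) = a" and psnd_pair [simp]: "psnd (pair a b) = b"
  by (simp_all add: pfst_def psnd_def pair_def)

lemma pair_eq: "pair a b = triangle (a + b) + a" by (simp add: pair_def prod_encode_def)

lemma unpair_eq: "pfst z = z - triangle (diagonal z)" "psnd z = diagonal z - (z - triangle (diagonal z))"
proof -
  have "z - triangle (diagonal z) \<le> diagonal z" using diagonal[of z] by auto
  then have "pair (z - triangle (diagonal z)) (diagonal z - (z - triangle (diagonal z))) = z"
    using diagonal[of z] by (simp add: pair_eq)
  then show "pfst z = z - triangle (diagonal z)" "psnd z = diagonal z - (z - triangle (diagonal z))"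
    by (metis pfst_pair, metis psnd_pair)
qed

text \<open>Restricted to unary functions, with further arguments packed by \<open>pair\<close>, so
  that the closure rules in \<open>recursive_intros\<close> apply to abstractions over one
  variable.\<close>

definition recursive :: "(nat \<Rightarrow> nat) \<Rightarrow> bool" where
  "recursive f \<longleftrightarrow> computable 1 (\<lambda>xs. f (xs ! 0))"

lemma recursive_app: "recursive F \<Longrightarrow> computable k f \<Longrightarrow> computable k (\<lambda>xs. F (f xs))"
  unfolding recursive_def by (rule computable_app1)

lemma recursive_comp: "recursive F \<Longrightarrow> recursive f \<Longrightarrow> recursive (\<lambda>x. F (f x))"
  using recursive_app[of F 1] unfolding recursive_def by simp

named_theorems recursive_intros

lemma recursive_id [recursive_intros]: "recursive (\<lambda>x. x)"
  unfolding recursive_def by (rule computable_proj) simp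

lemma recursive_const [recursive_intros]: "recursive (\<lambda>x. c)"
  unfolding recursive_def by (rule computable_const)

lemma recursive_Suc [recursive_intros]: "recursive f \<Longrightarrow> recursive (\<lambda>x. Suc (f x))"
  unfolding recursive_def by (rule computable_Suc)

lemma recursive_add [recursive_intros]: "recursive f \<Longrightarrow> recursive g \<Longrightarrow> recursive (\<lambda>x. f x + g x)"
  unfolding recursive_def by (rule computable_add)

lemma recursive_diff [recursive_intros]: "recursive f \<Longrightarrow> recursive g \<Longrightarrow> recursive (\<lambda>x. f x - g x)"
  unfolding recursive_def by (rule computable_diff)

lemma computable_pair: "computable k f \<Longrightarrow> computable k g \<Longrightarrow> computable k (\<lambda>xs. pair (f xs) (g xs))"
  unfolding pair_eq by (intro computable_add computable_triangle)

lemma recursive_pair [recursive_intros]: "recursive f \<Longrightarrow> recursive g \<Longrightarrow> recursive (\<lambda>x. pair (f x) (g x))"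
  unfolding recursive_def by (rule computable_pair)

lemma recursive_pfst [recursive_intros]: "recursive f \<Longrightarrow> recursive (\<lambda>x. pfst (f x))"
  unfolding recursive_def unpair_eq by (intro computable_diff computable_triangle computable_diagonal)

lemma recursive_psnd [recursive_intros]: "recursive f \<Longrightarrow> recursive (\<lambda>x. psnd (f x))"
  unfolding recursive_def unpair_eq by (intro computable_diff computable_triangle computable_diagonal)

lemma recursive_rec_nat:
  assumes "recursive a" "recursive m" "recursive (\<lambda>z. h (pfst z) (pfst (psnd z)) (psnd (psnd z)))"
  shows "recursive (\<lambda>x. rec_nat (a x) (\<lambda>k r. h k r x) (m x))"
proof -
  have "computable 3 (\<lambda>xs. h (pfst (pair (xs ! 0) (pair (xs ! 1) (xs ! 2)))) (pfst (psnd (pair (xs ! 0) (pair (xs ! 1) (xs ! 2)))))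
      (psnd (psnd (pair (xs ! 0) (pair (xs ! 1) (xs ! 2))))))"
    by (rule recursive_app[OF assms(3)]) (intro computable_pair computable_proj, simp_all)
  then have "computable 3 (\<lambda>xs. h (xs ! 0) (xs ! 1) (xs ! 2))" by simp
  with assms(1) have "computable 2 (\<lambda>xs. rec_nat (a (xs ! 1)) (\<lambda>i r. h i r (xs ! 1)) (xs ! 0))"
    unfolding recursive_def by (intro computable_rec2)
  from computable_app2[of "\<lambda>y x. rec_nat (a x) (\<lambda>i r. h i r x) y", OF this] assms(2)
  show ?thesis unfolding recursive_def by (simp add: computable_proj)
qed

lemma recursive_mult [recursive_intros]:
  assumes "recursive f" "recursive g" shows "recursive (\<lambda>x. f x * g x)"
proof -
  have "recursive (\<lambda>x. rec_nat 0 (\<lambda>k r. r + g x) (f x))"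
    by (rule recursive_rec_nat) (intro recursive_intros assms(1) recursive_comp[OF assms(2)])+
  moreover have "rec_nat 0 (\<lambda>k r. r + b) a = a * b" for a b :: nat by (induction a) simp_all
  ultimately show ?thesis by simp
qed

lemma recursive_power [recursive_intros]:
  assumes "recursive f" "recursive g" shows "recursive (\<lambda>x. f x ^ g x)"
proof -
  have "recursive (\<lambda>x. rec_nat 1 (\<lambda>k r. r * f x) (g x))"
    by (rule recursive_rec_nat) (intro recursive_intros assms(2) recursive_comp[OF assms(1)])+
  moreover have "rec_nat 1 (\<lambda>k r. r * b) a = b ^ a" for a b :: nat by (induction a) simp_all
  ultimately show ?thesis by simp
qed

lemma recursive_fact [recursive_intros]:
  assumes "recursive f" shows "recursive (\<lambda>x. fact (f x))"
proof -
  have "recursive (\<lambda>x. rec_nat 1 (\<lambda>k r. Suc k * r) (f x))"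
    by (rule recursive_rec_nat) (intro recursive_intros assms)+
  moreover have "rec_nat 1 (\<lambda>k r. Suc k * r) a = fact a" for a :: nat by (induction a) simp_all
  ultimately show ?thesis by simp
qed

section \<open>Decidable predicates\<close>

definition decidable :: "(nat \<Rightarrow> bool) \<Rightarrow> bool" where
  "decidable P \<longleftrightarrow> recursive (\<lambda>x. of_bool (P x))"

lemma recursive_of_bool [recursive_intros]: "decidable P \<Longrightarrow> recursive (\<lambda>x. of_bool (P x))"
  by (simp add: decidable_def)

lemma decidable_le [recursive_intros]:
  assumes "recursive f" "recursive g" shows "decidable (\<lambda>x. f x \<le> g x)"
proof -
  have "recursive (\<lambda>x. 1 - (f x - g x))" by (intro recursive_intros assms)
  moreover have "1 - (a - b) = of_bool (a \<le> b)" for a b :: nat by simp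
  ultimately show ?thesis by (simp add: decidable_def)
qed

lemma decidable_less [recursive_intros]:
  assumes "recursive f" "recursive g" shows "decidable (\<lambda>x. f x < g x)"
  using decidable_le[OF recursive_Suc[OF assms(1)] assms(2)] by (simp add: Suc_le_eq)

lemma decidable_conj [recursive_intros]:
  assumes "decidable P" "decidable Q" shows "decidable (\<lambda>x. P x \<and> Q x)"
  using recursive_mult[OF assms[unfolded decidable_def]] by (simp add: decidable_def of_bool_conj)

lemma decidable_not [recursive_intros]:
  assumes "decidable P" shows "decidable (\<lambda>x. \<not> P x)"
proof -
  have "recursive (\<lambda>x. 1 - of_bool (P x))" by (intro recursive_intros assms)
  moreover have "1 - of_bool p = (of_bool (\<not> p) :: nat)" for p by simp
  ultimately show ?thesis by (simp add: decidable_def)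
qed

lemma decidable_disj [recursive_intros]:
  assumes "decidable P" "decidable Q" shows "decidable (\<lambda>x. P x \<or> Q x)"
  using decidable_not[OF decidable_conj[OF decidable_not[OF assms(1)] decidable_not[OF assms(2)]]] by simp

lemma decidable_eq [recursive_intros]:
  assumes "recursive f" "recursive g" shows "decidable (\<lambda>x. f x = g x)"
  using decidable_conj[OF decidable_le[OF assms] decidable_le[OF assms(2,1)]] by (simp add: eq_iff)

lemma recursive_if [recursive_intros]:
  assumes "decidable P" "recursive f" "recursive g" shows "recursive (\<lambda>x. if P x then f x else g x)"
proof -
  have "recursive (\<lambda>x. of_bool (P x) * f x + of_bool (\<not> P x) * g x)" by (intro recursive_intros assms)
  moreover have "of_bool p * a + of_bool (\<not> p) * b = (if p then a else b)" for p and a b :: nat by simp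
  ultimately show ?thesis by simp
qed

lemma recursive_min [recursive_intros]:
  "recursive f \<Longrightarrow> recursive g \<Longrightarrow> recursive (\<lambda>x. min (f x) (g x))"
  unfolding min_def by (intro recursive_intros)

lemma decidable_all [recursive_intros]:
  assumes "recursive m" "decidable (\<lambda>z. P (pfst z) (psnd z))" shows "decidable (\<lambda>x. \<forall>k<m x. P k x)"
proof -
  have "recursive (\<lambda>z. of_bool (P (pfst (pair (pfst z) (psnd (psnd z)))) (psnd (pair (pfst z) (psnd (psnd z))))))"
    by (rule recursive_comp[OF assms(2)[unfolded decidable_def]]) (intro recursive_intros)
  then have "recursive (\<lambda>z. of_bool (P (pfst z) (psnd (psnd z))))" by simp
  then have "recursive (\<lambda>x. rec_nat 1 (\<lambda>k r. r * of_bool (P k x)) (m x))"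
    by (intro recursive_rec_nat recursive_mult recursive_pfst recursive_psnd recursive_id recursive_const assms(1))
  moreover have "rec_nat 1 (\<lambda>k r. r * of_bool (p k)) n = (of_bool (\<forall>k<n. p k) :: nat)" for p n
    by (induction n) (auto simp: less_Suc_eq)
  ultimately show ?thesis by (simp add: decidable_def)
qed

lemma recursive_mod [recursive_intros]:
  assumes "recursive f" "recursive g" shows "recursive (\<lambda>x. f x mod g x)"
proof -
  have "recursive (\<lambda>x. rec_nat 0 (\<lambda>k r. if Suc r = g x then 0 else Suc r) (f x))"
    by (rule recursive_rec_nat) (intro recursive_intros assms(1) recursive_comp[OF assms(2)])+
  moreover have "rec_nat 0 (\<lambda>k r. if Suc r = b then 0 else Suc r) a = a mod b" for a b :: nat
    by (induction a) (simp_all add: mod_Suc)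
  ultimately show ?thesis by simp
qed

lemma recursive_div [recursive_intros]:
  assumes "recursive f" "recursive g" shows "recursive (\<lambda>x. f x div g x)"
proof -
  have "recursive (\<lambda>x. rec_nat 0 (\<lambda>k r. if Suc k mod g x = 0 then Suc r else r) (f x))"
    by (rule recursive_rec_nat) (intro recursive_intros assms(1) recursive_comp[OF assms(2)])+
  moreover have "rec_nat 0 (\<lambda>k r. if Suc k mod b = 0 then Suc r else r) a = a div b" for a b :: nat
    by (induction a) (simp_all add: div_Suc)
  ultimately show ?thesis by simp
qed

lemma decidable_dvd [recursive_intros]:
  assumes "recursive f" "recursive g" shows "decidable (\<lambda>x. f x dvd g x)"
  unfolding dvd_eq_mod_eq_0 by (intro recursive_intros assms)

section \<open>Evaluation of coded terms\<close>

text \<open>Beyond the end of the list the value is \<open>0\<close>, the code of \<open>TZero\<close>.\<close>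

definition nth_code :: "nat \<Rightarrow> nat \<Rightarrow> nat" where
  "nth_code i l = pfst (rec_nat l (\<lambda>_ r. psnd (r - 1)) i - 1)"

text \<open>The empty list has code 0, and 0 unpairs to 0, so taking tails beyond the end of a list
  stays at 0.\<close>

lemma psnd_0 [simp]: "psnd 0 = 0" and pfst_0 [simp]: "pfst 0 = 0"
  by (simp_all add: pfst_def psnd_def prod_decode_def prod_decode_aux.simps)

lemma recursive_nth_code [recursive_intros]:
  assumes "recursive f" "recursive g" shows "recursive (\<lambda>x. nth_code (f x) (g x))"
  unfolding nth_code_def
  by (intro recursive_intros recursive_rec_nat assms)

lemma drop_code:
  "rec_nat (list_encode xs) (\<lambda>_ r. psnd (r - 1)) i = list_encode (drop i xs)"
proof (induction i)
  case (Suc i)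
  have "psnd (list_encode ys - 1) = list_encode (tl ys)" for ys
    using psnd_0 by (cases ys) (simp_all add: psnd_def)
  with Suc show ?case by (simp add: drop_Suc tl_drop)
qed simp

lemma nth_code_list: "nth_code i (list_encode xs) = (if i < length xs then xs ! i else 0)"
proof -
  have "pfst (list_encode ys - 1) = (case ys of [] \<Rightarrow> 0 | y # _ \<Rightarrow> y)" for ys
    using pfst_0 by (cases ys) (simp_all add: pfst_def)
  then show ?thesis unfolding nth_code_def drop_code
    by (cases "i < length xs") (auto simp: Cons_nth_drop_Suc[symmetric] pfst_def pfst_0[unfolded pfst_def])
qed

lemma pfst_le: "pfst z \<le> z" and psnd_le: "psnd z \<le> z"
  using le_prod_encode_1[of "pfst z" "psnd z"] le_prod_encode_2[of "psnd z" "pfst z"]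
  by (simp_all add: pfst_def psnd_def)

lemma nth_code_le: "nth_code i l \<le> l"
proof -
  have "rec_nat l (\<lambda>_ r. psnd (r - 1)) i \<le> l"
  proof (induction i)
    case (Suc i)
    then show ?case using psnd_le[of "rec_nat l (\<lambda>_ r. psnd (r - 1)) i - 1"] by simp
  qed simp
  then show ?thesis unfolding nth_code_def
    using pfst_le[of "rec_nat l (\<lambda>_ r. psnd (r - 1)) i - 1"] by linarith
qed

lemma length_le_code: "length xs \<le> list_encode xs"
proof (induction xs)
  case (Cons x xs)
  then show ?case using le_prod_encode_2[of "list_encode xs" x] by simp
qed simp

text \<open>Every number codes a term, so decoding is total and a search may range over all
  numbers.\<close>

lemma surj_term_code: "\<exists>t. term_code t = c"
proof (induction c rule: less_induct)
  case (less c)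
  show ?case
  proof (cases c)
    case 0
    then show ?thesis by (intro exI[of _ TZero]) simp
  next
    case (Suc k)
    define q where "q = k div 3"
    consider "k = 3 * q" | "k = 3 * q + 1" | "k = 3 * q + 2"
      unfolding q_def by linarith
    then show ?thesis
    proof cases
      case 1
      with Suc show ?thesis by (intro exI[of _ "TVar q"]) simp
    next
      case 2
      with Suc less[of q] obtain t where "term_code t = q" by auto
      with 2 Suc show ?thesis by (intro exI[of _ "TNeg t"]) simp
    next
      case 3
      have "pfst q < c" "psnd q < c" using pfst_le[of q] psnd_le[of q] 3 Suc by simp_all
      with less obtain s t where "term_code s = pfst q" "term_code t = psnd q" by metis
      with 3 Suc show ?thesis by (intro exI[of _ "TPlus s t"]) (simp add: pfst_def psnd_def)
    qed
  qed
qed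

definition decode_term :: "nat \<Rightarrow> mv_term" where "decode_term c = (THE t. term_code t = c)"

lemma decode_term_code [simp]: "decode_term (term_code t) = t"
  unfolding decode_term_def by (rule the_equality) (auto intro: term_code_inject)

lemma term_code_decode [simp]: "term_code (decode_term c) = c"
  using surj_term_code[of c] by auto

definition eval_code :: "nat \<Rightarrow> (nat \<Rightarrow> nat) \<Rightarrow> nat \<Rightarrow> nat" where
  "eval_code D \<rho> c = term_nat D \<rho> (decode_term c)"

lemma decode_term_eqI: "term_code t = c \<Longrightarrow> decode_term c = t" by auto

lemma eval_code_0: "eval_code D \<rho> 0 = 0"
  by (simp add: eval_code_def decode_term_eqI[of TZero])

text \<open>With the offsets 1, 2, 3 in \<open>term_code\<close>, the predecessor of a nonzero code
  has the constructor as its residue modulo 3 and the coded argument as its quotient.\<close>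

lemma eval_code_Suc:
  "eval_code D \<rho> (Suc k) = (if k mod 3 = 0 then \<rho> (k div 3) else if k mod 3 = 1 then D - eval_code D \<rho> (k div 3)
    else min D (eval_code D \<rho> (pfst (k div 3)) + eval_code D \<rho> (psnd (k div 3))))"
proof -
  define q where "q = k div 3"
  have k: "k = 3 * q + k mod 3" by (simp add: q_def)
  have "k mod 3 = 0 \<or> k mod 3 = 1 \<or> k mod 3 = 2" by linarith
  then consider "k mod 3 = 0" | "k mod 3 = 1" | "k mod 3 = 2" by (elim disjE)
  then show ?thesis unfolding q_def[symmetric]
  proof cases
    case 1
    with k have "decode_term (Suc k) = TVar q" by (intro decode_term_eqI) simp
    with 1 show "eval_code D \<rho> (Suc k) = (if k mod 3 = 0 then \<rho> q else if k mod 3 = 1 then D - eval_code D \<rho> q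
        else min D (eval_code D \<rho> (pfst q) + eval_code D \<rho> (psnd q)))"
      by (simp add: eval_code_def)
  next
    case 2
    with k have "decode_term (Suc k) = TNeg (decode_term q)" by (intro decode_term_eqI) simp
    with 2 show "eval_code D \<rho> (Suc k) = (if k mod 3 = 0 then \<rho> q else if k mod 3 = 1 then D - eval_code D \<rho> q
        else min D (eval_code D \<rho> (pfst q) + eval_code D \<rho> (psnd q)))"
      by (simp add: eval_code_def)
  next
    case 3
    with k have "decode_term (Suc k) = TPlus (decode_term (pfst q)) (decode_term (psnd q))"
      by (intro decode_term_eqI) (simp add: pfst_def psnd_def)
    with 3 show "eval_code D \<rho> (Suc k) = (if k mod 3 = 0 then \<rho> q else if k mod 3 = 1 then D - eval_code D \<rho> q
        else min D (eval_code D \<rho> (pfst q) + eval_code D \<rho> (psnd q)))"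
      by (simp add: eval_code_def)
  qed
qed

text \<open>Course-of-values recursion: \<open>eval_table D \<rho> c\<close> encodes the list of the values at the codes
  \<open>c - 1, \<dots>, 0\<close>.\<close>

definition eval_step :: "nat \<Rightarrow> (nat \<Rightarrow> nat) \<Rightarrow> nat \<Rightarrow> nat \<Rightarrow> nat" where
  "eval_step D \<rho> c r = (if c = 0 then 0 else if (c - 1) mod 3 = 0 then \<rho> ((c - 1) div 3)
     else if (c - 1) mod 3 = 1 then D - nth_code (c - 1 - (c - 1) div 3) r
     else min D (nth_code (c - 1 - pfst ((c - 1) div 3)) r + nth_code (c - 1 - psnd ((c - 1) div 3)) r))"

definition eval_table :: "nat \<Rightarrow> (nat \<Rightarrow> nat) \<Rightarrow> nat \<Rightarrow> nat" where
  "eval_table D \<rho> c = rec_nat 0 (\<lambda>k r. Suc (pair (eval_step D \<rho> k r) r)) c"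

lemma eval_table: "eval_table D \<rho> c = list_encode (map (eval_code D \<rho>) (rev [0..<c]))"
proof (induction c)
  case (Suc c)
  \<comment> \<open>The table lists the values in decreasing order of codes, so the value at code
    \<open>j\<close> sits at index \<open>c - 1 - j\<close>.\<close>
  have look: "nth_code (c - 1 - j) (eval_table D \<rho> c) = eval_code D \<rho> j" if "j < c" for j
    unfolding Suc nth_code_list using that by (simp add: rev_nth)
  have "eval_step D \<rho> c (eval_table D \<rho> c) = eval_code D \<rho> c"
  proof (cases c)
    case 0
    then show ?thesis by (simp add: eval_step_def eval_code_0)
  next
    case k: (Suc k)
    define q where "q = k div 3"
    have "q \<le> k" "pfst q \<le> k" "psnd q \<le> k"
      using pfst_le[of q] psnd_le[of q] by (auto simp: q_def intro: order_trans div_le_dividend)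
    then have lt: "q < c" "pfst q < c" "psnd q < c" using k by auto
    have ck: "c - 1 = k" using k by simp
    show ?thesis
      using look[OF lt(1)] look[OF lt(2)] look[OF lt(3)] k
      unfolding eval_step_def ck by (simp add: eval_code_Suc q_def[symmetric])
  qed
  then have "eval_table D \<rho> (Suc c) = Suc (pair (eval_code D \<rho> c) (eval_table D \<rho> c))"
    by (simp add: eval_table_def)
  then show ?case by (simp add: Suc pair_def)
qed (simp add: eval_table_def)

lemma recursive_eval_code [recursive_intros]:
  assumes "recursive D" "recursive c" "recursive (\<lambda>z. \<rho> (pfst z) (psnd z))"
  shows "recursive (\<lambda>x. eval_code (D x) (\<lambda>i. \<rho> i x) (c x))"
proof -
  have \<rho>: "recursive (\<lambda>x. \<rho> (f x) (g x))" if "recursive f" "recursive g" for f g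
    using recursive_comp[OF assms(3) recursive_pair[OF that]] by simp
  have "recursive (\<lambda>x. rec_nat 0 (\<lambda>k r. Suc (pair (eval_step (D x) (\<lambda>i. \<rho> i x) k r) r)) (Suc (c x)))"
    unfolding eval_step_def
    by (rule recursive_rec_nat) (intro recursive_intros assms(2) \<rho> recursive_comp[OF assms(1)])+
  \<comment> \<open>The head of the table with \<open>c + 1\<close> entries is the value at
    \<open>c\<close> itself.\<close>
  then have "recursive (\<lambda>x. nth_code 0 (eval_table (D x) (\<lambda>i. \<rho> i x) (Suc (c x))))"
    unfolding eval_table_def by (intro recursive_intros)
  then show ?thesis unfolding eval_table nth_code_list by simp
qed

text \<open>Digits in base \<open>E + 1\<close> encode a point of the grid {0..E}^n by one number
  below (E + 1)^n, which turns quantification over the grid into a bounded numerical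
  quantifier.\<close>

definition digit :: "nat \<Rightarrow> nat \<Rightarrow> nat \<Rightarrow> nat" where
  "digit E w i = (w div (E + 1) ^ i) mod (E + 1)"

lemma digit_le: "digit E w i \<le> E"
  by (simp add: digit_def flip: less_Suc_eq_le)

lemma digit_exists:
  assumes "\<And>i. i < n \<Longrightarrow> v i \<le> E"
  shows "\<exists>w<(E + 1) ^ n. \<forall>i<n. digit E w i = v i"
  using assms
proof (induction n arbitrary: v)
  case (Suc n)
  have "\<exists>w<(E + 1) ^ n. \<forall>i<n. digit E w i = v (Suc i)"
    by (rule Suc.IH) (use Suc.prems in auto)
  then obtain w where w: "w < (E + 1) ^ n" "\<And>i. i < n \<Longrightarrow> digit E w i = v (Suc i)" by blast
  have v0: "v 0 < E + 1" using Suc.prems[of 0] by simp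
  have "digit E (v 0 + (E + 1) * w) i = v i" if "i < Suc n" for i
  proof (cases i)
    case 0
    then show ?thesis using v0 by (simp add: digit_def del: mult_Suc)
  next
    case (Suc j)
    have "(v 0 + (E + 1) * w) div (E + 1) ^ Suc j = (v 0 + (E + 1) * w) div (E + 1) div (E + 1) ^ j"
      by (simp only: power_Suc div_mult2_eq)
    also have "(v 0 + (E + 1) * w) div (E + 1) = w"
      using v0 div_less[OF v0] by (subst div_mult_self2) simp_all
    finally show ?thesis using w(2)[of j] Suc that by (simp add: digit_def)
  qed
  moreover have "v 0 + (E + 1) * w < (E + 1) ^ Suc n"
  proof -
    have "v 0 + (E + 1) * w < (E + 1) * (w + 1)" using v0 by simp
    also have "\<dots> \<le> (E + 1) * (E + 1) ^ n" using w(1) by (intro mult_le_mono) simp_all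
    finally show ?thesis by simp
  qed
  ultimately show ?case by blast
qed simp

lemma recursive_digit [recursive_intros]:
  "recursive E \<Longrightarrow> recursive w \<Longrightarrow> recursive i \<Longrightarrow> recursive (\<lambda>x. digit (E x) (w x) (i x))"
  unfolding digit_def by (intro recursive_intros)

section \<open>The decision procedure\<close>

text \<open>\<open>E\<close> and \<open>w\<close> encode the point with coordinates \<open>digit E w i / E\<close>; its image, but not the point
  itself, has a denominator dividing \<open>D\<close>.\<close>

definition refutes :: "nat \<Rightarrow> nat \<Rightarrow> nat \<Rightarrow> nat \<Rightarrow> nat \<Rightarrow> bool" where
  "refutes E D w n c \<longleftrightarrow> 0 < E \<and> (\<forall>j<c. E dvd D * eval_code E (\<lambda>i. digit E w i) (nth_code j c)) \<and>
    \<not> (\<forall>i<n. E dvd D * digit E w i)"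

text \<open>\<open>s\<close> encodes terms that recover the coordinates from the generators.\<close>

definition confirms :: "nat \<Rightarrow> nat \<Rightarrow> nat \<Rightarrow> bool" where
  "confirms s n c \<longleftrightarrow> (\<forall>w<(grid_size n ((s + 1) * (c + 1) + 1) + 1) ^ n. \<forall>i<n.
    eval_code (grid_size n ((s + 1) * (c + 1) + 1))
      (\<lambda>j. eval_code (grid_size n ((s + 1) * (c + 1) + 1)) (\<lambda>i. digit (grid_size n ((s + 1) * (c + 1) + 1)) w i) (nth_code j c))
      (nth_code i s) = digit (grid_size n ((s + 1) * (c + 1) + 1)) w i)"

lemma decidable_refutes:
  assumes "recursive E" "recursive D" "recursive w" "recursive n" "recursive c"
  shows "decidable (\<lambda>x. refutes (E x) (D x) (w x) (n x) (c x))"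
  unfolding refutes_def
  by (intro recursive_intros assms recursive_comp[OF assms(1)] recursive_comp[OF assms(2)]
    recursive_comp[OF assms(3)] recursive_comp[OF assms(4)] recursive_comp[OF assms(5)])

lemma decidable_confirms:
  assumes "recursive s" "recursive n" "recursive c"
  shows "decidable (\<lambda>x. confirms (s x) (n x) (c x))"
  unfolding confirms_def grid_size_def
  by (intro recursive_intros assms recursive_comp[OF assms(1)] recursive_comp[OF assms(2)] recursive_comp[OF assms(3)])

text \<open>Minimisation finds the least certificate, and \<open>Q\<close> then tells which kind it
  is. The test for \<open>P\<close> is total and 0 exactly at certificates, so the search halts as
  soon as one exists.\<close>

lemma computable_search:
  assumes P: "decidable (\<lambda>x. P (pfst x) (pfst (psnd x)) (psnd (psnd x)))"
    and Q: "decidable (\<lambda>x. Q (pfst x) (pfst (psnd x)) (psnd (psnd x)))"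
  shows "\<exists>r. \<forall>n c. (\<exists>z. P z n c) \<longrightarrow> computes r [n, c] (of_bool (Q (LEAST z. P z n c) n c))"
proof -
  have three: "computable 3 (\<lambda>xs. f (xs ! 0) (xs ! 1) (xs ! 2))"
    if "recursive (\<lambda>x. f (pfst x) (pfst (psnd x)) (psnd (psnd x)))" for f
    using recursive_app[OF that, of 3 "\<lambda>xs. pair (xs ! 0) (pair (xs ! 1) (xs ! 2))"]
    by (simp add: computable_pair computable_proj)
  have "recursive (\<lambda>x. 1 - of_bool (P (pfst x) (pfst (psnd x)) (psnd (psnd x))))"
    by (intro recursive_intros P)
  from three[OF this] obtain p where "\<And>xs. length xs = 3 \<Longrightarrow> computes p xs (1 - of_bool (P (xs ! 0) (xs ! 1) (xs ! 2)))"
    unfolding computable_def by blast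
  from this[of "[_, _, _]"] have p: "computes p [z, n, c] (1 - of_bool (P z n c))" for z n c by simp
  have "recursive (\<lambda>x. of_bool (Q (pfst x) (pfst (psnd x)) (psnd (psnd x))))"
    by (intro recursive_intros Q)
  from three[OF this] obtain q where "\<And>xs. length xs = 3 \<Longrightarrow> computes q xs (of_bool (Q (xs ! 0) (xs ! 1) (xs ! 2)))"
    unfolding computable_def by blast
  from this[of "[_, _, _]"] have q: "computes q [z, n, c] (of_bool (Q z n c))" for z n c by simp
  have "computes (Comp q [Mini p, Proj 0, Proj 1]) [n, c] (of_bool (Q (LEAST z. P z n c) n c))"
    if ex: "\<exists>z. P z n c" for n c
  proof (rule computes.Comp[where ys = "[LEAST z. P z n c, n, c]"])
    have "computes (Mini p) [n, c] (LEAST z. P z n c)"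
    proof (rule computes.Mini)
      have "P (LEAST z. P z n c) n c" using ex by (rule LeastI_ex)
      then show "computes p [LEAST z. P z n c, n, c] 0" using p[of "LEAST z. P z n c" n c] by simp
      show "\<forall>y<LEAST z. P z n c. \<exists>v. computes p [y, n, c] (Suc v)"
      proof (intro allI impI)
        fix y assume "y < (LEAST z. P z n c)"
        then have "\<not> P y n c" by (rule not_less_Least)
        then show "\<exists>v. computes p [y, n, c] (Suc v)" using p[of y n c] by (intro exI[of _ 0]) simp
      qed
    qed
    then show "list_all2 (\<lambda>g y. computes g [n, c] y) [Mini p, Proj 0, Proj 1] [LEAST z. P z n c, n, c]"
      using computes.Proj[of 0 "[n, c]"] computes.Proj[of 1 "[n, c]"] by simp
  qed (rule q)
  then show ?thesis by blast
qed

lemma term_nat_cong: "(\<And>i. i \<in> term_vars t \<Longrightarrow> \<rho> i = \<rho>' i) \<Longrightarrow> term_nat D \<rho> t = term_nat D \<rho>' t"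
  by (induction t) simp_all

lemma real_multiple_Ints_iff:
  assumes "E > 0" shows "real D * (real a / real E) \<in> \<int> \<longleftrightarrow> E dvd D * a"
proof
  assume "real D * (real a / real E) \<in> \<int>"
  then obtain k where "real D * (real a / real E) = of_int k" by (auto elim: Ints_cases)
  then have "real (D * a) = of_int (k * int E)" using assms by (simp add: field_simps)
  then have "int (D * a) = k * int E" by (metis of_int_eq_iff of_int_of_nat_eq)
  then have "int E dvd int (D * a)" by simp
  then show "E dvd D * a" by (simp only: int_dvd_int_iff)
next
  assume "E dvd D * a"
  then obtain k where "D * a = E * k" by blast
  then have "real D * real a = real E * real k" by (metis of_nat_mult)
  then have "real D * (real a / real E) = real k" using assms by (simp add: field_simps)
  then show "real D * (real a / real E) \<in> \<int>" by simp
qed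

section \<open>Soundness and completeness of the certificates\<close>

locale generators =
  fixes n :: nat and ts :: "mv_term list"
  assumes vars: "\<And>t. t \<in> set ts \<Longrightarrow> term_vars t \<subseteq> {..<n}"
    and separating: "\<And>x y. x \<in> cube n \<Longrightarrow> y \<in> cube n \<Longrightarrow> \<forall>f\<in>term_function n ` set ts. f x = f y \<Longrightarrow> x = y"
begin

abbreviation "G \<equiv> term_function n ` set ts"

abbreviation "c \<equiv> terms_code ts"

text \<open>The default \<open>TZero\<close> agrees with what decoding yields at an index beyond the
  list.\<close>

definition \<theta> :: "nat \<Rightarrow> mv_term" where "\<theta> j = (if j < length ts then ts ! j else TZero)"

lemma G: "G \<subseteq> mcnaughton_functions n"
  using term_function_mcnaughton vars by (fastforce simp: mcnaughton_def)

lemma decode_nth: "decode_term (nth_code j c) = \<theta> j"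
  by (auto simp: terms_code_def nth_code_list \<theta>_def decode_term_eqI[of TZero])

lemma vars_\<theta>: "term_vars (\<theta> j) \<subseteq> {..<n}"
  using vars by (auto simp: \<theta>_def)

lemma refutes_iff:
  "refutes E D w n c \<longleftrightarrow> 0 < E \<and> (\<forall>f\<in>G. real D * f (grid_point n E (digit E w)) \<in> \<int>) \<and>
    \<not> (\<forall>i<n. real D * grid_point n E (digit E w) i \<in> \<int>)"
proof (cases "E = 0")
  case False
  then have E: "E > 0" by simp
  have y: "grid_point n E (digit E w) \<in> cube n" by (rule grid_point_cube) (rule digit_le)
  have eval: "term_real (grid_point n E (digit E w)) t = real (term_nat E (digit E w) t) / real E"
    if "term_vars t \<subseteq> {..<n}" for t
  proof -
    have "term_real (grid_point n E (digit E w)) t = term_real (\<lambda>i. real (digit E w i) / real E) t"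
      by (rule term_real_cong) (use that in \<open>auto simp: grid_point_def\<close>)
    with term_nat_real[OF E, of t "digit E w"] digit_le show ?thesis by simp
  qed
  have "(\<forall>j<c. E dvd D * eval_code E (digit E w) (nth_code j c)) \<longleftrightarrow> (\<forall>j<c. real D * term_real (grid_point n E (digit E w)) (\<theta> j) \<in> \<int>)"
    unfolding eval_code_def decode_nth using real_multiple_Ints_iff[OF E] eval[OF vars_\<theta>] by simp
  also have "\<dots> \<longleftrightarrow> (\<forall>t\<in>set ts. real D * term_real (grid_point n E (digit E w)) t \<in> \<int>)"
  proof -
    \<comment> \<open>The code \<open>c\<close> of the list bounds its length. The surplus indices
      decode to \<open>TZero\<close>, whose value 0 satisfies the condition trivially.\<close>
    have "length ts \<le> c" using length_le_code[of "map term_code ts"] by (simp add: terms_code_def)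
    then show ?thesis by (auto simp: \<theta>_def set_conv_nth)
  qed
  also have "\<dots> \<longleftrightarrow> (\<forall>f\<in>G. real D * f (grid_point n E (digit E w)) \<in> \<int>)"
    using y by (simp add: term_function_eq)
  finally have 1: "(\<forall>j<c. E dvd D * eval_code E (digit E w) (nth_code j c)) \<longleftrightarrow> \<dots>" .
  have 2: "(\<forall>i<n. E dvd D * digit E w i) \<longleftrightarrow> (\<forall>i<n. real D * grid_point n E (digit E w) i \<in> \<int>)"
    using real_multiple_Ints_iff[OF E] by (simp add: grid_point_def)
  show ?thesis unfolding refutes_def 1 2 ..
qed (simp add: refutes_def)

lemma refutes_exists_iff: "(\<exists>E D w. refutes E D w n c) \<longleftrightarrow> \<not> preserves_denominators n G"
proof
  assume "\<exists>E D w. refutes E D w n c"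
  then show "\<not> preserves_denominators n G"
    unfolding refutes_iff preserves_denominators_def using digit_le by blast
next
  assume "\<not> preserves_denominators n G"
  then obtain E D v where *: "E > 0" "\<forall>i<n. v i \<le> E" "\<forall>f\<in>G. real D * f (grid_point n E v) \<in> \<int>"
    "\<not> (\<forall>i<n. real D * grid_point n E v i \<in> \<int>)"
    unfolding preserves_denominators_def by blast
  obtain w where w: "\<forall>i<n. digit E w i = v i" using digit_exists[of n v E] *(2) by blast
  then have "grid_point n E (digit E w) = grid_point n E v" by (auto simp: grid_point_def fun_eq_iff)
  with *(1,3,4) have "refutes E D w n c" unfolding refutes_iff by simp
  then show "\<exists>E D w. refutes E D w n c" by blast
qed

text \<open>The certificate checks the recovery of the coordinates on a finite grid only;
  \<open>term_coordinate_grid\<close> extends it to the cube. A coordinate that is a term in the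
  generator values inherits every denominator that clears these values.\<close>

lemma confirms_sound:
  assumes "confirms s n c" shows "preserves_denominators n G"
  unfolding preserves_denominators_def
proof (intro allI impI)
  fix E D :: nat and v i
  assume E: "0 < E" and v: "\<forall>i<n. v i \<le> E" and int: "\<forall>f\<in>G. real D * f (grid_point n E v) \<in> \<int>" and i: "i < n"
  let ?y = "grid_point n E v" and ?\<sigma> = "decode_term (nth_code i s)"
  \<comment> \<open>A term has size at most its code plus 1, and codes of list entries are at most
    the code of the list. Substitution thus gives size at most \<open>(s + 1) * (c + 1)\<close>, and
    the final 1 makes the bound strict.\<close>
  define K where "K = (s + 1) * (c + 1) + 1"
  let ?t = "subst ?\<sigma> \<theta>"
  have y: "?y \<in> cube n" using v by (intro grid_point_cube) simp
  have "term_real ?y ?t = ?y i"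
  proof (rule term_coordinate_grid[where n = n and K = K])
    show "term_vars ?t \<subseteq> {..<n}" using vars_\<theta> by (auto simp: term_vars_subst)
    show "term_size ?t < K"
    proof -
      have "term_size (\<theta> j) \<le> c + 1" for j
        using term_size_le_code[of "\<theta> j"] nth_code_le[of j c] by (simp add: decode_nth[symmetric])
      then have "term_size ?t \<le> term_size ?\<sigma> * (c + 1)" by (rule term_size_subst) simp
      also have "\<dots> \<le> (s + 1) * (c + 1)"
        using term_size_le_code[of ?\<sigma>] nth_code_le[of i s] by (intro mult_le_mono1) simp
      finally show ?thesis by (simp add: K_def)
    qed
    show "0 \<le> ?y j \<and> ?y j \<le> 1" if "j < n" for j using y that by (simp add: cube_iff)
    show "term_nat (grid_size n K) u ?t = u i" if u: "\<And>j. j < n \<Longrightarrow> u j \<le> grid_size n K" for u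
    proof -
      let ?D = "grid_size n K"
      have "\<exists>w<(?D + 1) ^ n. \<forall>j<n. digit ?D w j = u j" by (rule digit_exists[OF u])
      then obtain w where w: "w < (?D + 1) ^ n" "\<And>j. j < n \<Longrightarrow> digit ?D w j = u j" by blast
      have "term_nat ?D u ?t = term_nat ?D (digit ?D w) ?t"
        by (rule term_nat_cong) (use w(2) subsetD[OF vars_\<theta>] in \<open>auto simp: term_vars_subst\<close>)
      also have "\<dots> = digit ?D w i"
        using assms w(1) i unfolding confirms_def K_def[symmetric] by (simp add: eval_code_def decode_nth term_nat_subst)
      finally show ?thesis using w(2) i by simp
    qed
  qed (rule i)
  moreover have "real D * term_real ?y ?t \<in> \<int>"
    unfolding term_real_subst
  proof (rule term_real_Ints)
    fix j show "real D * term_real ?y (\<theta> j) \<in> \<int>"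
      using int y by (auto simp: \<theta>_def term_function_eq)
  qed
  ultimately show "real D * ?y i \<in> \<int>" by simp
qed

text \<open>Terms recovering the coordinates on the whole cube do so on the grid of every positive
  denominator; of \<open>grid_size\<close> only positivity enters.\<close>

lemma confirms_complete:
  assumes "alg n G = mcnaughton_functions n" shows "\<exists>s. confirms s n c"
proof -
  have "\<forall>i\<in>{..<n}. \<exists>\<sigma>. term_vars \<sigma> \<subseteq> {..<length ts} \<and> (\<forall>x\<in>cube n. x i = term_real (\<lambda>j. term_real x (\<theta> j)) \<sigma>)"
  proof
    fix i assume "i \<in> {..<n}"
    then have "(\<lambda>x\<in>cube n. x i) \<in> alg n (set (map (term_function n) ts))"
      using assms mcnaughton_coordinate by simp
    from generated_by_terms[OF this] obtain \<sigma> where \<sigma>: "term_vars \<sigma> \<subseteq> {..<length ts}"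
      "\<And>x. x \<in> cube n \<Longrightarrow> x i = term_real (\<lambda>j. (map (term_function n) ts ! j) x) \<sigma>" by auto
    have "x i = term_real (\<lambda>j. term_real x (\<theta> j)) \<sigma>" if "x \<in> cube n" for x
      unfolding \<sigma>(2)[OF that]
      by (rule term_real_cong) (use \<sigma>(1) that in \<open>auto simp: \<theta>_def term_function_eq\<close>)
    with \<sigma>(1) show "\<exists>\<sigma>. term_vars \<sigma> \<subseteq> {..<length ts} \<and> (\<forall>x\<in>cube n. x i = term_real (\<lambda>j. term_real x (\<theta> j)) \<sigma>)" by blast
  qed
  from bchoice[OF this] obtain \<sigma> where
    \<sigma>: "\<And>i x. i < n \<Longrightarrow> x \<in> cube n \<Longrightarrow> x i = term_real (\<lambda>j. term_real x (\<theta> j)) (\<sigma> i)" by blast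
  define s where "s = list_encode (map (\<lambda>i. term_code (\<sigma> i)) [0..<n])"
  have "eval_code D (\<lambda>j. eval_code D (digit D w) (nth_code j c)) (nth_code i s) = digit D w i"
    if D: "D > 0" and i: "i < n" for D w i
  proof -
    have s: "decode_term (nth_code i s) = \<sigma> i" using i by (simp add: s_def nth_code_list)
    let ?y = "grid_point n D (digit D w)"
    have y: "?y \<in> cube n" by (rule grid_point_cube) (rule digit_le)
    have "real (digit D w i) / real D = ?y i" using i by (simp add: grid_point_def)
    also have "\<dots> = term_real ?y (subst (\<sigma> i) \<theta>)" unfolding term_real_subst by (rule \<sigma>[OF i y])
    also have "\<dots> = term_real (\<lambda>i. real (digit D w i) / real D) (subst (\<sigma> i) \<theta>)"
      by (rule term_real_cong) (use vars_\<theta> in \<open>auto simp: term_vars_subst grid_point_def\<close>)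
    also have "\<dots> = real (term_nat D (digit D w) (subst (\<sigma> i) \<theta>)) / real D"
      using term_nat_real[OF D, of "subst (\<sigma> i) \<theta>" "digit D w"] digit_le by simp
    finally have "real (digit D w i) = real (term_nat D (digit D w) (subst (\<sigma> i) \<theta>))" using D by simp
    then show ?thesis unfolding eval_code_def decode_nth s term_nat_subst by simp
  qed
  moreover have "grid_size n K > 0" for K by (simp add: grid_size_def)
  ultimately have "confirms s n c" unfolding confirms_def by simp
  then show ?thesis ..
qed

end

theorem theorem4p8:
  shows "\<exists>r. \<forall>n ts.
    (\<forall>t\<in>set ts. term_vars t \<subseteq> {..<n}) \<and>
    separating n (carrier (mv_generated (mcnaughton n) (term_function n ` set ts))) \<longrightarrow>
    computes r [n, terms_code ts]
      (if mv_isomorphic (mv_generated (mcnaughton n) (term_function n ` set ts)) (mcnaughton n)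
       then 1 else 0)"
proof -
  \<comment> \<open>One number \<open>z\<close> is read in two ways: as a list of terms that
    confirms, and as a triple \<open>E\<close>, \<open>D\<close>, \<open>w\<close> that
    refutes.\<close>
  let ?P = "\<lambda>z n c. confirms z n c \<or> refutes (pfst z) (pfst (psnd z)) (psnd (psnd z)) n c"
  have "decidable (\<lambda>x. ?P (pfst x) (pfst (psnd x)) (psnd (psnd x)))"
    by (intro decidable_disj decidable_confirms decidable_refutes recursive_intros)
  moreover have "decidable (\<lambda>x. confirms (pfst x) (pfst (psnd x)) (psnd (psnd x)))"
    by (intro decidable_confirms recursive_intros)
  ultimately obtain r where r: "\<And>n c. \<exists>z. ?P z n c \<Longrightarrow> computes r [n, c] (of_bool (confirms (LEAST z. ?P z n c) n c))"
    using computable_search[of ?P confirms] by blast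
  show ?thesis
  proof (intro exI[of _ r] allI impI)
    fix n ts
    let ?G = "term_function n ` set ts" and ?c = "terms_code ts"
    let ?iso = "mv_isomorphic (mv_generated (mcnaughton n) ?G) (mcnaughton n)"
    assume asm: "(\<forall>t\<in>set ts. term_vars t \<subseteq> {..<n}) \<and> separating n (carrier (mv_generated (mcnaughton n) ?G))"
    interpret generators n ts
    proof
      show "x = y" if "x \<in> cube n" "y \<in> cube n" "\<forall>f\<in>?G. f x = f y" for x y
      proof (rule ccontr)
        assume "x \<noteq> y"
        with asm that(1,2) have "\<exists>f\<in>alg n ?G. f x \<noteq> f y"
          by (simp add: separating_def mv_generated_def)
        with generated_separates[OF _ that] show False by blast
      qed
    qed (use asm in blast)
    have iso: "?iso \<longleftrightarrow> preserves_denominators n ?G" "preserves_denominators n ?G \<longleftrightarrow> alg n ?G = mcnaughton_functions n"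
      by (rule isomorphic_iff_denominators[OF _ G separating]; simp)+
    have "\<exists>z. ?P z n ?c"
    proof (cases ?iso)
      case True
      then show ?thesis using confirms_complete iso by blast
    next
      case False
      then obtain E D w where "refutes E D w n ?c" using refutes_exists_iff iso by blast
      then show ?thesis by (intro exI[of _ "pair E (pair D w)"]) simp
    qed
    then have P: "?P (LEAST z. ?P z n ?c) n ?c" by (rule LeastI_ex)
    \<comment> \<open>The least certificate may be of either kind, and both kinds are sound;
      completeness was needed only for its existence.\<close>
    have "confirms (LEAST z. ?P z n ?c) n ?c \<longleftrightarrow> ?iso"
      using P confirms_sound refutes_exists_iff iso(1) by blast
    with r[OF \<open>\<exists>z. ?P z n ?c\<close>] show "computes r [n, ?c] (if ?iso then 1 else 0)"
      by (simp add: of_bool_def)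
  qed
qed

end
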